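(* Let $q\in(0,1)$. For all $f_1,f_2\in\mathrm{Pol}(\mathbb{C})_q$ the following asymptotic expansion, as $t\to 0$ ($t\in(0,1)$), is valid in the topological vector space $D(\mathbb{U})_q'$: $$m_t(f_1,f_2)\ \underset{t\to 0}{\sim}\ f_1*f_2,$$ where $$f_1*f_2=f_1\cdot f_2+\sum_{k=1}^\infty C_k(f_1,f_2)\,t^k\in\mathrm{Pol}(\mathbb{C})_q[[t]],$$ $$C_k(f_1,f_2)=m_0\Big(\big(p_k(\widetilde{\square})-p_{k-1}(\widetilde{\square})\big)(f_1\otimes f_2)\Big),$$ and $p_k(x)$, $k\in\mathbb{Z}_+$, are the polynomials $$p_k(x)=\sum_{j=0}^k\frac{(q^{-2k};q^2)_j}{(q^2;q^2)_j^2}\,q^{2j}\prod_{i=0}^{j-1}\Big(1-q^{2i}\big((1-q^2)^2x+1+q^2\big)+q^{4i+2}\Big).$$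
   Context: The ground field is $\mathbb{C}$, $q\in(0,1)$, $\mathbb{Z}_+=\{0,1,2,\dots\}$, and $(a;q^2)_k=(1-a)(1-q^2a)\cdots(1-q^{2(k-1)}a)$ (empty product equal to $1$). **The algebra.** $\mathrm{Pol}(\mathbb{C})_q$ is the unital algebra with two generators $z,z^*$ and the single relation $z^*z=q^2zz^*+1-q^2$. The elements $\{z^jz^{*k}\}_{j,k\in\mathbb{Z}_+}$ form a basis of it. $\mathbb{C}[z]_q\subset \mathrm{Pol}(\mathbb{C})_q$ is the unital subalgebra generated by $z$. $D(\mathbb{U})_q'$ is the vector space of formal series $\sum_{j,k=0}^\infty a_{jk}z^jz^{*k}$ with complex coefficients, with the topology of coefficientwise convergence; $\mathrm{Pol}(\mathbb{C})_q$ is embedded in it via the basis $\{z^jz^{*k}\}_{j,k\in\mathbb{Z}_+}$ of $\mathrm{Pol}(\mathbb{C})_q$. An asymptotic expansion $F_t\sim\sum_{k\ge0}F_kt^k$ as $t\to0$ in $D(\mathbb{U})_q'$ means, as usual, that for every $N\in\mathbb{Z}_+$, $t^{-N}\big(F_t-\sum_{k=0}^NF_kt^k\big)\to0$ in $D(\mathbb{U})_q'$ as $t\to0$. **The maps $m_t$.** Let $\alpha>0$ and $t=q^{4\alpha}\in(0,1)$. Equip $\mathbb{C}[z]_q$ with the scalar product $(z^j,z^k)_\alpha=\delta_{jk}\dfrac{(q^2;q^2)_k}{(q^{4\alpha+2};q^2)_k}$, and let $L^2_a(d\nu_\alpha)_q$ be the Hilbert space completion. Let $\widehat z$ be the (bounded)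 operator of multiplication by $z$, $\psi(z)\mapsto z\psi(z)$, in $L^2_a(d\nu_\alpha)_q$, and $\widehat z^*$ its adjoint. Equip the space $\mathcal{L}_\alpha$ of bounded linear operators in $L^2_a(d\nu_\alpha)_q$ with the weakest topology in which all the functionals $A\mapsto(A\psi_1,\psi_2)_\alpha$, $\psi_1,\psi_2\in\mathbb{C}[z]_q$, are continuous. For every $\widehat f\in\mathcal{L}_\alpha$ there is a unique formal series $f=\sum_{j,k=0}^\infty a_{jk}z^jz^{*k}\in D(\mathbb{U})_q'$ with $\widehat f=\sum_{j,k=0}^\infty a_{jk}\widehat z^{\,j}\widehat z^{*k}$ (known fact); $f$ is called the covariant symbol of $\widehat f$. For $f_1,f_2\in\mathrm{Pol}(\mathbb{C})_q$ let $\widehat f_1,\widehat f_2\in\mathcal{L}_\alpha$ be the operators with covariant symbols $f_1,f_2$ (i.e. $f=\sum a_{jk}z^jz^{*k}$, a finite sum, gives $\widehat f=\sum a_{jk}\widehat z^{\,j}\widehat z^{*k}$). Then $m_t(f_1,f_2)\in D(\mathbb{U})_q'$ denotes the covariant symbol of the product $\widehat f_1\cdot\widehat f_2$. **Differential calculus.** $\Omega^1(\mathbb{C})_q$ is the first order differential calculus over $\mathrm{Pol}(\mathbb{C})_q$: a bimodule with a linear map $d:\mathrm{Pol}(\mathbb{C})_q\to\Omega^1(\mathbb{C})_q$ satisfying the Leibniz rule $d(f_1f_2)=df_1\cdot f_2+f_1\cdot df_2$, spanned by the elements $f_1\cdot df_2\cdot f_3$, and described by the commutation relations $$z\,dz=q^{-2}dz\,z,\quad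 z^*dz^*=q^2dz^*\,z^*,\quad z^*dz=q^2dz\,z^*,\quad z\,dz^*=q^{-2}dz^*\,z.$$ The partial derivatives are the linear operators in $\mathrm{Pol}(\mathbb{C})_q$ given by $$df=\frac{\partial^{(r)}f}{\partial z}dz+\frac{\partial^{(r)}f}{\partial z^*}dz^*=dz\frac{\partial^{(l)}f}{\partial z}+dz^*\frac{\partial^{(l)}f}{\partial z^*}.$$ **The operators $m_0$ and $\widetilde\square$.** $m_0:\mathrm{Pol}(\mathbb{C})_q^{\otimes2}\to\mathrm{Pol}(\mathbb{C})_q$ is $m_0(f_1\otimes f_2)=f_1f_2$, and $\widetilde\square:\mathrm{Pol}(\mathbb{C})_q^{\otimes2}\to\mathrm{Pol}(\mathbb{C})_q^{\otimes2}$ is the linear operator $$\widetilde\square(f_1\otimes f_2)=\Big(\frac{\partial^{(r)}f_1}{\partial z^*}\otimes1\Big)\cdot q^{-2}\big(1-(1+q^{-2})z^*\otimes z+q^{-2}z^{*2}\otimes z^2\big)\cdot\Big(1\otimes\frac{\partial^{(l)}f_2}{\partial z}\Big),$$ with products taken in the ordinary (componentwise) tensor product algebra. *)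

theory Defs
  imports
    "HOL-Analysis.Analysis"
    "HOL-Library.Poly_Mapping"
    "HOL-Computational_Algebra.Computational_Algebra"
begin

section \<open>Finitely supported families over the complex numbers\<close>

abbreviation "lookup \<equiv> Poly_Mapping.lookup"
abbreviation "keys \<equiv> Poly_Mapping.keys"
abbreviation "single \<equiv> Poly_Mapping.single"

definition cscale :: "complex \<Rightarrow> ('a \<Rightarrow>\<^sub>0 complex) \<Rightarrow> ('a \<Rightarrow>\<^sub>0 complex)"  (infixr "*\<^sub>C" 75)
  where "c *\<^sub>C f = Poly_Mapping.map ((*) c) f"

lemma lookup_cscale [simp]: "lookup (c *\<^sub>C f) x = c * lookup f x"
  by (simp add: cscale_def Poly_Mapping.map.rep_eq when_def)

interpretation cvec: vector_space "cscale :: complex \<Rightarrow> ('a \<Rightarrow>\<^sub>0 complex) \<Rightarrow> _"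
  by unfold_locales (auto intro!: poly_mapping_eqI simp: lookup_add algebra_simps)

text \<open>The linear map with prescribed values \<open>\<phi> b\<close> on the basis vectors \<open>single b 1\<close>; the
  scalar multiplication \<open>s\<close> of the target space is explicit.\<close>

definition lin :: "(complex \<Rightarrow> 'v \<Rightarrow> 'v) \<Rightarrow> ('a \<Rightarrow> 'v) \<Rightarrow> ('a \<Rightarrow>\<^sub>0 complex) \<Rightarrow> 'v::comm_monoid_add"
  where "lin s \<phi> f = (\<Sum>b\<in>keys f. s (lookup f b) (\<phi> b))"

lemma lin_superset:
  assumes "vector_space s" "finite S" "keys f \<subseteq> S"
  shows "lin s \<phi> f = (\<Sum>b\<in>S. s (lookup f b) (\<phi> b))"
proof -
  interpret vector_space s by fact
  show ?thesis unfolding lin_def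
    by (rule sum.mono_neutral_left) (use assms in \<open>auto simp: in_keys_iff\<close>)
qed

lemma linear_lin:
  assumes "vector_space s"
  shows "Vector_Spaces.linear cscale s (lin s \<phi>)"
proof -
  interpret vector_space s by fact
  show ?thesis
  proof (unfold_locales)
    fix f g :: "'b \<Rightarrow>\<^sub>0 complex"
    let ?S = "keys f \<union> keys g"
    have "lin s \<phi> (f + g) = (\<Sum>b\<in>?S. s (lookup (f + g) b) (\<phi> b))"
      by (rule lin_superset) (use assms in \<open>auto simp: Poly_Mapping.keys_add\<close>)
    also have "\<dots> = (\<Sum>b\<in>?S. s (lookup f b) (\<phi> b)) + (\<Sum>b\<in>?S. s (lookup g b) (\<phi> b))"
      by (simp add: lookup_add scale_left_distrib sum.distrib)
    also have "\<dots> = lin s \<phi> f + lin s \<phi> g"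
      by (simp add: lin_superset[OF assms, of ?S])
    finally show "lin s \<phi> (f + g) = lin s \<phi> f + lin s \<phi> g" .
  next
    fix c and f :: "'b \<Rightarrow>\<^sub>0 complex"
    have "lin s \<phi> (c *\<^sub>C f) = (\<Sum>b\<in>keys f. s (lookup (c *\<^sub>C f) b) (\<phi> b))"
      by (rule lin_superset) (use assms in \<open>auto simp: in_keys_iff\<close>)
    then show "lin s \<phi> (c *\<^sub>C f) = s c (lin s \<phi> f)"
      by (simp add: lin_def scale_sum_right)
  qed
qed

lemma lin_single [simp]:
  assumes "vector_space s"
  shows "lin s \<phi> (single b 1) = \<phi> b"
proof -
  interpret vector_space s by fact
  show ?thesis by (simp add: lin_def)
qed

lemma linear_eqI:
  assumes f: "Vector_Spaces.linear cscale s f" and g: "Vector_Spaces.linear cscale s g"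
    and eq: "\<And>b. f (single b 1) = g (single b 1)"
  shows "f x = g x"
proof -
  interpret f: Vector_Spaces.linear cscale s f by fact
  interpret g: Vector_Spaces.linear cscale s g by fact
  have x: "x = (\<Sum>b\<in>keys x. lookup x b *\<^sub>C single b 1)"
    by (rule poly_mapping_eqI)
      (auto simp: lookup_sum lookup_single when_def in_keys_iff if_distrib[of "(*) _"]
            cong: if_cong)
  show ?thesis
    by (subst (1 2) x) (simp only: f.sum g.sum f.scale g.scale eq)
qed

lemma linear_lin_fun:
  assumes "vector_space s" "\<And>b. Vector_Spaces.linear cscale s (\<lambda>g. \<phi> g b)"
  shows "Vector_Spaces.linear cscale s (\<lambda>g. lin s (\<phi> g) f)"
proof -
  interpret vector_space s by fact
  note l = assms(2)[unfolded Vector_Spaces.linear_iff]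
  show ?thesis
    unfolding Vector_Spaces.linear_iff lin_def
    using l by (auto simp: scale_right_distrib sum.distrib scale_sum_right mult.commute)
qed

lemmas linear_clin = linear_lin[OF cvec.vector_space_axioms]
lemmas linear_clin_fun = linear_lin_fun[OF cvec.vector_space_axioms]
lemmas clin_single [simp] = lin_single[OF cvec.vector_space_axioms]

lemma linear_ident: "Vector_Spaces.linear cscale cscale (\<lambda>f. f)"
  unfolding Vector_Spaces.linear_iff by (simp add: cvec.vector_space_axioms)

lemma linear_compose_c:
  assumes "Vector_Spaces.linear cscale cscale f" "Vector_Spaces.linear cscale s g"
  shows "Vector_Spaces.linear cscale s (\<lambda>x. g (f x))"
  using Vector_Spaces.linear_compose[OF assms] by (simp add: comp_def)

section \<open>The algebra \<open>Pol(\<complex>)\<^sub>q\<close>\<close>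

text \<open>An element is stored by its coefficients in the basis \<open>z\<^sup>j z*\<^sup>k\<close>, indexed by \<open>(j, k)\<close>. Only the
  multiplication depends on \<open>q\<close>; the library multiplication on \<^typ>\<open>(nat \<times> nat) \<Rightarrow>\<^sub>0 complex\<close>
  (commuting variables) is not used.\<close>

type_synonym pol = "(nat \<times> nat) \<Rightarrow>\<^sub>0 complex"

definition pmono :: "nat \<Rightarrow> nat \<Rightarrow> pol" where "pmono j k = single (j, k) 1"

definition pol_one :: pol where "pol_one = pmono 0 0"
definition pol_z :: pol where "pol_z = pmono 1 0"
definition pol_zs :: pol where "pol_zs = pmono 0 1"

text \<open>Left multiplication by \<open>z\<close> and by \<open>z*\<close>. The defining relation \<open>z* z = q\<^sup>2 z z* + 1 - q\<^sup>2\<close> gives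
  \<open>z* z\<^sup>l = q\<^sup>2\<^sup>l z\<^sup>l z* + (1 - q\<^sup>2\<^sup>l) z\<^sup>l\<^sup>-\<^sup>1\<close>.\<close>

definition mult_z :: "pol \<Rightarrow> pol" where
  "mult_z = lin cscale (\<lambda>(l, m). pmono (l + 1) m)"

definition mult_zs :: "real \<Rightarrow> pol \<Rightarrow> pol" where
  "mult_zs q = lin cscale (\<lambda>(l, m). of_real (q ^ (2 * l)) *\<^sub>C pmono l (m + 1)
                                    + of_real (1 - q ^ (2 * l)) *\<^sub>C pmono (l - 1) m)"

definition pol_mult :: "real \<Rightarrow> pol \<Rightarrow> pol \<Rightarrow> pol" where
  "pol_mult q f g = lin cscale (\<lambda>(j, k). (mult_z ^^ j) ((mult_zs q ^^ k) g)) f"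

lemma lin_mono [simp]: "vector_space s \<Longrightarrow> lin s \<phi> (pmono j k) = \<phi> (j, k)"
  by (simp add: pmono_def)
lemmas clin_mono [simp] = lin_mono[OF cvec.vector_space_axioms]

lemma pol_eqI:
  assumes "Vector_Spaces.linear cscale s F" "Vector_Spaces.linear cscale s G"
    and "\<And>j k. F (pmono j k) = G (pmono j k)"
  shows "F f = G f"
  using linear_eqI[OF assms(1,2)] assms(3) by (auto simp: pmono_def)

lemma linear_mult_z: "Vector_Spaces.linear cscale cscale mult_z"
  unfolding mult_z_def by (rule linear_clin)

lemma linear_mult_zs: "Vector_Spaces.linear cscale cscale (mult_zs q)"
  unfolding mult_zs_def by (rule linear_clin)

lemma linear_funpow:
  fixes F :: "('a \<Rightarrow>\<^sub>0 complex) \<Rightarrow> ('a \<Rightarrow>\<^sub>0 complex)"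
  assumes "Vector_Spaces.linear cscale cscale F"
  shows "Vector_Spaces.linear cscale cscale (F ^^ n)"
proof (induction n)
  case 0
  show ?case unfolding Vector_Spaces.linear_iff
    by (simp add: cvec.vector_space_axioms)
next
  case (Suc n)
  from linear_compose_c[OF this assms] show ?case by (simp add: comp_def)
qed

lemma linear_pol_mult_left: "Vector_Spaces.linear cscale cscale (\<lambda>f. pol_mult q f g)"
  unfolding pol_mult_def by (rule linear_clin)

lemma linear_pol_mult_right: "Vector_Spaces.linear cscale cscale (\<lambda>g. pol_mult q f g)"
  unfolding pol_mult_def
  by (rule linear_clin_fun)
    (simp add: case_prod_beta linear_compose_c[OF linear_funpow[OF linear_mult_zs]
        linear_funpow[OF linear_mult_z]])

lemmas pol_mult_linear_simps =
  linear_pol_mult_left[unfolded Vector_Spaces.linear_iff, THEN conjunct2, THEN conjunct2, THEN conjunct1, rule_format]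
  linear_pol_mult_left[unfolded Vector_Spaces.linear_iff, THEN conjunct2, THEN conjunct2, THEN conjunct2, rule_format]
  linear_pol_mult_right[unfolded Vector_Spaces.linear_iff, THEN conjunct2, THEN conjunct2, THEN conjunct1, rule_format]
  linear_pol_mult_right[unfolded Vector_Spaces.linear_iff, THEN conjunct2, THEN conjunct2, THEN conjunct2, rule_format]

lemma pol_mult_zero [simp]: "pol_mult q 0 f = 0" "pol_mult q f 0 = 0"
  using pol_mult_linear_simps(2)[of q 0 0 f] pol_mult_linear_simps(4)[of q f 0 0] by simp_all

lemma mult_z_mono: "mult_z (pmono j k) = pmono (j + 1) k"
  by (simp add: mult_z_def)

lemma mult_zs_mono: "mult_zs q (pmono l m) = of_real (q ^ (2 * l)) *\<^sub>C pmono l (m + 1)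
                                    + of_real (1 - q ^ (2 * l)) *\<^sub>C pmono (l - 1) m"
  by (simp add: mult_zs_def)

lemma pol_mult_mono: "pol_mult q (pmono j k) g = (mult_z ^^ j) ((mult_zs q ^^ k) g)"
  by (simp add: pol_mult_def)

lemma pol_mult_z: "pol_mult q pol_z g = mult_z g"
  and pol_mult_zs: "pol_mult q pol_zs g = mult_zs q g"
  and pol_one_left: "pol_mult q pol_one g = g"
  by (simp_all add: pol_z_def pol_zs_def pol_one_def pol_mult_mono)

lemma mult_zs_mult_z:
  "mult_zs q (mult_z g) = of_real (q\<^sup>2) *\<^sub>C mult_z (mult_zs q g) + of_real (1 - q\<^sup>2) *\<^sub>C g"
proof (rule pol_eqI[where F = "\<lambda>g. mult_zs q (mult_z g)" and s = cscale])
  interpret z: Vector_Spaces.linear cscale cscale mult_z by (rule linear_mult_z)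
  interpret zs: Vector_Spaces.linear cscale cscale "mult_zs q" by (rule linear_mult_zs)
  show "Vector_Spaces.linear cscale cscale (\<lambda>g. mult_zs q (mult_z g))"
    by (rule linear_compose_c[OF linear_mult_z linear_mult_zs])
  show "Vector_Spaces.linear cscale cscale
     (\<lambda>g. of_real (q\<^sup>2) *\<^sub>C mult_z (mult_zs q g) + of_real (1 - q\<^sup>2) *\<^sub>C g)"
    unfolding Vector_Spaces.linear_iff z.add zs.add z.scale zs.scale
    by (simp add: cvec.vector_space_axioms cvec.scale_right_distrib mult.commute add_ac)
  show "mult_zs q (mult_z (pmono j k)) =
    of_real (q\<^sup>2) *\<^sub>C mult_z (mult_zs q (pmono j k)) + of_real (1 - q\<^sup>2) *\<^sub>C pmono j k" for j k
    unfolding mult_zs_mono mult_z_mono z.add z.scale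
    by (rule poly_mapping_eqI; cases j) (simp_all add: lookup_add field_simps power2_eq_square)
qed

lemma mult_zs_mult_z_power:
  "mult_zs q ((mult_z ^^ l) g)
     = of_real (q ^ (2 * l)) *\<^sub>C (mult_z ^^ l) (mult_zs q g)
       + of_real (1 - q ^ (2 * l)) *\<^sub>C (mult_z ^^ (l - 1)) g"
proof (induction l)
  case 0
  then show ?case by simp
next
  case (Suc l)
  interpret z: Vector_Spaces.linear cscale cscale mult_z by (rule linear_mult_z)
  have *: "of_real (1 - q ^ (2 * l)) *\<^sub>C mult_z ((mult_z ^^ (l - 1)) g)
            = of_real (1 - q ^ (2 * l)) *\<^sub>C (mult_z ^^ l) g"
    by (cases l) auto
  have "mult_zs q ((mult_z ^^ Suc l) g)
     = of_real (q\<^sup>2) *\<^sub>C (of_real (q ^ (2 * l)) *\<^sub>C (mult_z ^^ Suc l) (mult_zs q g)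
         + of_real (1 - q ^ (2 * l)) *\<^sub>C (mult_z ^^ l) g) + of_real (1 - q\<^sup>2) *\<^sub>C (mult_z ^^ l) g"
    by (simp only: funpow.simps(2) comp_apply mult_zs_mult_z Suc.IH z.add z.scale *)
  also have "\<dots> = of_real (q ^ (2 * Suc l)) *\<^sub>C (mult_z ^^ Suc l) (mult_zs q g)
       + of_real (1 - q ^ (2 * Suc l)) *\<^sub>C (mult_z ^^ (Suc l - 1)) g"
    by (rule poly_mapping_eqI) (simp add: lookup_add algebra_simps power2_eq_square)
  finally show ?case .
qed

lemma pol_mult_mult_z: "pol_mult q (mult_z f) g = mult_z (pol_mult q f g)"
  by (rule pol_eqI[OF linear_compose_c[OF linear_mult_z linear_pol_mult_left]
        linear_compose_c[OF linear_pol_mult_left linear_mult_z]])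
    (simp add: mult_z_mono pol_mult_mono)

lemma pol_mult_mult_zs: "pol_mult q (mult_zs q f) g = mult_zs q (pol_mult q f g)"
proof (rule pol_eqI[where F = "\<lambda>f. pol_mult q (mult_zs q f) g" and s = cscale])
  show "Vector_Spaces.linear cscale cscale (\<lambda>f. pol_mult q (mult_zs q f) g)"
    by (rule linear_compose_c[OF linear_mult_zs linear_pol_mult_left])
  show "Vector_Spaces.linear cscale cscale (\<lambda>f. mult_zs q (pol_mult q f g))"
    by (rule linear_compose_c[OF linear_pol_mult_left linear_mult_zs])
  show "pol_mult q (mult_zs q (pmono j k)) g = mult_zs q (pol_mult q (pmono j k) g)" for j k
    by (simp add: mult_zs_mono pol_mult_mono pol_mult_linear_simps mult_zs_mult_z_power)
qed

text \<open>\<open>Pol(\<complex>)\<^sub>q\<close> is an associative unital algebra in which the defining relation holds.\<close>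

theorem pol_mult_assoc: "pol_mult q (pol_mult q f g) h = pol_mult q f (pol_mult q g h)"
proof (rule pol_eqI[where F = "\<lambda>f. pol_mult q (pol_mult q f g) h" and s = cscale])
  show "Vector_Spaces.linear cscale cscale (\<lambda>f. pol_mult q (pol_mult q f g) h)"
    by (rule linear_compose_c[OF linear_pol_mult_left linear_pol_mult_left])
  show "Vector_Spaces.linear cscale cscale (\<lambda>f. pol_mult q f (pol_mult q g h))"
    by (rule linear_pol_mult_left)
  have zs: "pol_mult q ((mult_zs q ^^ k) g) h = (mult_zs q ^^ k) (pol_mult q g h)" for k
    by (induction k) (simp_all add: pol_mult_mult_zs)
  have z: "pol_mult q ((mult_z ^^ j) g) h = (mult_z ^^ j) (pol_mult q g h)" for g j
    by (induction j) (simp_all add: pol_mult_mult_z)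
  show "pol_mult q (pol_mult q (pmono j k) g) h = pol_mult q (pmono j k) (pol_mult q g h)" for j k
    by (simp add: pol_mult_mono z zs)
qed

lemma mult_z_power_mono: "(mult_z ^^ i) (pmono j k) = pmono (i + j) k"
  by (induction i) (simp_all add: mult_z_mono)

lemma mult_zs_power_mono: "(mult_zs q ^^ i) (pmono 0 k) = pmono 0 (i + k)"
  by (induction i) (simp_all add: mult_zs_mono)

lemma mono_mult_z: "pol_mult q (pmono i 0) (pmono j k) = pmono (i + j) k"
  by (simp add: pol_mult_mono mult_z_power_mono)

lemma mono_mult_zs: "pol_mult q (pmono j i) (pmono 0 k) = pmono j (i + k)"
  by (simp add: pol_mult_mono mult_zs_power_mono mult_z_power_mono)

theorem pol_one: "pol_mult q pol_one f = f" "pol_mult q f pol_one = f"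
proof -
  show "pol_mult q f pol_one = f"
    by (rule pol_eqI[OF linear_pol_mult_left linear_ident]) (simp add: pol_one_def mono_mult_zs)
qed (rule pol_one_left)

theorem pol_relation:
  "pol_mult q pol_zs pol_z
     = of_real (q\<^sup>2) *\<^sub>C pol_mult q pol_z pol_zs + of_real (1 - q\<^sup>2) *\<^sub>C pol_one"
  unfolding pol_mult_zs pol_mult_z
  by (simp add: mult_z_mono mult_zs_mono pol_z_def pol_zs_def pol_one_def)

definition pol_power :: "real \<Rightarrow> pol \<Rightarrow> nat \<Rightarrow> pol" where
  "pol_power q f n = (pol_mult q f ^^ n) pol_one"

theorem mono_eq_product: "pmono j k = pol_mult q (pol_power q pol_z j) (pol_power q pol_zs k)"
proof -
  have "pol_mult q pol_z = mult_z" "pol_mult q pol_zs = mult_zs q"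
    by (auto simp: pol_mult_z pol_mult_zs)
  then show ?thesis
    by (simp add: pol_power_def pol_one_def mult_z_power_mono mult_zs_power_mono mono_mult_zs)
qed

text \<open>Universal property: \<open>Pol(\<complex>)\<^sub>q\<close> is presented by the generators \<open>z\<close>, \<open>z*\<close> and the one
  relation above. The complex algebra structure of the target \<^typ>\<open>'r\<close> is given by a central ring
  homomorphism \<open>\<iota>\<close>.\<close>

theorem pol_universal:
  fixes \<iota> :: "complex \<Rightarrow> 'r::ring_1" and x y :: 'r
  assumes \<iota>: "\<iota> 1 = 1" "\<And>a b. \<iota> (a + b) = \<iota> a + \<iota> b" "\<And>a b. \<iota> (a * b) = \<iota> a * \<iota> b"
    and central: "\<And>a r. \<iota> a * r = r * \<iota> a"
    and rel: "y * x = \<iota> (of_real (q\<^sup>2)) * (x * y) + \<iota> (of_real (1 - q\<^sup>2))"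
  shows "\<exists>!F. F pol_one = 1 \<and> (\<forall>f g. F (f + g) = F f + F g) \<and> (\<forall>c f. F (c *\<^sub>C f) = \<iota> c * F f)
            \<and> (\<forall>f g. F (pol_mult q f g) = F f * F g) \<and> F pol_z = x \<and> F pol_zs = y"
proof -
  define s where "s = (\<lambda>c r. \<iota> c * r)"
  interpret s: vector_space s
    by unfold_locales (simp_all add: s_def \<iota> distrib_left distrib_right mult.assoc)
  have vs: "vector_space s" by (rule s.vector_space_axioms)
  define F where "F = lin s (\<lambda>(j, k). x ^ j * y ^ k)"
  have lF: "Vector_Spaces.linear cscale s F"
    unfolding F_def by (rule linear_lin[OF vs])
  interpret F: Vector_Spaces.linear cscale s F by (rule lF)
  have F_mono: "F (pmono j k) = x ^ j * y ^ k" for j k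
    by (simp add: F_def vs)
  have \<iota>0: "\<iota> 0 = 0" using \<iota>(2)[of 0 0] by simp
  have comm: "u * (\<iota> a * v) = \<iota> a * (u * v)" for a u v
    by (metis central mult.assoc)
  have lx: "Vector_Spaces.linear cscale s (\<lambda>f. r * F f)" for r
    unfolding Vector_Spaces.linear_iff
    by (auto simp: F.add F.scale cvec.vector_space_axioms vs distrib_left)
      (simp add: s_def comm)
  have lr: "Vector_Spaces.linear cscale s (\<lambda>f. F f * r)" for r
    unfolding Vector_Spaces.linear_iff
    by (auto simp: F.add F.scale cvec.vector_space_axioms vs distrib_right)
      (simp add: s_def mult.assoc)
  have Fz: "F (mult_z f) = x * F f" for f
    by (rule pol_eqI[OF linear_compose_c[OF linear_mult_z lF] lx])
      (simp add: mult_z_mono F_mono mult.assoc)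
  have yx: "y * x ^ l = s (of_real (q ^ (2 * l))) (x ^ l * y)
              + s (of_real (1 - q ^ (2 * l))) (x ^ (l - 1))" for l
  proof (induction l)
    case 0
    show ?case by (simp add: s_def \<iota>(1) \<iota>0)
  next
    case (Suc l)
    define a b c e where "a = complex_of_real (q\<^sup>2)" and "b = complex_of_real (1 - q\<^sup>2)"
      and "c = complex_of_real (q ^ (2 * l))" and "e = complex_of_real (1 - q ^ (2 * l))"
    have *: "s e (x ^ (l - 1)) * x = s e (x ^ l)"
      by (cases l) (auto simp: s_def e_def \<iota>0 mult.assoc power_commutes)
    have "y * x ^ Suc l = (y * x ^ l) * x"
      by (simp add: mult.assoc power_commutes)
    also have "\<dots> = s c (x ^ l * (y * x)) + s e (x ^ l)"
      unfolding Suc c_def[symmetric] e_def[symmetric] distrib_right *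
      by (simp add: s_def mult.assoc)
    also have "x ^ l * (y * x) = s a (x ^ Suc l * y) + s b (x ^ l)"
      unfolding rel s_def a_def[symmetric] b_def[symmetric]
      by (simp only: distrib_left comm central[of b "x ^ l", symmetric] power_Suc2 mult.assoc)
    also have "s c (s a (x ^ Suc l * y) + s b (x ^ l)) + s e (x ^ l)
       = s (c * a) (x ^ Suc l * y) + s (c * b + e) (x ^ l)"
      by (simp only: s.scale_right_distrib s.scale_left_distrib s.scale_scale add.assoc)
    also have "c * a = of_real (q ^ (2 * Suc l))" 
      by (simp add: a_def c_def power2_eq_square)
    also have "c * b + e = of_real (1 - q ^ (2 * Suc l))"
      by (simp add: b_def c_def e_def algebra_simps power2_eq_square)
    finally show ?case by (simp only: diff_Suc_1)
  qed
  have Fzs: "F (mult_zs q f) = y * F f" for f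
  proof (rule pol_eqI[OF linear_compose_c[OF linear_mult_zs lF] lx])
    fix j k
    show "F (mult_zs q (pmono j k)) = y * F (pmono j k)"
      unfolding mult_zs_mono F.add F.scale F_mono mult.assoc[of y, symmetric] yx
      by (simp add: distrib_right s_def mult.assoc del: of_real_diff of_real_power)
  qed
  have Fzp: "F ((mult_z ^^ j) f) = x ^ j * F f" for j f
    by (induction j) (simp_all add: Fz mult.assoc)
  have Fzsp: "F ((mult_zs q ^^ j) f) = y ^ j * F f" for j f
    by (induction j) (simp_all add: Fzs mult.assoc)
  have mult: "F (pol_mult q f g) = F f * F g" for f g
    by (rule pol_eqI[OF linear_compose_c[OF linear_pol_mult_left lF] lr])
      (simp add: pol_mult_mono Fzp Fzsp F_mono mult.assoc)
  show ?thesis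
  proof (rule ex1I[of _ F], safe)
    show "F pol_one = 1" "F pol_z = x" "F pol_zs = y"
      by (simp_all add: pol_one_def pol_z_def pol_zs_def F_mono)
    show "F (f + g) = F f + F g" "F (c *\<^sub>C f) = \<iota> c * F f" "F (pol_mult q f g) = F f * F g" for f g c
      using F.add F.scale mult by (auto simp: s_def)
  next
    fix G
    assume G: "G pol_one = 1" "\<forall>f g. G (f + g) = G f + G g" "\<forall>c f. G (c *\<^sub>C f) = \<iota> c * G f"
      "\<forall>f g. G (pol_mult q f g) = G f * G g" and xy: "x = G pol_z" "y = G pol_zs"
    have lG: "Vector_Spaces.linear cscale s G"
      unfolding Vector_Spaces.linear_iff using G(2,3) vs cvec.vector_space_axioms by (simp add: s_def)
    have Gp: "G (pol_power q f n) = G f ^ n" for f n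
      by (induction n) (use G in \<open>auto simp: pol_power_def\<close>)
    have "G f = F f" for f
    proof (rule pol_eqI[OF lG lF])
      fix j k
      have "G (pmono j k) = G (pol_mult q (pol_power q pol_z j) (pol_power q pol_zs k))"
        by (simp only: mono_eq_product[symmetric])
      also have "\<dots> = F (pmono j k)"
        using G(4) by (simp add: Gp F_mono xy)
      finally show "G (pmono j k) = F (pmono j k)" .
    qed
    then show "G = F" by blast
  qed
qed

section \<open>The first order differential calculus\<close>

text \<open>The pair \<open>(f, g)\<close> is the form \<open>f dz + g dz*\<close>. The commutation relations say
  \<open>dz h = \<sigma>(h) dz\<close> and \<open>dz* h = \<sigma>(h) dz*\<close> with \<open>\<sigma>\<close> the automorphism \<open>\<sigma>(z) = q\<^sup>2 z\<close>,
  \<open>\<sigma>(z*) = q\<^sup>-\<^sup>2 z*\<close>, and this determines the right action.\<close>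

type_synonym form = "pol \<times> pol"

definition form_dz :: form where "form_dz = (pol_one, 0)"
definition form_dzs :: form where "form_dzs = (0, pol_one)"

definition form_scale :: "complex \<Rightarrow> form \<Rightarrow> form" where
  "form_scale c \<omega> = (c *\<^sub>C fst \<omega>, c *\<^sub>C snd \<omega>)"

definition form_twist :: "real \<Rightarrow> pol \<Rightarrow> pol" where
  "form_twist q = lin cscale (\<lambda>(j, k). of_real (q ^ (2 * j) / q ^ (2 * k)) *\<^sub>C pmono j k)"

definition lact :: "real \<Rightarrow> pol \<Rightarrow> form \<Rightarrow> form" where
  "lact q h \<omega> = (pol_mult q h (fst \<omega>), pol_mult q h (snd \<omega>))"

definition ract :: "real \<Rightarrow> form \<Rightarrow> pol \<Rightarrow> form" where
  "ract q \<omega> h = (pol_mult q (fst \<omega>) (form_twist q h), pol_mult q (snd \<omega>) (form_twist q h))"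

text \<open>The Leibniz rule written out on \<open>z\<^sup>j z*\<^sup>k\<close>.\<close>

definition form_d :: "real \<Rightarrow> pol \<Rightarrow> form" where
  "form_d q = lin form_scale (\<lambda>(j, k).
       (\<Sum>i<j. lact q (pmono i 0) (ract q form_dz (pmono (j - 1 - i) k)))
     + (\<Sum>i<k. lact q (pmono j i) (ract q form_dzs (pmono 0 (k - 1 - i)))))"

text \<open>The components of \<open>df\<close> with the coefficients on the left (superscript \<open>r\<close> in the notation
  \<open>\<partial>\<^sup>(\<^sup>r\<^sup>)\<close>) and on the right (superscript \<open>l\<close>).\<close>

definition pdr_zs :: "real \<Rightarrow> pol \<Rightarrow> pol" where
  "pdr_zs q f = (THE b. \<exists>a. form_d q f = lact q a form_dz + lact q b form_dzs)"

definition pdl_z :: "real \<Rightarrow> pol \<Rightarrow> pol" where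
  "pdl_z q f = (THE a. \<exists>b. form_d q f = ract q form_dz a + ract q form_dzs b)"

interpretation form: vector_space form_scale
  by unfold_locales (simp_all add: form_scale_def prod_eq_iff cvec.scale_right_distrib
      cvec.scale_left_distrib)

lemma linear_form_d: "Vector_Spaces.linear cscale form_scale (form_d q)"
  unfolding form_d_def by (rule linear_lin[OF form.vector_space_axioms])

lemma linear_form_twist: "Vector_Spaces.linear cscale cscale (form_twist q)"
  unfolding form_twist_def by (rule linear_clin)

lemma form_twist_mono: "form_twist q (pmono j k) = of_real (q ^ (2 * j) / q ^ (2 * k)) *\<^sub>C pmono j k"
  by (simp add: form_twist_def)

theorem form_twist_mult:
  assumes "q \<noteq> 0"
  shows "form_twist q (pol_mult q f g) = pol_mult q (form_twist q f) (form_twist q g)"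
proof -
  interpret z: Vector_Spaces.linear cscale cscale mult_z by (rule linear_mult_z)
  interpret zs: Vector_Spaces.linear cscale cscale "mult_zs q" by (rule linear_mult_zs)
  interpret t: Vector_Spaces.linear cscale cscale "form_twist q" by (rule linear_form_twist)
  have z: "form_twist q (mult_z f) = of_real (q\<^sup>2) *\<^sub>C mult_z (form_twist q f)" for f
    by (rule pol_eqI[OF linear_compose_c[OF linear_mult_z linear_form_twist]
        linear_compose_c[OF linear_compose_c[OF linear_form_twist linear_mult_z] cvec.linear_scale_self]])
      (simp add: mult_z_mono form_twist_mono z.scale assms power2_eq_square)
  have zs: "form_twist q (mult_zs q f) = of_real (inverse (q\<^sup>2)) *\<^sub>C mult_zs q (form_twist q f)" for f
  proof (rule pol_eqI[OF linear_compose_c[OF linear_mult_zs linear_form_twist]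
         linear_compose_c[OF linear_compose_c[OF linear_form_twist linear_mult_zs] cvec.linear_scale_self]])
    show "form_twist q (mult_zs q (pmono j k)) = of_real (inverse (q\<^sup>2)) *\<^sub>C mult_zs q (form_twist q (pmono j k))"
      for j k
      unfolding mult_zs_mono form_twist_mono zs.scale t.add t.scale
      by (rule poly_mapping_eqI; cases j)
        (simp_all add: lookup_add lookup_minus assms power2_eq_square field_simps)
  qed
  have zp: "form_twist q ((mult_z ^^ n) f) = of_real (q ^ (2 * n)) *\<^sub>C (mult_z ^^ n) (form_twist q f)" for n f
    by (induction n) (simp_all add: z z.scale power2_eq_square mult_ac)
  have zsp: "form_twist q ((mult_zs q ^^ n) f)
      = of_real (inverse (q ^ (2 * n))) *\<^sub>C (mult_zs q ^^ n) (form_twist q f)" for n f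
    by (induction n) (simp_all add: zs zs.scale power2_eq_square mult_ac)
  have zc: "(mult_z ^^ n) (c *\<^sub>C f) = c *\<^sub>C (mult_z ^^ n) f" for n c f
    by (induction n) (simp_all add: z.scale)
  show ?thesis
  proof (rule pol_eqI[OF linear_compose_c[OF linear_pol_mult_left linear_form_twist]
        linear_compose_c[OF linear_form_twist linear_pol_mult_left]])
    show "form_twist q (pol_mult q (pmono j k) g) = pol_mult q (form_twist q (pmono j k)) (form_twist q g)"
      for j k
      by (simp add: pol_mult_mono zp zsp zc form_twist_mono pol_mult_linear_simps)
        (simp add: power_int_diff assms nat_mult_distrib power_int_def divide_inverse)
  qed
qed

lemma form_twist_one: "form_twist q pol_one = pol_one"
  by (simp add: form_twist_mono pol_one_def)

lemma form_twist_inverse: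
  assumes "q \<noteq> 0"
  shows "form_twist q (form_twist (inverse q) f) = f" "form_twist (inverse q) (form_twist q f) = f"
proof -
  interpret t: Vector_Spaces.linear cscale cscale "form_twist q" by (rule linear_form_twist)
  interpret t': Vector_Spaces.linear cscale cscale "form_twist (inverse q)" by (rule linear_form_twist)
  show "form_twist q (form_twist (inverse q) f) = f"
    by (rule pol_eqI[OF linear_compose_c[OF linear_form_twist linear_form_twist] linear_ident])
      (simp add: form_twist_mono t.scale assms power_inverse)
  show "form_twist (inverse q) (form_twist q f) = f"
    by (rule pol_eqI[OF linear_compose_c[OF linear_form_twist linear_form_twist] linear_ident])
      (simp add: form_twist_mono t'.scale assms power_inverse)
qed

lemma lact_linear:
  "lact q (f + g) \<omega> = lact q f \<omega> + lact q g \<omega>" "lact q (c *\<^sub>C f) \<omega> = form_scale c (lact q f \<omega>)"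
  "lact q f (\<omega> + \<eta>) = lact q f \<omega> + lact q f \<eta>"
  "lact q f (form_scale c \<omega>) = form_scale c (lact q f \<omega>)"
  by (simp_all add: lact_def form_scale_def prod_eq_iff pol_mult_linear_simps)

lemma ract_linear:
  "ract q \<omega> (f + g) = ract q \<omega> f + ract q \<omega> g" "ract q \<omega> (c *\<^sub>C f) = form_scale c (ract q \<omega> f)"
  "ract q (\<omega> + \<eta>) f = ract q \<omega> f + ract q \<eta> f"
  "ract q (form_scale c \<omega>) f = form_scale c (ract q \<omega> f)"
proof -
  interpret t: Vector_Spaces.linear cscale cscale "form_twist q" by (rule linear_form_twist)
  show "ract q \<omega> (f + g) = ract q \<omega> f + ract q \<omega> g" "ract q \<omega> (c *\<^sub>C f) = form_scale c (ract q \<omega> f)"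
    "ract q (\<omega> + \<eta>) f = ract q \<omega> f + ract q \<eta> f"
    "ract q (form_scale c \<omega>) f = form_scale c (ract q \<omega> f)"
    by (simp_all add: ract_def form_scale_def prod_eq_iff pol_mult_linear_simps t.add t.scale)
qed

theorem form_bimodule:
  assumes "q \<noteq> 0"
  shows "lact q pol_one \<omega> = \<omega>" "ract q \<omega> pol_one = \<omega>"
    "lact q (pol_mult q f g) \<omega> = lact q f (lact q g \<omega>)"
    "ract q \<omega> (pol_mult q f g) = ract q (ract q \<omega> f) g"
    "lact q f (ract q \<omega> g) = ract q (lact q f \<omega>) g"
  by (simp_all add: lact_def ract_def pol_one form_twist_one form_twist_mult[OF assms] pol_mult_assoc)

theorem form_commutation:
  assumes "q \<noteq> 0"
  shows "lact q pol_z form_dz = form_scale (of_real (inverse (q\<^sup>2))) (ract q form_dz pol_z)"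
    "lact q pol_zs form_dzs = form_scale (of_real (q\<^sup>2)) (ract q form_dzs pol_zs)"
    "lact q pol_zs form_dz = form_scale (of_real (q\<^sup>2)) (ract q form_dz pol_zs)"
    "lact q pol_z form_dzs = form_scale (of_real (inverse (q\<^sup>2))) (ract q form_dzs pol_z)"
  using assms
  by (simp_all add: lact_def ract_def form_dz_def form_dzs_def form_scale_def pol_one pol_mult_linear_simps
      form_twist_mono pol_z_def pol_zs_def)

theorem form_free:
  "lact q f form_dz + lact q g form_dzs = (f, g)"
  "ract q form_dz f + ract q form_dzs g = (form_twist q f, form_twist q g)"
  by (simp_all add: lact_def ract_def form_dz_def form_dzs_def pol_one)

lemma form_d_mono:
  "form_d q (pmono j k) =
       (\<Sum>i<j. lact q (pmono i 0) (ract q form_dz (pmono (j - 1 - i) k)))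
     + (\<Sum>i<k. lact q (pmono j i) (ract q form_dzs (pmono 0 (k - 1 - i))))"
  unfolding form_d_def by (simp add: form.vector_space_axioms)

lemma lact_sum: "lact q f (\<Sum>i\<in>A. \<phi> i) = (\<Sum>i\<in>A. lact q f (\<phi> i))"
proof (induction A rule: infinite_finite_induct)
  case (insert x A)
  then show ?case by (simp add: lact_linear)
qed (simp_all add: lact_def prod_eq_iff)

theorem form_d_Leibniz:
  assumes q: "q \<noteq> 0"
  shows "form_d q (pol_mult q f g) = ract q (form_d q f) g + lact q f (form_d q g)"
proof -
  interpret D: Vector_Spaces.linear cscale form_scale "form_d q" by (rule linear_form_d)
  note bim = form_bimodule[OF q]
  have lz: "lact q (pmono (Suc i) k) \<omega> = lact q pol_z (lact q (pmono i k) \<omega>)" for i k \<omega>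
    by (simp add: bim(3)[symmetric] pol_mult_z mult_z_mono)
  have lzs: "lact q (pmono 0 (Suc k)) \<omega> = lact q pol_zs (lact q (pmono 0 k) \<omega>)" for k \<omega>
    by (simp add: bim(3)[symmetric] pol_mult_zs mult_zs_mono)
  have one: "lact q (pmono 0 0) \<omega> = \<omega>" for \<omega>
    using bim(1) by (simp add: pol_one_def)
  have llin: "Vector_Spaces.linear cscale form_scale (\<lambda>g. ract q \<omega> g + lact q f (form_d q g))" for f \<omega>
    unfolding Vector_Spaces.linear_iff
    by (simp add: cvec.vector_space_axioms form.vector_space_axioms ract_linear lact_linear D.add D.scale
        form.scale_right_distrib add_ac)
  have dz: "form_d q (mult_z g) = ract q form_dz g + lact q pol_z (form_d q g)" for g
  proof (rule pol_eqI[OF linear_compose_c[OF linear_mult_z linear_form_d] llin])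
    fix j k
    show "form_d q (mult_z (pmono j k)) = ract q form_dz (pmono j k) + lact q pol_z (form_d q (pmono j k))"
      unfolding mult_z_mono form_d_mono lact_linear lact_sum
      by (simp add: sum.lessThan_Suc_shift lz one add_ac del: sum.lessThan_Suc)
  qed
  have "form_d q (mult_zs q (pmono l m)) = ract q form_dzs (pmono l m) + lact q pol_zs (form_d q (pmono l m))"
    for l m
  proof (induction l)
    case 0
    have "form_d q (mult_zs q (pmono 0 m)) = form_d q (pmono 0 (Suc m))"
      by (simp add: mult_zs_mono)
    also have "\<dots> = ract q form_dzs (pmono 0 m) + lact q pol_zs (form_d q (pmono 0 m))"
      unfolding form_d_mono lact_linear lact_sum
      by (simp add: sum.lessThan_Suc_shift lzs one add_ac del: sum.lessThan_Suc)
    finally show ?case .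
  next
    case (Suc l)
    let ?w = "pmono l m" and ?c = "complex_of_real (q\<^sup>2)" and ?e = "complex_of_real (1 - q\<^sup>2)"
    have com: "form_scale ?c (ract q form_dz (mult_zs q ?w)) = lact q pol_zs (ract q form_dz ?w)"
      "form_scale ?c (lact q pol_z (ract q form_dzs ?w)) = ract q form_dzs (mult_z ?w)"
      using q by (simp_all add: pol_mult_zs[symmetric] pol_mult_z[of q, symmetric] bim form_commutation[OF q] ract_linear)
    have rel: "form_scale ?c (lact q pol_z (lact q pol_zs \<omega>)) + form_scale ?e \<omega>
                  = lact q pol_zs (lact q pol_z \<omega>)" for \<omega>
      unfolding bim(3)[symmetric] pol_relation lact_linear bim(1) ..
    have "form_d q (mult_zs q (pmono (Suc l) m)) = form_d q (mult_zs q (mult_z ?w))"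
      by (simp add: mult_z_mono)
    also have "\<dots> = form_scale ?c (ract q form_dz (mult_zs q ?w)
           + lact q pol_z (ract q form_dzs ?w + lact q pol_zs (form_d q ?w))) + form_scale ?e (form_d q ?w)"
      unfolding mult_zs_mult_z D.add D.scale dz Suc ..
    also have "\<dots> = lact q pol_zs (ract q form_dz ?w) + (ract q form_dzs (mult_z ?w)
         + (form_scale ?c (lact q pol_z (lact q pol_zs (form_d q ?w))) + form_scale ?e (form_d q ?w)))"
      unfolding lact_linear form.scale_right_distrib com by (simp only: add_ac)
    also have "\<dots> = ract q form_dzs (mult_z ?w) + lact q pol_zs (form_d q (mult_z ?w))"
      unfolding rel dz lact_linear by (simp only: add_ac)
    finally show ?case by (simp add: mult_z_mono)
  qed
  then have dzs: "form_d q (mult_zs q g) = ract q form_dzs g + lact q pol_zs (form_d q g)" for g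
    by (rule pol_eqI[OF linear_compose_c[OF linear_mult_zs linear_form_d] llin])
  let ?L = "\<lambda>f. \<forall>g. form_d q (pol_mult q f g) = ract q (form_d q f) g + lact q f (form_d q g)"
  have L1: "?L (pmono 0 0)"
    using pol_one(1)[of q] by (simp add: form_d_mono one pol_one_def)
      (simp add: ract_def prod_eq_iff)
  have l: "lact q (mult_z f) \<omega> = lact q pol_z (lact q f \<omega>)"
    "lact q (mult_zs q f) \<omega> = lact q pol_zs (lact q f \<omega>)" for f \<omega>
    by (simp_all only: bim(3)[symmetric] pol_mult_z pol_mult_zs)
  have Lz: "?L (mult_z f)" if "?L f" for f
    using that
    by (simp add: pol_mult_mult_z dz ract_linear lact_linear l bim(4,5) add_ac)
  have Lzs: "?L (mult_zs q f)" if "?L f" for f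
    using that
    by (simp add: pol_mult_mult_zs dzs ract_linear lact_linear l bim(4,5) add_ac)
  have "?L (pmono 0 k)" for k
  proof (induction k)
    case (Suc k)
    from Lzs[OF this] show ?case by (simp add: mult_zs_mono)
  qed (rule L1)
  then have "?L (pmono j k)" for j k
  proof (induction j)
    case (Suc j)
    then have "?L (pmono j k)" by blast
    from Lz[OF this] show ?case by (simp add: mult_z_mono)
  qed
  moreover have "Vector_Spaces.linear cscale form_scale (\<lambda>f. ract q (form_d q f) g + lact q f (form_d q g))"
    unfolding Vector_Spaces.linear_iff
    by (simp add: cvec.vector_space_axioms form.vector_space_axioms ract_linear lact_linear D.add D.scale
        form.scale_right_distrib add_ac)
  ultimately show ?thesis
    using pol_eqI[OF linear_compose_c[OF linear_pol_mult_left linear_form_d]] by blast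
qed

theorem form_d_generators: "form_d q pol_z = form_dz" "form_d q pol_zs = form_dzs"
  by (simp_all add: pol_z_def pol_zs_def form_d_mono form_dz_def form_dzs_def)
    (simp_all add: lact_def ract_def pol_one_def[symmetric] pol_one form_twist_one prod_eq_iff)

theorem form_d_unique:
  assumes q: "q \<noteq> 0" and G: "Vector_Spaces.linear cscale form_scale G"
    and Leibniz: "\<And>f g. G (pol_mult q f g) = ract q (G f) g + lact q f (G g)"
    and gen: "G pol_z = form_dz" "G pol_zs = form_dzs"
  shows "G f = form_d q f"
proof -
  have one: "G pol_one = form_d q pol_one"
    using Leibniz[of pol_one pol_one] form_d_Leibniz[OF q, of pol_one pol_one]
    by (simp add: pol_one form_bimodule[OF q])
  have z: "G (mult_z f) = form_d q (mult_z f)" "G (mult_zs q f) = form_d q (mult_zs q f)"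
    if "G f = form_d q f" for f
    using that by (simp_all add: Leibniz form_d_Leibniz[OF q] gen form_d_generators
        flip: pol_mult_z[of q f] pol_mult_zs[of q f])
  have "G (pmono 0 k) = form_d q (pmono 0 k)" for k
  proof (induction k)
    case (Suc k)
    from z(2)[OF this] show ?case by (simp add: mult_zs_mono)
  qed (use one in \<open>simp add: pol_one_def\<close>)
  then have "G (pmono j k) = form_d q (pmono j k)" for j k
  proof (induction j)
    case (Suc j)
    from z(1)[OF Suc.IH[OF Suc.prems]] show ?case by (simp add: mult_z_mono)
  qed simp
  then show ?thesis by (rule pol_eqI[OF G linear_form_d])
qed

lemma pdr_zs_eq: "pdr_zs q f = snd (form_d q f)"
  unfolding pdr_zs_def form_free by (rule the_equality) (auto simp: prod_eq_iff)

lemma pdl_z_eq: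
  assumes "q \<noteq> 0"
  shows "pdl_z q f = form_twist (inverse q) (fst (form_d q f))"
  unfolding pdl_z_def form_free
proof (rule the_equality)
  show "\<exists>b. form_d q f = (form_twist q (form_twist (inverse q) (fst (form_d q f))), form_twist q b)"
    by (rule exI[of _ "form_twist (inverse q) (snd (form_d q f))"])
      (simp add: form_twist_inverse[OF assms])
qed (auto simp: form_twist_inverse[OF assms])

theorem partial_derivatives:
  assumes "q \<noteq> 0"
  shows "\<exists>!(a, b). form_d q f = lact q a form_dz + lact q b form_dzs"
    and "\<exists>!(a, b). form_d q f = ract q form_dz a + ract q form_dzs b"
proof -
  show "\<exists>!(a, b). form_d q f = lact q a form_dz + lact q b form_dzs"
    by (rule ex1I[of _ "form_d q f"]) (auto simp: form_free)
  show "\<exists>!(a, b). form_d q f = ract q form_dz a + ract q form_dzs b"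
    by (rule ex1I[of _ "(form_twist (inverse q) (fst (form_d q f)), form_twist (inverse q) (snd (form_d q f)))"])
      (auto simp: form_free form_twist_inverse[OF assms])
qed

section \<open>The tensor square, \<open>m\<^sub>0\<close> and the box operator\<close>

text \<open>The algebraic tensor product of two vector spaces with bases indexed by \<^typ>\<open>'a\<close> and \<^typ>\<open>'b\<close>
  has a basis indexed by \<^typ>\<open>'a \<times> 'b\<close>.\<close>

type_synonym pol2 = "((nat \<times> nat) \<times> (nat \<times> nat)) \<Rightarrow>\<^sub>0 complex"

definition tensor :: "pol \<Rightarrow> pol \<Rightarrow> pol2"  (infixr "\<otimes>\<^sub>p" 76) where
  "f \<otimes>\<^sub>p g = lin cscale (\<lambda>a. lin cscale (\<lambda>b. single (a, b) 1) g) f"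

definition pol2_mult :: "real \<Rightarrow> pol2 \<Rightarrow> pol2 \<Rightarrow> pol2" where
  "pol2_mult q S T = lin cscale (\<lambda>(a, b). lin cscale (\<lambda>(c, e).
      pol_mult q (single a 1) (single c 1) \<otimes>\<^sub>p pol_mult q (single b 1) (single e 1)) T) S"

definition m0 :: "real \<Rightarrow> pol2 \<Rightarrow> pol" where
  "m0 q = lin cscale (\<lambda>(a, b). pol_mult q (single a 1) (single b 1))"

definition box_kernel :: "real \<Rightarrow> pol2" where
  "box_kernel q = of_real (inverse (q\<^sup>2)) *\<^sub>C
     (pol_one \<otimes>\<^sub>p pol_one - of_real (1 + inverse (q\<^sup>2)) *\<^sub>C (pol_zs \<otimes>\<^sub>p pol_z)
      + of_real (inverse (q\<^sup>2)) *\<^sub>C (pol_power q pol_zs 2 \<otimes>\<^sub>p pol_power q pol_z 2))"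

definition box :: "real \<Rightarrow> pol2 \<Rightarrow> pol2" where
  "box q = lin cscale (\<lambda>(a, b).
      pol2_mult q (pol2_mult q (pdr_zs q (single a 1) \<otimes>\<^sub>p pol_one) (box_kernel q))
                  (pol_one \<otimes>\<^sub>p pdl_z q (single b 1)))"

lemma linear_tensor_left: "Vector_Spaces.linear cscale cscale (\<lambda>f. f \<otimes>\<^sub>p g)"
  unfolding tensor_def by (rule linear_clin)

lemma linear_tensor_right: "Vector_Spaces.linear cscale cscale (\<lambda>g. f \<otimes>\<^sub>p g)"
  unfolding tensor_def by (rule linear_clin_fun) (rule linear_clin)

lemma tensor_single [simp]: "single a 1 \<otimes>\<^sub>p single b 1 = single (a, b) 1"
  by (simp add: tensor_def)

lemma linear_pol2_mult_left: "Vector_Spaces.linear cscale cscale (\<lambda>S. pol2_mult q S T)"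
  unfolding pol2_mult_def by (rule linear_clin)

lemma linear_pol2_mult_right: "Vector_Spaces.linear cscale cscale (\<lambda>T. pol2_mult q S T)"
  unfolding pol2_mult_def by (rule linear_clin_fun) (simp add: case_prod_beta linear_clin)

lemma linear_m0: "Vector_Spaces.linear cscale cscale (m0 q)"
  unfolding m0_def by (rule linear_clin)

lemma linear_box: "Vector_Spaces.linear cscale cscale (box q)"
  unfolding box_def by (rule linear_clin)

lemma bilinear_eqI:
  assumes "\<And>g. Vector_Spaces.linear cscale cscale (\<lambda>f. F f g)"
    "\<And>f. Vector_Spaces.linear cscale cscale (\<lambda>g. F f g)"
    "\<And>g. Vector_Spaces.linear cscale cscale (\<lambda>f. G f g)"
    "\<And>f. Vector_Spaces.linear cscale cscale (\<lambda>g. G f g)"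
    "\<And>a b. F (single a 1) (single b 1) = G (single a 1) (single b 1)"
  shows "F f g = G f g"
proof (rule linear_eqI[where f = "\<lambda>f. F f g" and g = "\<lambda>f. G f g" and s = cscale])
  show "F (single a 1) g = G (single a 1) g" for a
    by (rule linear_eqI[OF assms(2,4,5)])
qed (rule assms)+

theorem m0_tensor: "m0 q (f \<otimes>\<^sub>p g) = pol_mult q f g"
  by (rule bilinear_eqI[OF linear_compose_c[OF linear_tensor_left linear_m0]
        linear_compose_c[OF linear_tensor_right linear_m0] linear_pol_mult_left linear_pol_mult_right])
    (simp add: m0_def)

theorem pol2_mult_tensor:
  "pol2_mult q (f \<otimes>\<^sub>p g) (h \<otimes>\<^sub>p k) = pol_mult q f h \<otimes>\<^sub>p pol_mult q g k"
proof -
  have "pol2_mult q (single a 1 \<otimes>\<^sub>p single b 1) (h \<otimes>\<^sub>p k)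
          = pol_mult q (single a 1) h \<otimes>\<^sub>p pol_mult q (single b 1) k" for a b
    by (rule bilinear_eqI[OF linear_compose_c[OF linear_tensor_left linear_pol2_mult_right]
          linear_compose_c[OF linear_tensor_right linear_pol2_mult_right]
          linear_compose_c[OF linear_pol_mult_right linear_tensor_left]
          linear_compose_c[OF linear_pol_mult_right linear_tensor_right]])
      (simp add: pol2_mult_def)
  then show ?thesis
    by (rule bilinear_eqI[OF linear_compose_c[OF linear_tensor_left linear_pol2_mult_left]
          linear_compose_c[OF linear_tensor_right linear_pol2_mult_left]
          linear_compose_c[OF linear_pol_mult_left linear_tensor_left]
          linear_compose_c[OF linear_pol_mult_left linear_tensor_right]])
qed

theorem box_tensor:
  assumes "q \<noteq> 0"
  shows "box q (f \<otimes>\<^sub>p g) = pol2_mult q (pol2_mult q (pdr_zs q f \<otimes>\<^sub>p pol_one) (box_kernel q))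
                               (pol_one \<otimes>\<^sub>p pdl_z q g)"
proof -
  interpret D: Vector_Spaces.linear cscale form_scale "form_d q" by (rule linear_form_d)
  have r: "Vector_Spaces.linear cscale cscale (pdr_zs q)"
    unfolding Vector_Spaces.linear_iff pdr_zs_eq D.add D.scale
    by (simp add: cvec.vector_space_axioms form_scale_def)
  have "Vector_Spaces.linear cscale cscale (\<lambda>f. fst (form_d q f))"
    unfolding Vector_Spaces.linear_iff D.add D.scale
    by (simp add: cvec.vector_space_axioms form_scale_def)
  from linear_compose_c[OF this linear_form_twist]
  have l: "Vector_Spaces.linear cscale cscale (pdl_z q)"
    unfolding pdl_z_eq[OF assms, abs_def] .
  show ?thesis
    by (rule bilinear_eqI[OF linear_compose_c[OF linear_tensor_left linear_box]
        linear_compose_c[OF linear_tensor_right linear_box]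
        linear_compose_c[OF linear_compose_c[OF linear_compose_c[OF r linear_tensor_left]
           linear_pol2_mult_left] linear_pol2_mult_left]
        linear_compose_c[OF linear_compose_c[OF l linear_tensor_right] linear_pol2_mult_right]])
      (simp add: box_def)
qed

section \<open>The star product\<close>

definition qpoch :: "'a::comm_ring_1 \<Rightarrow> 'a \<Rightarrow> nat \<Rightarrow> 'a" where
  "qpoch a p k = (\<Prod>i<k. 1 - p ^ i * a)"

definition p_poly :: "real \<Rightarrow> nat \<Rightarrow> complex poly" where
  "p_poly q k = (let Q = complex_of_real q in
     (\<Sum>j\<le>k. smult (qpoch (Q powi (- 2 * int k)) (Q\<^sup>2) j / (qpoch (Q\<^sup>2) (Q\<^sup>2) j)\<^sup>2 * Q ^ (2 * j))
       (\<Prod>i<j. 1 - smult (Q ^ (2 * i)) [: 1 + Q\<^sup>2, (1 - Q\<^sup>2)\<^sup>2 :] + [: Q ^ (4 * i + 2) :])))"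

definition poly_operator :: "complex poly \<Rightarrow> (('a \<Rightarrow>\<^sub>0 complex) \<Rightarrow> ('a \<Rightarrow>\<^sub>0 complex)) \<Rightarrow> ('a \<Rightarrow>\<^sub>0 complex) \<Rightarrow> ('a \<Rightarrow>\<^sub>0 complex)"
  where "poly_operator p T v = (\<Sum>n\<le>degree p. coeff p n *\<^sub>C (T ^^ n) v)"

definition C_coeff :: "real \<Rightarrow> nat \<Rightarrow> pol \<Rightarrow> pol \<Rightarrow> pol" where
  "C_coeff q k f g = m0 q (poly_operator (p_poly q k - p_poly q (k - 1)) (box q) (f \<otimes>\<^sub>p g))"

definition star_product :: "real \<Rightarrow> pol \<Rightarrow> pol \<Rightarrow> pol fps" where
  "star_product q f g = Abs_fps (\<lambda>k. if k = 0 then pol_mult q f g else C_coeff q k f g)"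

section \<open>The Hilbert space and covariant symbols\<close>

text \<open>A vector \<open>\<Sum>\<^sub>k \<psi>\<^sub>k z\<^sup>k\<close> is stored as \<open>\<psi>\<close>; the elements of \<open>\<complex>[z]\<^sub>q\<close> are the finitely supported
  sequences. The completion is realised as the weighted \<open>\<ell>\<^sup>2\<close> space \<open>L2a\<close>.\<close>

definition weight :: "real \<Rightarrow> real \<Rightarrow> nat \<Rightarrow> real" where
  "weight q \<alpha> k = qpoch (q\<^sup>2) (q\<^sup>2) k / qpoch (q powr (4 * \<alpha> + 2)) (q\<^sup>2) k"

definition Cz :: "(nat \<Rightarrow> complex) set" where
  "Cz = {\<psi>. finite {k. \<psi> k \<noteq> 0}}"

definition L2a :: "real \<Rightarrow> real \<Rightarrow> (nat \<Rightarrow> complex) set" where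
  "L2a q \<alpha> = {\<psi>. summable (\<lambda>k. weight q \<alpha> k * (cmod (\<psi> k))\<^sup>2)}"

definition scalar_prod :: "real \<Rightarrow> real \<Rightarrow> (nat \<Rightarrow> complex) \<Rightarrow> (nat \<Rightarrow> complex) \<Rightarrow> complex" where
  "scalar_prod q \<alpha> \<psi> \<phi> = (suminf (\<lambda>k. of_real (weight q \<alpha> k) * \<psi> k * cnj (\<phi> k)))"

definition L2a_norm :: "real \<Rightarrow> real \<Rightarrow> (nat \<Rightarrow> complex) \<Rightarrow> real" where
  "L2a_norm q \<alpha> \<psi> = sqrt (Re (scalar_prod q \<alpha> \<psi> \<psi>))"

text \<open>Bounded operators are total functions that vanish outside \<open>L2a\<close>, so that two of them are
  equal iff they agree on \<open>L2a\<close>.\<close>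

definition bounded_ops :: "real \<Rightarrow> real \<Rightarrow> ((nat \<Rightarrow> complex) \<Rightarrow> (nat \<Rightarrow> complex)) set" where
  "bounded_ops q \<alpha> = {A.
      (\<forall>\<psi>\<in>L2a q \<alpha>. A \<psi> \<in> L2a q \<alpha>) \<and>
      (\<forall>\<psi>\<in>L2a q \<alpha>. \<forall>\<phi>\<in>L2a q \<alpha>. A (\<lambda>k. \<psi> k + \<phi> k) = (\<lambda>k. A \<psi> k + A \<phi> k)) \<and>
      (\<forall>c. \<forall>\<psi>\<in>L2a q \<alpha>. A (\<lambda>k. c * \<psi> k) = (\<lambda>k. c * A \<psi> k)) \<and>
      (\<exists>M. \<forall>\<psi>\<in>L2a q \<alpha>. L2a_norm q \<alpha> (A \<psi>) \<le> M * L2a_norm q \<alpha> \<psi>) \<and>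
      (\<forall>\<psi>. \<psi> \<notin> L2a q \<alpha> \<longrightarrow> A \<psi> = (\<lambda>_. 0))}"

text \<open>The weakest topology in which the functionals \<open>A \<mapsto> (A \<psi>\<^sub>1, \<psi>\<^sub>2)\<close> are continuous.\<close>

definition weak_op_topology :: "real \<Rightarrow> real \<Rightarrow> ((nat \<Rightarrow> complex) \<Rightarrow> (nat \<Rightarrow> complex)) topology" where
  "weak_op_topology q \<alpha> = topology_generated_by
     {{A \<in> bounded_ops q \<alpha>. scalar_prod q \<alpha> (A \<psi>\<^sub>1) \<psi>\<^sub>2 \<in> U} | \<psi>\<^sub>1 \<psi>\<^sub>2 U.
        \<psi>\<^sub>1 \<in> Cz \<and> \<psi>\<^sub>2 \<in> Cz \<and> open U}"

definition adjoint_op ::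
  "real \<Rightarrow> real \<Rightarrow> ((nat \<Rightarrow> complex) \<Rightarrow> (nat \<Rightarrow> complex)) \<Rightarrow> ((nat \<Rightarrow> complex) \<Rightarrow> (nat \<Rightarrow> complex))" where
  "adjoint_op q \<alpha> A = (THE B. B \<in> bounded_ops q \<alpha> \<and>
     (\<forall>\<psi>\<in>L2a q \<alpha>. \<forall>\<phi>\<in>L2a q \<alpha>. scalar_prod q \<alpha> (A \<psi>) \<phi> = scalar_prod q \<alpha> \<psi> (B \<phi>)))"

definition z_op :: "real \<Rightarrow> real \<Rightarrow> (nat \<Rightarrow> complex) \<Rightarrow> (nat \<Rightarrow> complex)" where
  "z_op q \<alpha> \<psi> = (if \<psi> \<in> L2a q \<alpha> then (\<lambda>k. case k of 0 \<Rightarrow> 0 | Suc i \<Rightarrow> \<psi> i) else (\<lambda>_. 0))"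

text \<open>\<open>\<Sum>\<^bsub>(j, k) \<in> S\<^esub> a\<^sub>j\<^sub>k z\<^sup>j z*\<^sup>k\<close> evaluated at the operator \<open>z_op\<close> and its adjoint.\<close>

definition antiwick_sum ::
  "real \<Rightarrow> real \<Rightarrow> (nat \<times> nat) set \<Rightarrow> (nat \<times> nat \<Rightarrow> complex) \<Rightarrow> (nat \<Rightarrow> complex) \<Rightarrow> (nat \<Rightarrow> complex)" where
  "antiwick_sum q \<alpha> S a \<psi> = (if \<psi> \<in> L2a q \<alpha>
     then (\<lambda>n. \<Sum>(j, k)\<in>S. a (j, k) * (z_op q \<alpha> ^^ j) ((adjoint_op q \<alpha> (z_op q \<alpha>) ^^ k) \<psi>) n)
     else (\<lambda>_. 0))"

text \<open>\<open>D(U)'\<^sub>q\<close> is the type \<^typ>\<open>nat \<times> nat \<Rightarrow> complex\<close> with its product topology.\<close>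

definition is_covariant_symbol ::
  "real \<Rightarrow> real \<Rightarrow> ((nat \<Rightarrow> complex) \<Rightarrow> (nat \<Rightarrow> complex)) \<Rightarrow> (nat \<times> nat \<Rightarrow> complex) \<Rightarrow> bool" where
  "is_covariant_symbol q \<alpha> A a \<longleftrightarrow>
     limitin (weak_op_topology q \<alpha>) (\<lambda>S. antiwick_sum q \<alpha> S a) A (finite_subsets_at_top UNIV)"

definition covariant_symbol ::
  "real \<Rightarrow> real \<Rightarrow> ((nat \<Rightarrow> complex) \<Rightarrow> (nat \<Rightarrow> complex)) \<Rightarrow> (nat \<times> nat \<Rightarrow> complex)" where
  "covariant_symbol q \<alpha> A = (THE a. is_covariant_symbol q \<alpha> A a)"

definition quantize :: "real \<Rightarrow> real \<Rightarrow> pol \<Rightarrow> (nat \<Rightarrow> complex) \<Rightarrow> (nat \<Rightarrow> complex)" where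
  "quantize q \<alpha> f = antiwick_sum q \<alpha> (keys f) (lookup f)"

text \<open>\<open>\<alpha>\<close> is recovered from \<open>t = q\<^bsup>4\<alpha>\<^esup>\<close>, see \<open>m_t_parameter\<close> below.\<close>

definition m_t :: "real \<Rightarrow> real \<Rightarrow> pol \<Rightarrow> pol \<Rightarrow> (nat \<times> nat \<Rightarrow> complex)" where
  "m_t q t f g = (let \<alpha> = log q t / 4 in covariant_symbol q \<alpha> (quantize q \<alpha> f \<circ> quantize q \<alpha> g))"

text \<open>The limit is taken in the product topology of \<^typ>\<open>nat \<times> nat \<Rightarrow> complex\<close>; near \<open>at_right 0\<close> the
  parameter \<open>t\<close> lies in \<open>(0, 1)\<close>.\<close>

definition asymptotic_expansion :: "(real \<Rightarrow> nat \<times> nat \<Rightarrow> complex) \<Rightarrow> (nat \<Rightarrow> nat \<times> nat \<Rightarrow> complex) \<Rightarrow> bool" where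
  "asymptotic_expansion F c \<longleftrightarrow> (\<forall>N.
     ((\<lambda>t jk. inverse (of_real t ^ N) * (F t jk - (\<Sum>k\<le>N. c k jk * of_real t ^ k))) \<longlongrightarrow> (\<lambda>_. 0)) (at_right 0))"

lemma m_t_parameter:
  assumes "0 < q" "q < 1" "0 < t" "t < 1"
  shows "log q t / 4 > 0" "q powr (4 * (log q t / 4)) = t"
proof -
  show "log q t / 4 > 0" using assms by (simp add: log_def divide_neg_neg)
  have "4 * (log q t / 4) = log q t" by simp
  then show "q powr (4 * (log q t / 4)) = t" using assms by (simp only: powr_log_cancel)
qed

lemma weight_pos:
  assumes "0 < q" "q < 1" "\<alpha> > 0"
  shows "weight q \<alpha> k > 0"
proof -
  have "q\<^sup>2 < 1" using assms by (simp add: power_less_one_iff)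
  have pos: "1 - (q\<^sup>2) ^ i * a > 0" if "0 \<le> a" "a < 1" for i a
  proof -
    have "(q\<^sup>2) ^ i \<le> 1" using \<open>q\<^sup>2 < 1\<close> by (simp add: power_le_one)
    then have "(q\<^sup>2) ^ i * a \<le> 1 * a" using that by (intro mult_right_mono) auto
    then show ?thesis using that by simp
  qed
  have qp: "qpoch a (q\<^sup>2) k > 0" if "0 \<le> a" "a < 1" for a
    unfolding qpoch_def using pos[OF that] by (simp add: prod_pos)
  have "ln q < 0" using assms by simp
  then have "q powr (4 * \<alpha> + 2) < 1"
    using assms by (simp add: powr_def mult_pos_neg)
  then show ?thesis
    unfolding weight_def using \<open>q\<^sup>2 < 1\<close> by (intro divide_pos_pos qp) auto
qed

lemma scalar_prod_monomials:
  "scalar_prod q \<alpha> (\<lambda>i. of_bool (i = j)) (\<lambda>i. of_bool (i = k))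
     = (if j = k then of_real (qpoch (q\<^sup>2) (q\<^sup>2) k / qpoch (q powr (4 * \<alpha> + 2)) (q\<^sup>2) k) else 0)"
proof -
  have "scalar_prod q \<alpha> (\<lambda>i. of_bool (i = j)) (\<lambda>i. of_bool (i = k))
     = (\<Sum>i\<in>{k}. of_real (weight q \<alpha> i) * of_bool (i = j) * cnj (of_bool (i = k)))"
    unfolding scalar_prod_def by (rule suminf_finite) auto
  then show ?thesis by (auto simp: weight_def)
qed

lemma L2a_norm_eq:
  assumes "\<psi> \<in> L2a q \<alpha>"
  shows "L2a_norm q \<alpha> \<psi> = sqrt (suminf (\<lambda>k. weight q \<alpha> k * (cmod (\<psi> k))\<^sup>2))"
proof -
  have "scalar_prod q \<alpha> \<psi> \<psi> = (suminf (\<lambda>k. of_real (weight q \<alpha> k * (cmod (\<psi> k))\<^sup>2)))"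
    unfolding scalar_prod_def by (simp add: complex_norm_square mult.assoc del: of_real_power)
  also have "\<dots> = of_real (suminf (\<lambda>k. weight q \<alpha> k * (cmod (\<psi> k))\<^sup>2))"
    using assms by (intro suminf_of_real[symmetric]) (simp add: L2a_def)
  finally show ?thesis by (simp add: L2a_norm_def)
qed

text \<open>\<open>L2a\<close> is the completion of \<open>Cz\<close>: it contains \<open>Cz\<close> as a dense subset and is complete.\<close>

lemma L2a_diff:
  assumes "0 < q" "q < 1" "\<alpha> > 0" "\<psi> \<in> L2a q \<alpha>" "\<phi> \<in> L2a q \<alpha>"
  shows "(\<lambda>k. \<psi> k - \<phi> k) \<in> L2a q \<alpha>"
proof -
  have le: "(cmod (a - b))\<^sup>2 \<le> 2 * (cmod a)\<^sup>2 + 2 * (cmod b)\<^sup>2" for a b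
  proof -
    have "(cmod (a - b))\<^sup>2 \<le> (cmod a + cmod b)\<^sup>2"
      by (intro power_mono norm_triangle_ineq4) auto
    also have "\<dots> \<le> 2 * (cmod a)\<^sup>2 + 2 * (cmod b)\<^sup>2"
      using zero_le_power2[of "cmod a - cmod b"] by (simp add: power2_eq_square algebra_simps)
    finally show ?thesis .
  qed
  have "summable (\<lambda>k. 2 * (weight q \<alpha> k * (cmod (\<psi> k))\<^sup>2) + 2 * (weight q \<alpha> k * (cmod (\<phi> k))\<^sup>2))"
    using assms by (intro summable_add summable_mult) (auto simp: L2a_def)
  then have "summable (\<lambda>k. weight q \<alpha> k * (cmod (\<psi> k - \<phi> k))\<^sup>2)"
  proof (rule summable_comparison_test'[where N = 0])
    fix n :: nat
    have w: "weight q \<alpha> n > 0" using weight_pos assms by blast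
    have "weight q \<alpha> n * (cmod (\<psi> n - \<phi> n))\<^sup>2 \<le> weight q \<alpha> n * (2 * (cmod (\<psi> n))\<^sup>2 + 2 * (cmod (\<phi> n))\<^sup>2)"
      using w le by (intro mult_left_mono) auto
    then show "norm (weight q \<alpha> n * (cmod (\<psi> n - \<phi> n))\<^sup>2)
        \<le> 2 * (weight q \<alpha> n * (cmod (\<psi> n))\<^sup>2) + 2 * (weight q \<alpha> n * (cmod (\<phi> n))\<^sup>2)"
      using w by (simp add: algebra_simps)
  qed
  then show ?thesis by (simp add: L2a_def)
qed

theorem Cz_dense:
  assumes q: "0 < q" "q < 1" "\<alpha> > 0"
  shows "Cz \<subseteq> L2a q \<alpha>"
    and "\<psi> \<in> L2a q \<alpha> \<Longrightarrow> e > 0 \<Longrightarrow> \<exists>\<phi>\<in>Cz. L2a_norm q \<alpha> (\<lambda>k. \<psi> k - \<phi> k) < e"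
proof -
  show sub: "Cz \<subseteq> L2a q \<alpha>"
  proof
    fix \<psi> assume "\<psi> \<in> Cz"
    then show "\<psi> \<in> L2a q \<alpha>"
      unfolding Cz_def L2a_def mem_Collect_eq by (intro summable_finite) auto
  qed
  assume \<psi>: "\<psi> \<in> L2a q \<alpha>" and e: "e > 0"
  define w where "w = (\<lambda>k. weight q \<alpha> k * (cmod (\<psi> k))\<^sup>2)"
  have sw: "summable w" using \<psi> by (simp add: L2a_def w_def)
  from suminf_exist_split[OF _ sw, of "e\<^sup>2"] e
  obtain N where N: "norm (suminf (\<lambda>i. w (i + N))) < e\<^sup>2" by auto
  define \<phi> where "\<phi> = (\<lambda>k. if k < N then \<psi> k else 0)"
  have \<phi>: "\<phi> \<in> Cz"
    unfolding Cz_def \<phi>_def by (auto intro: finite_subset[of _ "{..<N}"])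
  then have d: "(\<lambda>k. \<psi> k - \<phi> k) \<in> L2a q \<alpha>" using L2a_diff[OF q \<psi>] sub by blast
  let ?v = "\<lambda>k. weight q \<alpha> k * (cmod (\<psi> k - \<phi> k))\<^sup>2"
  have "(suminf (\<lambda>k. ?v k)) = (suminf (\<lambda>k. ?v (k + N))) + sum ?v {..<N}"
    using d by (intro suminf_split_initial_segment) (simp add: L2a_def)
  also have "\<dots> = (suminf (\<lambda>k. w (k + N)))"
    by (simp add: \<phi>_def w_def)
  finally have "(suminf (\<lambda>k. ?v k)) < e\<^sup>2" using N by simp
  then have "L2a_norm q \<alpha> (\<lambda>k. \<psi> k - \<phi> k) < e"
    using e by (simp add: L2a_norm_eq[OF d] real_less_lsqrt)
  then show "\<exists>\<phi>\<in>Cz. L2a_norm q \<alpha> (\<lambda>k. \<psi> k - \<phi> k) < e" using \<phi> by blast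
qed

theorem L2a_complete:
  assumes q: "0 < q" "q < 1" "\<alpha> > 0"
    and X: "\<And>n. X n \<in> L2a q \<alpha>"
    and cauchy: "\<And>e. e > 0 \<Longrightarrow> \<exists>M. \<forall>m\<ge>M. \<forall>n\<ge>M. L2a_norm q \<alpha> (\<lambda>k. X m k - X n k) < e"
  shows "\<exists>\<psi>\<in>L2a q \<alpha>. (\<lambda>n. L2a_norm q \<alpha> (\<lambda>k. X n k - \<psi> k)) \<longlonglongrightarrow> 0"
proof -
  let ?w = "weight q \<alpha>"
  have w: "?w k > 0" for k using weight_pos q by blast
  have part: "(\<Sum>k\<in>K. ?w k * (cmod (\<psi> k))\<^sup>2) < e\<^sup>2"
    if "\<psi> \<in> L2a q \<alpha>" "L2a_norm q \<alpha> \<psi> < e" "finite K" for \<psi> e K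
  proof -
    have "(\<Sum>k\<in>K. ?w k * (cmod (\<psi> k))\<^sup>2) \<le> (suminf (\<lambda>k. ?w k * (cmod (\<psi> k))\<^sup>2))"
      using that(1,3) w by (intro sum_le_suminf) (auto simp: L2a_def less_imp_le)
    also have "\<dots> < e\<^sup>2"
    proof -
      have nn: "(suminf (\<lambda>k. ?w k * (cmod (\<psi> k))\<^sup>2)) \<ge> 0"
        using that(1) w by (intro suminf_nonneg) (auto simp: L2a_def less_imp_le)
      have "(sqrt (suminf (\<lambda>k. ?w k * (cmod (\<psi> k))\<^sup>2)))\<^sup>2 < e\<^sup>2"
        using that(2) nn by (intro power_strict_mono) (auto simp: L2a_norm_eq[OF that(1)])
      then show ?thesis using nn by simp
    qed
    finally show ?thesis .
  qed
  have "Cauchy (\<lambda>n. X n k)" for k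
  proof (rule metric_CauchyI)
    fix e :: real assume e: "e > 0"
    then have "sqrt (?w k) * e > 0" using w by simp
    from cauchy[OF this] obtain M where
      M: "\<And>m n. m \<ge> M \<Longrightarrow> n \<ge> M \<Longrightarrow> L2a_norm q \<alpha> (\<lambda>k. X m k - X n k) < sqrt (?w k) * e" by blast
    have "dist (X m k) (X n k) < e" if "m \<ge> M" "n \<ge> M" for m n
    proof -
      have "?w k * (cmod (X m k - X n k))\<^sup>2 < (sqrt (?w k) * e)\<^sup>2"
        using part[OF L2a_diff[OF q X X] M[OF that], of "{k}"] by simp
      also have "\<dots> = ?w k * e\<^sup>2" using w[of k] by (simp add: power_mult_distrib)
      finally have "(cmod (X m k - X n k))\<^sup>2 < e\<^sup>2" using w[of k] by simp
      then show ?thesis using e by (simp add: dist_norm power2_less_imp_less)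
    qed
    then show "\<exists>M. \<forall>m\<ge>M. \<forall>n\<ge>M. dist (X m k) (X n k) < e" by blast
  qed
  then have "\<forall>k. \<exists>l. (\<lambda>n. X n k) \<longlonglongrightarrow> l"
    using Cauchy_convergent_iff convergent_def by blast
  then obtain \<psi> where \<psi>: "\<And>k. (\<lambda>n. X n k) \<longlonglongrightarrow> \<psi> k" by metis
  have key: "\<exists>M. \<forall>m\<ge>M. (\<lambda>k. X m k - \<psi> k) \<in> L2a q \<alpha> \<and> L2a_norm q \<alpha> (\<lambda>k. X m k - \<psi> k) \<le> e"
    if e: "e > 0" for e
  proof -
    from cauchy[OF e] obtain M where
      M: "\<And>m n. m \<ge> M \<Longrightarrow> n \<ge> M \<Longrightarrow> L2a_norm q \<alpha> (\<lambda>k. X m k - X n k) < e" by blast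
    have "(\<lambda>k. X m k - \<psi> k) \<in> L2a q \<alpha> \<and> L2a_norm q \<alpha> (\<lambda>k. X m k - \<psi> k) \<le> e" if "m \<ge> M" for m
    proof -
      have le: "(\<Sum>k<K. ?w k * (cmod (X m k - \<psi> k))\<^sup>2) \<le> e\<^sup>2" for K
      proof (rule tendsto_upperbound)
        show "(\<lambda>n. \<Sum>k<K. ?w k * (cmod (X m k - X n k))\<^sup>2)
                \<longlonglongrightarrow> (\<Sum>k<K. ?w k * (cmod (X m k - \<psi> k))\<^sup>2)"
          by (intro tendsto_intros \<psi>)
        show "\<forall>\<^sub>F n in sequentially. (\<Sum>k<K. ?w k * (cmod (X m k - X n k))\<^sup>2) \<le> e\<^sup>2"
          using eventually_ge_at_top[of M]
        proof eventually_elim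
          case (elim n)
          show ?case
            using part[OF L2a_diff[OF q X X] M[OF that elim], of "{..<K}"] by simp
        qed
      qed simp
      have nn: "0 \<le> ?w k * (cmod (X m k - \<psi> k))\<^sup>2" for k
        using w[of k] by simp
      have "summable (\<lambda>k. ?w k * (cmod (X m k - \<psi> k))\<^sup>2)"
        by (rule summableI_nonneg_bounded[OF nn le])
      moreover from this have "(suminf (\<lambda>k. ?w k * (cmod (X m k - \<psi> k))\<^sup>2)) \<le> e\<^sup>2"
        by (intro suminf_le_const le)
      ultimately show ?thesis
        using e by (simp add: L2a_def L2a_norm_eq real_le_lsqrt)
    qed
    then show ?thesis by blast
  qed
  from key[of 1] obtain m where m: "(\<lambda>k. X m k - \<psi> k) \<in> L2a q \<alpha>" by force
  from L2a_diff[OF q X[of m] m] have "\<psi> \<in> L2a q \<alpha>" by simp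
  moreover have "(\<lambda>n. L2a_norm q \<alpha> (\<lambda>k. X n k - \<psi> k)) \<longlonglongrightarrow> 0"
  proof (rule LIMSEQ_I)
    fix r :: real assume "r > 0"
    then have "r / 2 > 0" by simp
    from key[OF this] obtain M where
      M: "\<And>m. m \<ge> M \<Longrightarrow> (\<lambda>k. X m k - \<psi> k) \<in> L2a q \<alpha> \<and> L2a_norm q \<alpha> (\<lambda>k. X m k - \<psi> k) \<le> r / 2"
      by blast
    have "norm (L2a_norm q \<alpha> (\<lambda>k. X n k - \<psi> k) - 0) < r" if "n \<ge> M" for n
    proof -
      have "L2a_norm q \<alpha> (\<lambda>k. X n k - \<psi> k) \<ge> 0"
        using M[OF that] w by (simp add: L2a_norm_eq suminf_nonneg L2a_def less_imp_le)
      then show ?thesis using M[OF that] \<open>r > 0\<close> by simp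
    qed
    then show "\<exists>M. \<forall>n\<ge>M. norm (L2a_norm q \<alpha> (\<lambda>k. X n k - \<psi> k) - 0) < r" by blast
  qed
  ultimately show ?thesis by blast
qed

end

theory Submission
  imports Defs
begin

text \<open>
  Put \<open>p = q\<^sup>2\<close>. In the monomial basis \<open>e\<^sub>N = z\<^sup>N\<close> the operator \<open>z*\<close> acts by
  \<open>e\<^sub>N \<mapsto> (1 - p\<^sup>N) / (1 - t p\<^sup>N) e\<^sub>N\<^sub>-\<^sub>1\<close>, and at \<open>t = 0\<close> this is a representation of \<open>Pol(\<complex>)\<^sub>q\<close>.
  A symbol is determined, through a triangular system not depending on \<open>t\<close>, by the matrix entries of
  its quantization at \<open>t = 0\<close>; these are obtained from the entries at \<open>t\<close> by averaging against the
  \<open>q\<close>-binomial weights with parameter \<open>t p\<close>.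

  For the product of \<open>z\<^sup>a z*\<^sup>k\<close> and \<open>z\<^sup>l z*\<^sup>m\<close> let \<open>g\<^sub>k\<^sub>,\<^sub>l(t)\<close> be such an averaged entry divided by \<open>1 - t\<close>. A
  contiguity relation, true even before averaging up to a summation by parts, gives
  \<open>(1 - t) (1 - p t) g\<^sub>k\<^sub>,\<^sub>l(t) - (1 - p t)\<^sup>2 g\<^sub>k\<^sub>,\<^sub>l(p t) = t (\<Lambda> g)\<^sub>k\<^sub>,\<^sub>l(t)\<close>, where \<open>\<Lambda>\<close> is the tridiagonal
  action of \<open>(1 - p)\<^sup>2 \<box>\<close> on the \<open>z\<^sup>a z*\<^sup>k \<otimes> z\<^sup>l z*\<^sup>m\<close>. Comparing Taylor coefficients yields exactly the
  three-term recurrence of the polynomials \<open>p\<^sub>k\<close>, so that \<open>g = \<Sum>\<^sub>k t\<^sup>k p\<^sub>k(\<box>)\<close>, and multiplying by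
  \<open>1 - t\<close> produces the differences \<open>p\<^sub>k - p\<^sub>k\<^sub>-\<^sub>1\<close>.
\<close>

section \<open>The weighted shift and \<open>q\<close>-binomial averages\<close>

text \<open>With p = q^2 and t = q^(4 \<alpha>) this is the ratio of the squared norms of e_n and
  e_(n-1), which the adjoint of the shift picks up. The field is general because t is real in the
  Hilbert space and complex in the power series.\<close>

definition zs_coeff :: "'a::field \<Rightarrow> 'a \<Rightarrow> nat \<Rightarrow> 'a" where
  "zs_coeff p t n = (1 - p ^ n) / (1 - t * p ^ n)"

text \<open>The coefficient in \<open>z*\<^sup>k e\<^sub>N\<close>. For \<open>k > N\<close> the truncated subtraction produces the factor
  \<open>zs_coeff p t 0 = 0\<close>, which is the correct value.\<close>

definition zs_power_coeff :: "'a::field \<Rightarrow> 'a \<Rightarrow> nat \<Rightarrow> nat \<Rightarrow> 'a" where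
  "zs_power_coeff p t N k = (\<Prod>i<k. zs_coeff p t (N - i))"

text \<open>\<open>qmean p x M f = \<Sum>\<^sub>N [M choose N]\<^sub>p x\<^sup>M\<^sup>-\<^sup>N (x; p)\<^sub>N f N\<close>; the recursion is the \<open>q\<close>-Pascal rule, and
  using it as the definition avoids Gaussian binomials altogether.\<close>

fun qmean :: "'a::field \<Rightarrow> 'a \<Rightarrow> nat \<Rightarrow> (nat \<Rightarrow> 'a) \<Rightarrow> 'a" where
  "qmean p x 0 f = f 0"
| "qmean p x (Suc M) f = qmean p x M (\<lambda>N. p ^ N * x * f N + (1 - x * p ^ N) * f (Suc N))"

lemma zs_coeff_0 [simp]: "zs_coeff p t 0 = 0"
  by (simp add: zs_coeff_def)

lemma zs_power_coeff_0 [simp]: "zs_power_coeff p t N 0 = 1"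
  by (simp add: zs_power_coeff_def)

lemma zs_power_coeff_Suc: "zs_power_coeff p t N (Suc k) = zs_power_coeff p t N k * zs_coeff p t (N - k)"
  by (simp add: zs_power_coeff_def)

lemma zs_power_coeff_rec: "zs_power_coeff p t N (Suc k) = zs_coeff p t N * zs_power_coeff p t (N - 1) k"
  by (simp add: zs_power_coeff_def prod.lessThan_Suc_shift del: prod.lessThan_Suc)

lemma zs_power_coeff_Suc_Suc:
  "zs_power_coeff p t (Suc N) (Suc k) = zs_coeff p t (Suc N) * zs_power_coeff p t N k"
  by (simp add: zs_power_coeff_rec)

lemma zs_power_coeff_eq_0: "N < k \<Longrightarrow> zs_power_coeff p t N k = 0"
  by (auto simp: zs_power_coeff_def intro!: bexI[of _ N])

lemma qmean_add: "qmean p x M (\<lambda>N. f N + g N) = qmean p x M f + qmean p x M g"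
proof (induction M arbitrary: f g)
  case (Suc M)
  show ?case by (simp add: Suc[symmetric] algebra_simps)
qed simp

lemma qmean_scale: "qmean p x M (\<lambda>N. c * f N) = c * qmean p x M f"
proof (induction M arbitrary: f)
  case (Suc M)
  show ?case by (simp add: Suc[symmetric] algebra_simps)
qed simp

lemma qmean_sum: "qmean p x M (\<lambda>N. \<Sum>i\<in>A. f i N) = (\<Sum>i\<in>A. qmean p x M (f i))"
proof (induction A rule: infinite_finite_induct)
  case (insert a A)
  then show ?case by (simp add: qmean_add)
qed (use qmean_scale[of p x M 0 "\<lambda>_. 0"] in auto)

lemma qmean_cong:
  assumes "\<And>N. N \<le> M \<Longrightarrow> f N = g N"
  shows "qmean p x M f = qmean p x M g"
  using assms
proof (induction M arbitrary: f g)
  case (Suc M)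
  have "f N = g N" "f (Suc N) = g (Suc N)" if "N \<le> M" for N
    using Suc.prems that by simp_all
  then show ?case unfolding qmean.simps by (intro Suc.IH) simp
qed simp

lemma qmean_at_0: "qmean p 0 M f = f M"
  by (induction M arbitrary: f) auto

text \<open>The operators of the two sides commute with the recursion step of \<^const>\<open>qmean\<close>.\<close>

lemma qmean_shift:
  "(1 - x) * qmean p (x * p) M f = qmean p x M (\<lambda>N. (1 - x * p ^ N) * f N - x * (1 - p ^ N) * f (N - 1))"
proof (induction M arbitrary: f)
  case (Suc M)
  show ?case
    unfolding qmean.simps Suc
  proof (rule qmean_cong)
    fix N
    show "(1 - x * p ^ N) * (p ^ N * (x * p) * f N + (1 - x * p * p ^ N) * f (Suc N))
        - x * (1 - p ^ N) * (p ^ (N - 1) * (x * p) * f (N - 1) + (1 - x * p * p ^ (N - 1)) * f (Suc (N - 1)))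
      = p ^ N * x * ((1 - x * p ^ N) * f N - x * (1 - p ^ N) * f (N - 1))
        + (1 - x * p ^ N) * ((1 - x * p ^ Suc N) * f (Suc N) - x * (1 - p ^ Suc N) * f (Suc N - 1))"
      \<comment> \<open>At N = 0 the factor \<open>1 - p ^ N\<close> removes the terms in which
        \<open>N - 1\<close> is truncated.\<close>
      by (cases N) (simp_all add: algebra_simps)
  qed
qed simp

text \<open>At t = 0 the coefficient is (p; p)_k times the Gaussian binomial [N choose k], so this
  is the q-Pascal rule multiplied by (p; p)_(k+1).\<close>

lemma zs_power_coeff_0_Pascal:
  "zs_power_coeff p 0 (Suc M) (Suc k)
     = p ^ Suc k * zs_power_coeff p 0 M (Suc k) + (1 - p ^ Suc k) * zs_power_coeff p 0 M k"
proof (cases "k \<le> M")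
  case True
  then have "p ^ Suc M = p ^ Suc k * p ^ (M - k)" by (simp flip: power_add)
  then show ?thesis
    unfolding zs_power_coeff_Suc_Suc
    by (simp only: zs_power_coeff_Suc[of p 0 M] zs_coeff_def) (simp add: algebra_simps)
qed (simp add: zs_power_coeff_eq_0)

text \<open>One recursion step of \<open>qmean\<close> at x = t p acts on
  \<open>zs_power_coeff p t N k\<close> with the coefficients p^k and 1 - p^k, which depend on
  neither N nor t. They are those of the q-Pascal rule at t = 0, so both sides obey the same
  recursion in M.\<close>

lemma qmean_zs_power_coeff:
  assumes "\<And>n. t * p ^ n \<noteq> 1"
  shows "qmean p (t * p) M (\<lambda>N. zs_power_coeff p t N k) = zs_power_coeff p 0 M k"
proof (induction M arbitrary: k)
  case 0
  show ?case by (cases k) (simp_all add: zs_power_coeff_rec)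
next
  case (Suc M)
  show ?case
  proof (cases k)
    case 0
    then show ?thesis using Suc[of 0] by (simp add: algebra_simps)
  next
    case (Suc k')
    have "p ^ N * (t * p) * zs_power_coeff p t N k + (1 - t * p * p ^ N) * zs_power_coeff p t (Suc N) k
       = p ^ k * zs_power_coeff p t N k + (1 - p ^ k) * zs_power_coeff p t N k'" for N
    proof (cases "k' \<le> N")
      case True
      define y where "y = p ^ (N - k')"
      have N: "p ^ N = p ^ k' * y" using True by (simp add: y_def flip: power_add)
      have nz: "1 - t * y \<noteq> 0" "1 - t * (p * p ^ N) \<noteq> 0"
        using assms[of "N - k'"] assms[of "Suc N"] by (auto simp: y_def)
      define r where "r = (1 - y) / (1 - t * y)"
      have "(1 - t * p * p ^ N) * zs_power_coeff p t (Suc N) k = (1 - p * p ^ N) * zs_power_coeff p t N k'"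
        using nz(2) unfolding Suc zs_power_coeff_Suc_Suc by (simp add: zs_coeff_def mult.assoc)
      moreover have "zs_power_coeff p t N k = zs_power_coeff p t N k' * r"
        unfolding Suc zs_power_coeff_Suc by (simp add: zs_coeff_def y_def r_def)
      moreover have "zs_power_coeff p t N k' * (p ^ N * (t * p) * r + (1 - p * p ^ N))
          = zs_power_coeff p t N k' * (p ^ k * r + (1 - p ^ k))"
        using nz(1) unfolding N Suc r_def by (simp add: field_simps)
      ultimately show ?thesis
        by (simp only:) (simp only: distrib_left mult_ac)
    qed (simp add: Suc zs_power_coeff_eq_0)
    then have "qmean p (t * p) (Suc M) (\<lambda>N. zs_power_coeff p t N k)
        = p ^ k * zs_power_coeff p 0 M k + (1 - p ^ k) * zs_power_coeff p 0 M k'"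
      by (simp add: qmean_add qmean_scale Suc.IH)
    then show ?thesis using zs_power_coeff_0_Pascal[of p M k'] Suc by simp
  qed
qed

text \<open>The numerators do not involve t, and the denominators for t p are those for t moved by
  one place, so the quotient telescopes to two end factors.\<close>

lemma zs_power_coeff_dilate:
  assumes "p \<noteq> 0" "\<And>n. t * p ^ n \<noteq> 1"
  shows "zs_power_coeff p (t * p) h k * (1 - t * p ^ Suc h) = zs_power_coeff p t h k * (1 - t * p ^ Suc h / p ^ k)"
proof (induction k)
  case (Suc k)
  show ?case
  proof (cases "k < h")
    case True
    define y where "y = p ^ (h - k)"
    have y: "p ^ h = p ^ k * y" using True by (simp add: y_def flip: power_add)
    have nz: "1 - t * y \<noteq> 0" "1 - t * p * y \<noteq> 0"
      using assms(2)[of "h - k"] assms(2)[of "Suc (h - k)"] by (auto simp: y_def mult.assoc)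
    have "zs_power_coeff p (t * p) h (Suc k) * (1 - t * p ^ Suc h)
        = zs_power_coeff p (t * p) h k * (1 - t * p ^ Suc h) * ((1 - y) / (1 - t * p * y))"
      by (simp add: zs_power_coeff_Suc zs_coeff_def y_def)
    also have "\<dots> = zs_power_coeff p t h k * (1 - t * p * y) * ((1 - y) / (1 - t * p * y))"
      unfolding Suc using assms(1) by (simp add: y mult.assoc)
    also have "\<dots> = zs_power_coeff p t h k * ((1 - y) / (1 - t * y)) * (1 - t * y)"
      using nz by simp
    also have "\<dots> = zs_power_coeff p t h (Suc k) * (1 - t * p ^ Suc h / p ^ Suc k)"
      using assms(1) by (simp add: zs_power_coeff_Suc zs_coeff_def y_def[symmetric] y)
    finally show ?thesis .
  qed (simp add: zs_power_coeff_Suc)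
qed simp

text \<open>Here the denominators coincide, as t p p^(h-1-i) = t p^(h-i), and the numerators
  telescope.\<close>

lemma zs_power_coeff_dilate_pred:
  assumes "p \<noteq> 0" "\<And>n. t * p ^ n \<noteq> 1"
  shows "(1 - p ^ h) * zs_power_coeff p (t * p) (h - 1) k = zs_power_coeff p t h k * (1 - p ^ h / p ^ k)"
proof (induction k)
  case (Suc k)
  show ?case
  proof (cases "k < h")
    case True
    define y where "y = p ^ (h - Suc k)"
    have y: "p ^ h = p ^ k * (p * y)" and hk: "h - k = Suc (h - Suc k)"
      using True by (simp_all add: y_def flip: power_add power_Suc)
    have nz: "1 - t * p * y \<noteq> 0"
      using assms(2)[of "Suc (h - Suc k)"] by (auto simp: y_def mult.assoc)
    have "(1 - p ^ h) * zs_power_coeff p (t * p) (h - 1) (Suc k)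
        = zs_power_coeff p t h k * (1 - p ^ h / p ^ k) * ((1 - y) / (1 - t * p * y))"
      unfolding Suc[symmetric] by (simp add: zs_power_coeff_Suc zs_coeff_def y_def)
    also have "\<dots> = zs_power_coeff p t h k * ((1 - p * y) / (1 - t * p * y)) * (1 - y)"
      using assms(1) by (simp add: y)
    also have "\<dots> = zs_power_coeff p t h (Suc k) * (1 - p ^ h / p ^ Suc k)"
      using assms(1) by (simp add: zs_power_coeff_Suc zs_coeff_def hk y_def[symmetric] y mult.assoc)
    finally show ?thesis .
  next
    case False
    then show ?thesis using assms(1) Suc
      by (cases "k = h") (auto simp: zs_power_coeff_Suc zs_power_coeff_eq_0)
  qed
qed simp

text \<open>The left side contains the difference operator of \<open>qmean_shift\<close>, the right
  side the tridiagonal action of the box operator. By the two dilation lemmas every term is a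
  rational multiple of one coefficient X, apart from degenerate indices.\<close>

lemma zs_power_coeff_contiguous:
  fixes p t :: "'a::field"
  assumes p: "p \<noteq> 0" "\<And>n. p ^ Suc n \<noteq> 1" and t: "\<And>n. t * p ^ n \<noteq> 1"
  shows "(1 - t * p) * zs_power_coeff p t (N + l) k
     - (1 - t * p * p ^ N) * zs_power_coeff p (t * p) (N + l) k
     + t * p * (1 - p ^ N) * zs_power_coeff p (t * p) (N + l - 1) k
   = t / (1 - t) * (p * (1 - 1 / p ^ k) * (1 - 1 / p ^ l))
     * (zs_power_coeff p t (N + l - 1) (k - 1) - (1 + 1 / p) * zs_power_coeff p t (N + l) k
        + 1 / p * zs_power_coeff p t (Suc (N + l)) (Suc k))"
\<comment> \<open>Where \<open>k - 1\<close> or \<open>N + l - 1\<close> is truncated, the factors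
  in front of it vanish.\<close>
proof (cases "N + l = 0 \<or> k = 0")
  case True
  then show ?thesis
    by (cases "k = 0") (simp_all add: zs_power_coeff_eq_0, simp add: algebra_simps)
next
  case False
  define h s u v X where "h = N + l" and "s = p ^ h" and "u = p ^ k" and "v = p ^ l"
    and "X = zs_power_coeff p t (h - 1) (k - 1)"
  have nz: "1 - t \<noteq> 0" "1 - t * s \<noteq> 0" "1 - t * p * s \<noteq> 0" "1 - s \<noteq> 0" "u \<noteq> 0" "v \<noteq> 0"
    using t[of 0] t[of h] t[of "Suc h"] p(2)[of "h - 1"] p(1) False
    by (auto simp: s_def u_def v_def h_def mult.assoc simp flip: power_Suc)
  have s: "s = v * p ^ N" by (simp add: s_def v_def h_def power_add)
  then have PN: "p ^ N = s / v" using nz by simp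
  define Y where "Y = zs_power_coeff p t h k"
  have Y: "Y = (1 - s) / (1 - t * s) * X"
    using False zs_power_coeff_rec[of p t h "k - 1"]
    by (simp add: Y_def X_def zs_coeff_def s_def)
  have Y1: "zs_power_coeff p t (Suc h) (Suc k) = (1 - p * s) / (1 - t * p * s) * Y"
    by (simp add: zs_power_coeff_Suc_Suc Y_def zs_coeff_def s_def mult.assoc)
  have D: "zs_power_coeff p (t * p) h k = Y * (1 - t * p * s / u) / (1 - t * p * s)"
    using zs_power_coeff_dilate[OF p(1) t, of h k] nz
    by (simp add: Y_def s_def u_def eq_divide_eq mult.assoc)
  have D': "zs_power_coeff p (t * p) (h - 1) k = Y * (1 - s / u) / (1 - s)"
    using zs_power_coeff_dilate_pred[OF p(1) t, of h k] nz
    by (simp add: Y_def s_def u_def eq_divide_eq mult.commute)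
  have "(1 - t * p) * Y - (1 - t * p * (s / v)) * (Y * (1 - t * p * s / u) / (1 - t * p * s))
      + t * p * (1 - s / v) * (Y * (1 - s / u) / (1 - s))
    = t / (1 - t) * (p * (1 - 1 / u) * (1 - 1 / v))
       * (X - (1 + 1 / p) * Y + 1 / p * ((1 - p * s) / (1 - t * p * s) * Y))"
    \<comment> \<open>Clearing denominators leaves a polynomial identity in t, p, s, u, v, linear in
      X.\<close>
    unfolding Y using nz p(1) by (simp add: divide_simps) algebra
  then show ?thesis
    unfolding h_def[symmetric] PN D D' Y1 unfolding X_def[symmetric] Y_def[symmetric] u_def[symmetric] v_def[symmetric] .
qed

text \<open>The coefficient in \<open>z*\<^sup>k z\<^sup>l z*\<^sup>m e\<^sub>N\<close>.\<close>

definition product_entry :: "'a::field \<Rightarrow> 'a \<Rightarrow> nat \<Rightarrow> nat \<Rightarrow> nat \<Rightarrow> nat \<Rightarrow> 'a" where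
  "product_entry p t m k l N = zs_power_coeff p t N m * zs_power_coeff p t (N - m + l) k"

text \<open>The dilation lemmas, applied to the extra factor X of z*^m, exchange
  \<open>1 - t * p * p ^ N\<close> and \<open>1 - p ^ N\<close> for the same expressions in N' = N -
  m. What remains is X times the previous lemma at N'.\<close>

lemma product_entry_contiguous:
  fixes p t :: "'a::field"
  assumes p: "p \<noteq> 0" "\<And>n. p ^ Suc n \<noteq> 1" and t: "\<And>n. t * p ^ n \<noteq> 1"
  shows "(1 - t * p) * product_entry p t m k l N
     - (1 - t * p * p ^ N) * product_entry p (t * p) m k l N
     + t * p * (1 - p ^ N) * product_entry p (t * p) m k l (N - 1)
   = t / (1 - t) * (p * (1 - 1 / p ^ k) * (1 - 1 / p ^ l))
     * (product_entry p t m (k - 1) (l - 1) N - (1 + 1 / p) * product_entry p t m k l N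
        + 1 / p * product_entry p t m (Suc k) (Suc l) N)"
proof (cases "m \<le> N")
  case False
  then show ?thesis by (simp add: product_entry_def zs_power_coeff_eq_0)
next
  case True
  define N' c where "N' = N - m" and "c = t / (1 - t) * (p * (1 - 1 / p ^ k) * (1 - 1 / p ^ l))"
  define X where "X = zs_power_coeff p t N m"
  define Z where "Z = zs_power_coeff p (t * p) (N' + l) k"
  define Z' where "Z' = zs_power_coeff p (t * p) (N' + l - 1) k"
  have PN: "p ^ N = p ^ m * p ^ N'" using True by (simp add: N'_def flip: power_add)
  have P: "p ^ N / p ^ m = p ^ N'" using p(1) by (simp add: PN)
  have 1: "(1 - t * p * p ^ N) * zs_power_coeff p (t * p) N m = X * (1 - t * p * p ^ N')"
  proof -
    have "t * p ^ Suc N / p ^ m = t * p * p ^ N'" "t * p ^ Suc N = t * p * p ^ N"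
      using p(1) by (simp_all add: PN)
    then show ?thesis
      using zs_power_coeff_dilate[OF p(1) t, of N m] by (simp only: X_def mult.commute)
  qed
  have 2: "(1 - p ^ N) * zs_power_coeff p (t * p) (N - 1) m = X * (1 - p ^ N')"
    using zs_power_coeff_dilate_pred[OF p(1) t, of N m] P by (simp add: X_def)
  have e1: "(1 - t * p * p ^ N) * product_entry p (t * p) m k l N = X * ((1 - t * p * p ^ N') * Z)"
    unfolding product_entry_def mult.assoc[symmetric] 1 by (simp add: Z_def N'_def)
  have e2: "(1 - p ^ N) * product_entry p (t * p) m k l (N - 1) = X * ((1 - p ^ N') * Z')"
  \<comment> \<open>The indices \<open>N - 1 - m + l\<close> and \<open>N' + l - 1\<close> can
    differ only for N' = 0, where \<open>1 - p ^ N'\<close> kills both terms.\<close>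
  proof (cases "N' = 0")
    case False
    then have "N - 1 - m + l = N' + l - 1" by (simp add: N'_def)
    then show ?thesis
      unfolding product_entry_def mult.assoc[symmetric] 2 by (simp add: Z'_def)
  next
    case True
    then show ?thesis 
      unfolding product_entry_def mult.assoc[symmetric] 2 by simp
  qed
  have e3: "c
     * (product_entry p t m (k - 1) (l - 1) N - (1 + 1 / p) * product_entry p t m k l N
        + 1 / p * product_entry p t m (Suc k) (Suc l) N)
   = X * (c
     * (zs_power_coeff p t (N' + l - 1) (k - 1) - (1 + 1 / p) * zs_power_coeff p t (N' + l) k
        + 1 / p * zs_power_coeff p t (Suc (N' + l)) (Suc k)))"
  \<comment> \<open>For l = 0 the truncated \<open>l - 1\<close> gives a wrong index, but then c =
    0.\<close>
  proof (cases "l = 0")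
    case False
    then have "N' + (l - 1) = N' + l - 1" "N' + Suc l = Suc (N' + l)" by simp_all
    then show ?thesis
      unfolding product_entry_def X_def[symmetric] N'_def[symmetric]
      by (simp only: distrib_left right_diff_distrib mult_ac)
  qed (simp add: c_def)
  have e4: "(1 - t * p) * product_entry p t m k l N = X * ((1 - t * p) * zs_power_coeff p t (N' + l) k)"
    by (simp add: product_entry_def X_def N'_def)
  show ?thesis
    unfolding c_def[symmetric] mult.assoc[of "t * p"] e1 e2 e3 e4
    unfolding zs_power_coeff_contiguous[OF p t, of N' l k, folded Z_def Z'_def c_def, symmetric]
    by (simp only: distrib_left right_diff_distrib mult_ac)
qed

section \<open>Averaged entries and their equation under the dilation of t by p\<close>

definition symbol_gf :: "'a::field \<Rightarrow> nat \<Rightarrow> nat \<Rightarrow> 'a \<Rightarrow> nat \<Rightarrow> nat \<Rightarrow> 'a" where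
  "symbol_gf p M m t k l = qmean p (t * p) M (product_entry p t m k l) / (1 - t)"

text \<open>By \<open>qmean_shift\<close> at x = t p the mean at t p^2 becomes a mean at t p of a
  differenced sequence. All terms then stand under the same mean, and the contiguity relation
  applies for each N.\<close>

lemma symbol_gf_dilate:
  fixes p t :: "'a::field"
  assumes p: "p \<noteq> 0" "\<And>n. p ^ Suc n \<noteq> 1" and t: "\<And>n. t * p ^ n \<noteq> 1"
  shows "(1 - t) * (1 - t * p) * symbol_gf p M m t k l - (1 - t * p)\<^sup>2 * symbol_gf p M m (t * p) k l
    = t * (p * (1 - 1 / p ^ k) * (1 - 1 / p ^ l)
        * (symbol_gf p M m t (k - 1) (l - 1) - (1 + 1 / p) * symbol_gf p M m t k l + 1 / p * symbol_gf p M m t (Suc k) (Suc l)))"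
proof -
  have nz: "1 - t \<noteq> 0" "1 - t * p \<noteq> 0" using t[of 0] t[of 1] by auto
  define c where "c = p * (1 - 1 / p ^ k) * (1 - 1 / p ^ l)"
  let ?m = "qmean p (t * p) M"
  have "(1 - t * p) * ?m (product_entry p t m k l) - (1 - t * p) * qmean p (t * p * p) M (product_entry p (t * p) m k l)
    = ?m (\<lambda>N. (1 - t * p) * product_entry p t m k l N + (- 1) * 
         ((1 - t * p * p ^ N) * product_entry p (t * p) m k l N
           - t * p * (1 - p ^ N) * product_entry p (t * p) m k l (N - 1)))"
    unfolding qmean_shift qmean_add qmean_scale by simp
  also have "\<dots> = ?m (\<lambda>N. t / (1 - t) * c * (product_entry p t m (k - 1) (l - 1) N
       + (- (1 + 1 / p)) * product_entry p t m k l N + 1 / p * product_entry p t m (Suc k) (Suc l) N))"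
  proof (rule qmean_cong)
    fix N
    show "(1 - t * p) * product_entry p t m k l N + (- 1) * 
         ((1 - t * p * p ^ N) * product_entry p (t * p) m k l N
           - t * p * (1 - p ^ N) * product_entry p (t * p) m k l (N - 1))
       = t / (1 - t) * c * (product_entry p t m (k - 1) (l - 1) N
       + (- (1 + 1 / p)) * product_entry p t m k l N + 1 / p * product_entry p t m (Suc k) (Suc l) N)"
      using product_entry_contiguous[OF p t, of m k l N] unfolding c_def by (simp add: algebra_simps)
  qed
  also have "\<dots> = t * (c * (?m (product_entry p t m (k - 1) (l - 1)) / (1 - t)
      - (1 + 1 / p) * (?m (product_entry p t m k l) / (1 - t)) + 1 / p * (?m (product_entry p t m (Suc k) (Suc l)) / (1 - t))))"
    unfolding qmean_add qmean_scale by (simp add: divide_inverse algebra_simps)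
  finally show ?thesis
    using nz unfolding symbol_gf_def c_def[symmetric] by (simp add: power2_eq_square mult.assoc)
qed

section \<open>The polynomials \<open>p\<^sub>k\<close> and the box operator\<close>

text \<open>Keeps the denominators nonzero on the whole complex unit disc, as Taylor expansion in t
  requires a complex neighbourhood of 0.\<close>

lemma of_real_mult_power_neq_1:
  assumes "0 < q" "q < 1" "norm (t :: complex) < 1"
  shows "t * of_real (q\<^sup>2) ^ n \<noteq> 1"
proof -
  have "(q\<^sup>2) ^ n \<le> 1" using assms by (simp add: power_le_one)
  then have "norm (t * of_real (q\<^sup>2) ^ n) \<le> norm t * 1"
    unfolding norm_mult by (intro mult_left_mono) (simp_all add: norm_power)
  then show ?thesis using assms(3) by auto
qed

lemma of_real_power_neq_1:
  assumes "0 < q" "q < 1"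
  shows "complex_of_real (q\<^sup>2) ^ Suc n \<noteq> 1"
  using of_real_mult_power_neq_1[OF assms, of "of_real (q\<^sup>2)" n] assms
  by (simp add: norm_power power_less_one_iff)

section \<open>Newton form and three-term recurrence of the polynomials p_k\<close>

lemma qpoch_Suc: "qpoch a p (Suc j) = qpoch a p j * (1 - p ^ j * a)"
  by (simp add: qpoch_def)

lemma qpoch_Suc_shift: "qpoch a p (Suc j) = (1 - a) * qpoch (p * a) p j"
  by (simp add: qpoch_def prod.lessThan_Suc_shift mult_ac del: prod.lessThan_Suc)

definition p_poly_coeff :: "complex \<Rightarrow> nat \<Rightarrow> nat \<Rightarrow> complex" where
  "p_poly_coeff p K j = qpoch (1 / p ^ K) p j / (qpoch p p j)\<^sup>2 * p ^ j"

text \<open>The factors in p_k, split into constant and linear part: a Newton basis with nodes (1 -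
  p^i) (1 - p^(i+1)) / (p^i (1 - p)^2).\<close>

definition p_poly_basis :: "complex \<Rightarrow> nat \<Rightarrow> complex poly" where
  "p_poly_basis p j = (\<Prod>i<j. [: (1 - p ^ i) * (1 - p ^ Suc i), - (p ^ i * (1 - p)\<^sup>2) :])"

text \<open>(p^(-K); p)_j contains the zero factor i = K. Hence p_K may be summed up to any n \<ge>
  K, which puts consecutive polynomials over one index range.\<close>

lemma p_poly_coeff_eq_0:
  assumes "p \<noteq> 0" "K < j"
  shows "p_poly_coeff p K j = 0"
proof -
  have "qpoch (1 / p ^ K) p j = 0"
    unfolding qpoch_def using assms by (auto intro!: bexI[of _ K])
  then show ?thesis by (simp add: p_poly_coeff_def)
qed

lemma p_poly_expand:
  assumes "q \<noteq> 0" "K \<le> n"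
  shows "p_poly q K = (\<Sum>j\<le>n. smult (p_poly_coeff (of_real (q\<^sup>2)) K j) (p_poly_basis (of_real (q\<^sup>2)) j))"
proof -
  define Q p where "Q = complex_of_real q" and "p = complex_of_real (q\<^sup>2)"
  have p: "p = Q\<^sup>2" "Q \<noteq> 0" "p \<noteq> 0" using assms(1) by (simp_all add: p_def Q_def)
  have pw: "Q ^ (2 * i) = p ^ i" "Q ^ (4 * i + 2) = p ^ i * p ^ Suc i" for i
    by (simp_all add: p(1) power_mult[symmetric] power_add[symmetric] power_Suc[symmetric] algebra_simps del: power_Suc)
  have "Q powi (- 2 * int K) = inverse (Q powi int (2 * K))"
    by (simp add: power_int_minus)
  then have A: "Q powi (- 2 * int K) = 1 / p ^ K"
    by (simp only: power_int_of_nat pw divide_inverse mult_1_left)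
  have f: "1 - smult (p ^ i) [: 1 + p, (1 - p)\<^sup>2 :] + [: p ^ i * p ^ Suc i :]
      = [: (1 - p ^ i) * (1 - p ^ Suc i), - (p ^ i * (1 - p)\<^sup>2) :]" for i
    by (simp add: algebra_simps one_pCons)
  have "p_poly q K = (\<Sum>j\<le>K. smult (p_poly_coeff p K j) (p_poly_basis p j))"
    unfolding p_poly_def Let_def Q_def[symmetric] A pw p(1)[symmetric] f
    by (simp add: p_poly_coeff_def p_poly_basis_def)
  also have "\<dots> = (\<Sum>j\<le>n. smult (p_poly_coeff p K j) (p_poly_basis p j))"
    using assms(2) p by (intro sum.mono_neutral_left) (auto simp: p_poly_coeff_eq_0)
  finally show ?thesis by (simp add: p_def)
qed

text \<open>This is the coefficient at i + 1 of the recurrence for p_K in the Newton basis. Pulling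
  out e = (p^(-K); p)_i and d = (p; p)_i leaves a rational identity in p, x = p^K and y =
  p^i.\<close>

lemma p_poly_coeff_recurrence:
  fixes p :: complex
  assumes p: "p \<noteq> 0" "\<And>n. p ^ Suc n \<noteq> 1"
  shows "(1 - p ^ Suc K) * (p_poly_coeff p (Suc K) (Suc i) - p_poly_coeff p K (Suc i))
     + p * (1 - p ^ K) * (p_poly_coeff p (K - 1) (Suc i) - p_poly_coeff p K (Suc i))
   = (1 - p ^ Suc i) * (1 - p ^ Suc (Suc i)) / p ^ Suc i * p_poly_coeff p K (Suc i) - p_poly_coeff p K i / p ^ i"
proof -
  define x y e d where "x = p ^ K" and "y = p ^ i" and "e = qpoch (1 / p ^ K) p i" and "d = qpoch p p i"
  have "d \<noteq> 0" unfolding d_def qpoch_def using p(2) by (auto simp: power_commutes)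
  have nz: "x \<noteq> 0" "y \<noteq> 0" "d \<noteq> 0" "1 - p * y \<noteq> 0"
    using p(1) \<open>d \<noteq> 0\<close> p(2)[of i] by (auto simp: x_def y_def)
  have q0: "qpoch (1 / p ^ K) p (Suc i) = e * (1 - y / x)"
    by (simp add: qpoch_Suc e_def y_def x_def)
  have q1: "qpoch (1 / p ^ Suc K) p (Suc i) = (1 - 1 / (p * x)) * e"
    using p(1) by (simp add: qpoch_Suc_shift e_def x_def)
  \<comment> \<open>\<open>K - 1\<close> is truncated at K = 0; the factor \<open>1 - x\<close> is
    kept because it vanishes there.\<close>
  have q2: "(1 - x) * qpoch (1 / p ^ (K - 1)) p (Suc i) = - x * (e * (1 - y / x) * (1 - p * y / x))"
  proof -
    have "e * (1 - y / x) * (1 - p * y / x) = qpoch (1 / p ^ K) p (Suc (Suc i))"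
      unfolding qpoch_Suc by (simp add: e_def x_def y_def)
    moreover have "(1 - x) * qpoch (1 / p ^ (K - 1)) p (Suc i) = - x * qpoch (1 / p ^ K) p (Suc (Suc i))"
    proof (cases K)
      case 0
      then show ?thesis by (simp add: x_def qpoch_Suc_shift)
    next
      case (Suc K')
      then have "p * (1 / p ^ K) = 1 / p ^ (K - 1)" using p(1) by simp
      then show ?thesis
        using nz(1) by (simp only: qpoch_Suc_shift[of "1 / p ^ K"]) (simp add: x_def field_simps)
    qed
    ultimately show ?thesis by simp
  qed
  have d: "qpoch p p (Suc i) = d * (1 - p * y)"
    by (simp add: qpoch_Suc d_def y_def mult.commute)
  let ?D = "(d * (1 - p * y))\<^sup>2"
  have c: "p_poly_coeff p (Suc K) (Suc i) = (1 - 1 / (p * x)) * e / ?D * (p * y)"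
    "p_poly_coeff p K (Suc i) = e * (1 - y / x) / ?D * (p * y)" "p_poly_coeff p K i = e / d\<^sup>2 * y"
    unfolding p_poly_coeff_def q0 q1 d by (simp_all add: y_def e_def d_def)
  have "(1 - p * x) * ((1 - 1 / (p * x)) * e / ?D * (p * y) - e * (1 - y / x) / ?D * (p * y))
     + (p * ((- x * (e * (1 - y / x) * (1 - p * y / x))) / ?D * (p * y)) - p * (1 - x) * (e * (1 - y / x) / ?D * (p * y)))
   = (1 - p * y) * (1 - p * (p * y)) / (p * y) * (e * (1 - y / x) / ?D * (p * y)) - e / d\<^sup>2 * y / y"
    using nz p(1) by (simp add: divide_simps power2_eq_square) algebra
  moreover have "p * (1 - x) * (p_poly_coeff p (K - 1) (Suc i) - p_poly_coeff p K (Suc i))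
     = p * ((- x * (e * (1 - y / x) * (1 - p * y / x))) / ?D * (p * y)) - p * (1 - x) * (e * (1 - y / x) / ?D * (p * y))"
    unfolding c(2) q2[symmetric] unfolding p_poly_coeff_def d
    by (simp add: y_def algebra_simps)
  ultimately show ?thesis
    unfolding power_Suc x_def[symmetric] y_def[symmetric] c by (simp only:)
qed

text \<open>The j-th Newton factor, solved for (1 - p)^2 x.\<close>

lemma p_poly_basis_mult:
  assumes "p \<noteq> 0"
  shows "[:0, (1 - p)\<^sup>2:] * p_poly_basis p j
    = smult ((1 - p ^ j) * (1 - p ^ Suc j) / p ^ j) (p_poly_basis p j) - smult (1 / p ^ j) (p_poly_basis p (Suc j))"
proof -
  have "[:0, (1 - p)\<^sup>2:] = [: (1 - p ^ j) * (1 - p ^ Suc j) / p ^ j :]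
      - smult (1 / p ^ j) [: (1 - p ^ j) * (1 - p ^ Suc j), - (p ^ j * (1 - p)\<^sup>2) :]"
    using assms by simp
  moreover have "([:c:] - smult d L) * B = smult c B - smult d (B * L)" for c d and L B :: "complex poly"
    by (simp add: left_diff_distrib mult.commute[of B])
  ultimately show ?thesis
    unfolding p_poly_basis_def prod.lessThan_Suc by (simp only:)
qed

lemma smult_sum_right: "smult c (\<Sum>i\<in>A. f i) = (\<Sum>i\<in>A. smult c (f i))"
  by (induction A rule: infinite_finite_induct) (simp_all add: smult_add_right)

text \<open>Multiplication by (1 - p)^2 x is bidiagonal in the Newton basis, so each coefficient is
  an instance of \<open>p_poly_coeff_recurrence\<close>. At K = 0 the truncated \<open>K - 1\<close>
  has the factor 0.\<close>

lemma p_poly_recurrence: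
  assumes q: "0 < q" "q < 1"
  defines "p \<equiv> complex_of_real (q\<^sup>2)"
  shows "smult (1 - p ^ Suc K) (p_poly q (Suc K) - p_poly q K) + smult (p * (1 - p ^ K)) (p_poly q (K - 1) - p_poly q K)
    = [:0, (1 - p)\<^sup>2:] * p_poly q K"
proof -
  have p: "p \<noteq> 0" using q by (simp add: p_def)
  have p1: "p ^ Suc n \<noteq> 1" for n
    unfolding p_def by (rule of_real_power_neq_1[OF q])
  let ?c = "p_poly_coeff p" and ?B = "p_poly_basis p"
  have ex: "p_poly q J = (\<Sum>j\<le>Suc K. smult (?c J j) (?B j))" if "J \<le> Suc K" for J
    using p_poly_expand[of q J "Suc K"] q that by (simp add: p_def)
  define r where "r j = (1 - p ^ Suc K) * (?c (Suc K) j - ?c K j) + p * (1 - p ^ K) * (?c (K - 1) j - ?c K j)" for j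
  have lincomb: "smult a ((\<Sum>j\<in>A. smult (f j) (B j)) - (\<Sum>j\<in>A. smult (g j) (B j)))
       + smult b ((\<Sum>j\<in>A. smult (h j) (B j)) - (\<Sum>j\<in>A. smult (g j) (B j)))
     = (\<Sum>j\<in>A. smult (a * (f j - g j) + b * (h j - g j)) (B j))" for a b :: complex and A :: "nat set" and B f g h
    by (simp add: smult_sum_right sum.distrib sum_subtractf smult_diff_right smult_diff_left smult_add_left right_diff_distrib)
  \<comment> \<open>All p_K have the coefficient 1 at j = 0, so it cancels in the
    differences.\<close>
  have r0: "r 0 = 0" by (simp add: r_def p_poly_coeff_def qpoch_def)
  have "smult (1 - p ^ Suc K) (p_poly q (Suc K) - p_poly q K) + smult (p * (1 - p ^ K)) (p_poly q (K - 1) - p_poly q K)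
    = (\<Sum>j\<le>Suc K. smult (r j) (?B j))"
    unfolding ex[OF order.refl] ex[OF le_SucI[OF order.refl]] ex[OF le_SucI[OF diff_le_self]] r_def lincomb ..
  also have "\<dots> = (\<Sum>j\<le>Suc K. smult ((1 - p ^ j) * (1 - p ^ Suc j) / p ^ j * ?c K j) (?B j))
      - (\<Sum>j\<le>K. smult (?c K j / p ^ j) (?B (Suc j)))"
    unfolding sum.atMost_Suc_shift r0
    unfolding r_def p_poly_coeff_recurrence[OF p p1] smult_diff_left sum_subtractf
    by simp
  \<comment> \<open>The added top term is 0 by \<open>p_poly_coeff_eq_0\<close>.\<close>
  also have "(\<Sum>j\<le>K. smult (?c K j / p ^ j) (?B (Suc j))) = (\<Sum>j\<le>Suc K. smult (?c K j / p ^ j) (?B (Suc j)))"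
    using p by (simp add: p_poly_coeff_eq_0)
  also have "(\<Sum>j\<le>Suc K. smult ((1 - p ^ j) * (1 - p ^ Suc j) / p ^ j * ?c K j) (?B j)) - \<dots>
      = (\<Sum>j\<le>Suc K. smult (?c K j) ([:0, (1 - p)\<^sup>2:] * ?B j))"
    unfolding p_poly_basis_mult[OF p] sum_subtractf[symmetric]
    by (intro sum.cong refl) (simp add: smult_diff_right mult_ac)
  also have "\<dots> = [:0, (1 - p)\<^sup>2:] * p_poly q K"
    unfolding ex[OF le_SucI[OF order.refl]] sum_distrib_left mult_smult_right ..
  finally show ?thesis .
qed

lemma p_poly_0: "p_poly q 0 = 1"
  by (simp add: p_poly_def Let_def qpoch_def)

section \<open>Polynomials evaluated at an operator\<close>

lemma poly_operator_bound:
  assumes "degree p \<le> n"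
  shows "poly_operator p T v = (\<Sum>i\<le>n. coeff p i *\<^sub>C (T ^^ i) v)"
  unfolding poly_operator_def
  using assms by (intro sum.mono_neutral_left) (auto simp: coeff_eq_0 cvec.scale_zero_left)

lemma poly_operator_add: "poly_operator (p + r) T v = poly_operator p T v + poly_operator r T v"
  by (simp add: poly_operator_bound[of _ "max (degree p) (degree r)"] degree_add_le
      cvec.scale_left_distrib sum.distrib)

lemma poly_operator_smult: "poly_operator (smult c p) T v = c *\<^sub>C poly_operator p T v"
  by (simp add: poly_operator_bound[of "smult c p" "degree p"] poly_operator_bound[of p "degree p"]
      degree_smult_le cvec.scale_sum_right)

lemma poly_operator_diff: "poly_operator (p - r) T v = poly_operator p T v - poly_operator r T v"
  using poly_operator_add[of "p - r" r T v] by simp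

lemma poly_operator_X: "poly_operator (pCons 0 p) T v = poly_operator p T (T v)"
proof -
  have "poly_operator (pCons 0 p) T v = (\<Sum>i\<le>Suc (degree p). coeff (pCons 0 p) i *\<^sub>C (T ^^ i) v)"
    by (intro poly_operator_bound degree_pCons_le)
  also have "\<dots> = poly_operator p T (T v)"
    unfolding sum.atMost_Suc_shift poly_operator_def by (simp add: funpow_swap1)
  finally show ?thesis .
qed

lemma poly_operator_1: "poly_operator 1 T v = v"
  by (simp add: poly_operator_def)

lemma linear_poly_operator:
  assumes "Vector_Spaces.linear cscale cscale T"
  shows "Vector_Spaces.linear cscale cscale (poly_operator p T)"
  using linear_funpow[OF assms, unfolded Vector_Spaces.linear_iff]
  unfolding poly_operator_def Vector_Spaces.linear_iff
  by (auto simp: cvec.scale_right_distrib sum.distrib cvec.scale_sum_right mult.commute)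

lemma poly_operator_p_poly_recurrence:
  assumes q: "0 < q" "q < 1"
  defines "p \<equiv> complex_of_real (q\<^sup>2)"
  shows "(1 - p ^ Suc K) *\<^sub>C (poly_operator (p_poly q (Suc K)) T v - poly_operator (p_poly q K) T v)
     + (p * (1 - p ^ K)) *\<^sub>C (poly_operator (p_poly q (K - 1)) T v - poly_operator (p_poly q K) T v)
   = ((1 - p)\<^sup>2) *\<^sub>C poly_operator (p_poly q K) T (T v)"
  using arg_cong[OF p_poly_recurrence[OF q, of K], of "\<lambda>p. poly_operator p T v"]
  by (simp add: p_def poly_operator_add poly_operator_smult poly_operator_diff poly_operator_X)

lemma clinear_simps:
  assumes "Vector_Spaces.linear cscale s f"
  shows "f 0 = 0" "f (c *\<^sub>C x) = s c (f x)" "f (x + y) = f x + f y" "f (x - y) = f x - f y"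
proof -
  interpret f: Vector_Spaces.linear cscale s f by fact
  show "f 0 = 0" "f (c *\<^sub>C x) = s c (f x)" "f (x + y) = f x + f y" "f (x - y) = f x - f y"
    by (simp_all add: f.zero f.scale f.add f.diff)
qed

lemma vector_space_complex: "vector_space ((*) :: complex \<Rightarrow> complex \<Rightarrow> complex)"
  by unfold_locales (simp_all add: algebra_simps)

section \<open>Partial derivatives and the box operator on monomials\<close>

lemma pol_power_generators: "pol_power q pol_z n = pmono n 0" "pol_power q pol_zs n = pmono 0 n"
proof -
  show "pol_power q pol_z n = pmono n 0"
    by (induction n) (simp_all add: pol_power_def pol_one_def pol_mult_z mult_z_mono)
  show "pol_power q pol_zs n = pmono 0 n"
    by (induction n) (simp_all add: pol_power_def pol_one_def pol_mult_zs mult_zs_mono)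
qed

text \<open>d replaces one of the k factors z* by dz*; moving it right past the remaining k - 1 - i
  factors costs q^(-2 (k-1-i)). The sum is a q-number and is empty at k = 0.\<close>

lemma pdr_zs_mono:
  "pdr_zs q (pmono a k) = (\<Sum>i<k. 1 / of_real (q\<^sup>2) ^ i) *\<^sub>C pmono a (k - 1)"
proof -
  have "pdr_zs q (pmono a k) = (\<Sum>i<k. of_real (1 / q ^ (2 * (k - 1 - i))) *\<^sub>C pmono a (i + (k - 1 - i)))"
    unfolding pdr_zs_eq form_d_mono
    by (simp add: lact_def ract_def form_dz_def form_dzs_def snd_sum pol_one form_twist_mono
        pol_mult_linear_simps mono_mult_zs del: of_real_divide)
  also have "\<dots> = (\<Sum>i<k. (1 / of_real (q\<^sup>2) ^ (k - Suc i)) *\<^sub>C pmono a (k - 1))"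
    by (intro sum.cong) (simp_all add: power_mult[symmetric])
  also have "\<dots> = (\<Sum>i<k. 1 / of_real (q\<^sup>2) ^ (k - Suc i)) *\<^sub>C pmono a (k - 1)"
    by (simp add: cvec.scale_sum_left)
  finally show ?thesis by (simp only: sum.nat_diff_reindex[of "\<lambda>i. 1 / of_real (q\<^sup>2) ^ i"])
qed

text \<open>Now dz moves left past i factors z, each at the cost q^(-2). The proof takes the left
  coefficient first and then undoes the twist, so the powers of q coming from z*^m cancel.\<close>

lemma pdl_z_mono:
  assumes "q \<noteq> 0"
  shows "pdl_z q (pmono l m) = (\<Sum>i<l. 1 / of_real (q\<^sup>2) ^ i) *\<^sub>C pmono (l - 1) m"
proof -
  interpret t: Vector_Spaces.linear cscale cscale "form_twist (inverse q)" by (rule linear_form_twist)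
  have "fst (form_d q (pmono l m))
      = (\<Sum>i<l. of_real (q ^ (2 * (l - 1 - i)) / q ^ (2 * m)) *\<^sub>C pmono (i + (l - 1 - i)) m)"
    unfolding form_d_mono
    by (simp add: lact_def ract_def form_dz_def form_dzs_def fst_sum pol_one form_twist_mono
        pol_mult_linear_simps mono_mult_z del: of_real_divide)
  also have "\<dots> = (\<Sum>i<l. of_real (q ^ (2 * (l - 1 - i)) / q ^ (2 * m)) *\<^sub>C pmono (l - 1) m)"
    by (intro sum.cong) simp_all
  finally have "pdl_z q (pmono l m) = (\<Sum>i<l. of_real (q ^ (2 * (l - 1 - i)) / q ^ (2 * m)) *\<^sub>C
       (of_real (inverse q ^ (2 * (l - 1)) / inverse q ^ (2 * m)) *\<^sub>C pmono (l - 1) m))"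
    unfolding pdl_z_eq[OF assms] by (simp add: t.sum t.scale form_twist_mono del: of_real_divide)
  also have "\<dots> = (\<Sum>i<l. (1 / of_real (q\<^sup>2) ^ i) *\<^sub>C pmono (l - 1) m)"
  proof (intro sum.cong refl)
    fix i assume "i \<in> {..<l}"
    then have "2 * (l - 1) = 2 * (l - 1 - i) + 2 * i" by auto
    then have "q ^ (2 * (l - 1 - i)) / q ^ (2 * m) * (inverse q ^ (2 * (l - 1)) / inverse q ^ (2 * m)) = 1 / (q\<^sup>2) ^ i"
      using assms by (simp only: power_add) (simp add: power_mult[symmetric] field_simps)
    then have "of_real (q ^ (2 * (l - 1 - i)) / q ^ (2 * m)) * of_real (inverse q ^ (2 * (l - 1)) / inverse q ^ (2 * m))
      = (1 / of_real (q\<^sup>2) ^ i :: complex)"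
      by (simp only: of_real_mult[symmetric]) simp
    then show "of_real (q ^ (2 * (l - 1 - i)) / q ^ (2 * m)) *\<^sub>C
       (of_real (inverse q ^ (2 * (l - 1)) / inverse q ^ (2 * m)) *\<^sub>C pmono (l - 1) m)
      = (1 / of_real (q\<^sup>2) ^ i) *\<^sub>C pmono (l - 1) m"
      by (simp only: cvec.scale_scale)
  qed
  finally show ?thesis by (simp add: cvec.scale_sum_left)
qed

text \<open>The exponents k and l that the box operator changes come last; a and m stay
  fixed.\<close>

definition mono2 :: "nat \<Rightarrow> nat \<Rightarrow> nat \<Rightarrow> nat \<Rightarrow> pol2" where
  "mono2 a m k l = pmono a k \<otimes>\<^sub>p pmono l m"

lemma geometric_sum_inverse:
  fixes p :: "'a::field"
  assumes "p \<noteq> 0"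
  shows "(1 - p) * (\<Sum>i<k. 1 / p ^ i) = - p * (1 - 1 / p ^ k)"
proof (induction k)
  case (Suc k)
  show ?case
    unfolding sum.lessThan_Suc distrib_left Suc using assms by (simp add: field_simps)
qed simp

text \<open>Differentiation lowers k and l by one, and the kernel terms z*^n tensor z^n with n = 0,
  1, 2 raise both by n. No reordering occurs, since z* is multiplied from the right and z from the
  left.\<close>

lemma box_mono2:
  assumes "q \<noteq> 0"
  defines "p \<equiv> complex_of_real (q\<^sup>2)"
  shows "(1 - p)\<^sup>2 *\<^sub>C box q (mono2 a m k l) = (p * (1 - 1 / p ^ k) * (1 - 1 / p ^ l)) *\<^sub>C
     (mono2 a m (k - 1) (l - 1) - (1 + 1 / p) *\<^sub>C mono2 a m k l + (1 / p) *\<^sub>C mono2 a m (Suc k) (Suc l))"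
proof (cases "k = 0 \<or> l = 0")
  case True
  have "box q (mono2 a m k l) = 0"
    using True unfolding mono2_def box_tensor[OF assms(1)] pdr_zs_mono pdl_z_mono[OF assms(1)]
    by (auto simp: clinear_simps[OF linear_tensor_left] clinear_simps[OF linear_tensor_right]
        clinear_simps[OF linear_pol2_mult_left] clinear_simps[OF linear_pol2_mult_right])
  with True show ?thesis by auto
next
  case False
  then obtain k' l' where kl: "k = Suc k'" "l = Suc l'" by (metis not0_implies_Suc)
  have p: "p \<noteq> 0" using assms by simp
  define b c where "b = (\<Sum>i<k. 1 / p ^ i)" and "c = (\<Sum>i<l. 1 / p ^ i)"
  note tl = clinear_simps(2)[OF linear_tensor_left] clinear_simps(2)[OF linear_tensor_right]
  note pl = clinear_simps(2-)[OF linear_pol2_mult_left] clinear_simps(2-)[OF linear_pol2_mult_right]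
  define i r where "i = 1 / p" and "r = 1 + 1 / p"
  have ir: "complex_of_real (inverse (q\<^sup>2)) = i" "complex_of_real (1 + inverse (q\<^sup>2)) = r"
    by (simp_all add: i_def r_def p_def divide_inverse)
  have m: "pol_mult q (pmono a (k - 1)) (pmono 0 2) = pmono a (Suc k)"
    "pol_mult q (pmono a (k - 1)) pol_zs = pmono a k"
    "pol_mult q (pmono 2 0) (pmono (l - 1) m) = pmono (Suc l) m"
    "pol_mult q pol_z (pmono (l - 1) m) = pmono l m"
    by (simp_all add: kl pol_mult_z pol_zs_def mult_z_mono mono_mult_zs mono_mult_z)
  have "box q (mono2 a m k l) = b *\<^sub>C c *\<^sub>C i *\<^sub>C
     (mono2 a m (k - 1) (l - 1) - r *\<^sub>C mono2 a m k l + i *\<^sub>C mono2 a m (Suc k) (Suc l))"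
    unfolding mono2_def box_tensor[OF assms(1)] pdr_zs_mono pdl_z_mono[OF assms(1)] box_kernel_def ir
      p_def[symmetric] b_def[symmetric] c_def[symmetric]
      pol_power_generators tl pl pol2_mult_tensor pol_one m
    by (simp only: cvec.scale_right_distrib cvec.scale_right_diff_distrib cvec.scale_scale mult_ac)
  moreover
  \<comment> \<open>Each factor 1 - p turns one q-number into \<open>1 - 1 / p ^ k\<close> or
    \<open>1 - 1 / p ^ l\<close>, up to the factor -p.\<close>
  have "(1 - p)\<^sup>2 * (b * (c * i)) = ((1 - p) * b) * ((1 - p) * c) / p"
    by (simp add: power2_eq_square i_def)
  then have "(1 - p)\<^sup>2 * (b * (c * i)) = p * (1 - 1 / p ^ k) * (1 - 1 / p ^ l)"
    unfolding b_def c_def geometric_sum_inverse[OF p] using p by simp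
  ultimately show ?thesis
    unfolding r_def[symmetric] unfolding i_def[symmetric] by (simp only: cvec.scale_scale)
qed

text \<open>The matrix entry from \<open>e\<^sub>N\<close> to \<open>e\<^sub>N\<^sub>+\<^sub>d\<close> of \<open>\<Sum> a\<^sub>j\<^sub>k z\<^sup>j z*\<^sup>k\<close>; only the terms with \<open>j - k = d\<close> contribute.\<close>

definition symbol_entry :: "complex \<Rightarrow> complex \<Rightarrow> (nat \<times> nat \<Rightarrow> complex) \<Rightarrow> int \<Rightarrow> nat \<Rightarrow> complex" where
  "symbol_entry p t a d N =
     (\<Sum>k\<le>N. (if 0 \<le> int k + d then a (nat (int k + d), k) else 0) * zs_power_coeff p t N k)"

lemma linear_symbol_entry: "Vector_Spaces.linear cscale (*) (\<lambda>f. symbol_entry p t (lookup f) d N)"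
  unfolding Vector_Spaces.linear_iff symbol_entry_def
  by (intro conjI allI cvec.vector_space_axioms vector_space_complex)
    (auto simp: lookup_add sum.distrib[symmetric] sum_distrib_left algebra_simps intro!: sum.cong)

lemma symbol_entry_mono:
  "symbol_entry p t (lookup (pmono j k)) d N = (if int j = int k + d then zs_power_coeff p t N k else 0)"
proof -
  have "symbol_entry p t (lookup (pmono j k)) d N
     = (\<Sum>i\<le>N. if i = k then (if int j = int k + d then zs_power_coeff p t N k else 0) else 0)"
    unfolding symbol_entry_def pmono_def
    by (intro sum.cong) (auto simp: lookup_single when_def)
  then show ?thesis by (auto simp: zs_power_coeff_eq_0)
qed

lemma symbol_entry_mult_z:
  "symbol_entry p t (lookup (mult_z f)) d N = symbol_entry p t (lookup f) (d - 1) N"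
  by (rule pol_eqI[OF linear_compose_c[OF linear_mult_z linear_symbol_entry] linear_symbol_entry])
    (auto simp: mult_z_mono symbol_entry_mono)

text \<open>At t = 0 the rule z* e_n = (1 - p^n) e_(n-1) respects the relation of the algebra,
  because p (1 - p^n) + 1 - p = 1 - p^(n+1). Here n = N + d + 1; a negative n is truncated to 0,
  where the factor is 0.\<close>

lemma symbol_entry_mult_zs:
  assumes "p = of_real (q\<^sup>2)"
  shows "symbol_entry p 0 (lookup (mult_zs q f)) d N
    = (1 - p ^ nat (int N + d + 1)) * symbol_entry p 0 (lookup f) (d + 1) N"
proof (rule pol_eqI[OF linear_compose_c[OF linear_mult_zs linear_symbol_entry]])
  interpret E: Vector_Spaces.linear cscale "(*)" "\<lambda>f. symbol_entry p 0 (lookup f) d N" for d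
    by (rule linear_symbol_entry)
  show "Vector_Spaces.linear cscale (*) (\<lambda>f. (1 - p ^ nat (int N + d + 1)) * symbol_entry p 0 (lookup f) (d + 1) N)"
    unfolding Vector_Spaces.linear_iff E.add E.scale
    using linear_symbol_entry[of p 0 d N] by (simp add: Vector_Spaces.linear_iff algebra_simps)
  fix l m
  have pw: "complex_of_real (q ^ (2 * l)) = p ^ l" by (simp add: assms power_mult)
  show "symbol_entry p 0 (lookup (mult_zs q (pmono l m))) d N
    = (1 - p ^ nat (int N + d + 1)) * symbol_entry p 0 (lookup (pmono l m)) (d + 1) N"
  proof (cases "int l = int m + (d + 1) \<and> m \<le> N")
    case True
    then have "nat (int N + d + 1) = l + (N - m)" and e2: "int l = int (Suc m) + d" by auto
    then have e: "p ^ nat (int N + d + 1) = p ^ l * p ^ (N - m)" by (simp only: power_add)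
    have "l = 0 \<or> int (l - 1) = int m + d" using True by auto
    then show ?thesis
      unfolding mult_zs_mono of_real_diff pw E.add E.scale symbol_entry_mono e
      using True e2 by (auto simp: zs_power_coeff_Suc zs_coeff_def power_add algebra_simps)
  next
    case False
    then have "m \<le> N \<longrightarrow> l \<noteq> 0 \<longrightarrow> int (l - 1) \<noteq> int m + d" by auto
    then show ?thesis
      unfolding mult_zs_mono of_real_diff pw E.add E.scale symbol_entry_mono
      using False by (cases "l = 0") (auto simp: zs_power_coeff_eq_0)
  qed
qed

text \<open>Left multiplication by z* and z is applied one factor at a time. This supplies the
  initial value for the induction over the polynomials p_k.\<close>

lemma symbol_entry_pol_mult_mono:
  assumes "p = of_real (q\<^sup>2)"
  shows "symbol_entry p 0 (lookup (pol_mult q (pmono a k) (pmono l m))) d N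
    = (if int l + int a = int m + int k + d then product_entry p 0 m k l N else 0)"
proof -
  have "symbol_entry p 0 (lookup ((mult_zs q ^^ k) (pmono l m))) d N
      = (if int l = int m + int k + d then product_entry p 0 m k l N else 0)" for d
  proof (induction k arbitrary: d)
    case 0
    show ?case by (simp add: symbol_entry_mono product_entry_def)
  next
    case (Suc k)
    have "p ^ nat (int N + d + 1) = p ^ (N - m + l - k)" if "m \<le> N" "int l = int m + int k + (d + 1)"
    proof -
      from that have "nat (int N + d + 1) = N - m + l - k" by auto
      then show ?thesis by (simp only:)
    qed
    then show ?case
      by (cases "m \<le> N") (auto simp: symbol_entry_mult_zs[OF assms] Suc product_entry_def zs_power_coeff_Suc zs_coeff_def
          zs_power_coeff_eq_0 not_le)
  qed
  moreover have "symbol_entry p 0 (lookup ((mult_z ^^ a) f)) d N = symbol_entry p 0 (lookup f) (d - int a) N" for f d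
    by (induction a arbitrary: d) (simp_all add: symbol_entry_mult_z algebra_simps)
  ultimately show ?thesis by (simp add: pol_mult_mono algebra_simps)
qed

section \<open>Power series in \<open>t\<close>\<close>

lemma has_fps_expansion_unique_complex:
  fixes f g :: "complex \<Rightarrow> complex"
  assumes "f has_fps_expansion F" "g has_fps_expansion G" "\<forall>\<^sub>F z in nhds 0. f z = g z"
  shows "F = G"
proof (rule fps_ext)
  fix n
  have "(deriv ^^ n) f 0 = (deriv ^^ n) g 0" by (rule higher_deriv_cong_ev[OF assms(3) refl])
  then show "fps_nth F n = fps_nth G n"
    by (simp add: fps_nth_fps_expansion[OF assms(1)] fps_nth_fps_expansion[OF assms(2)])
qed

text \<open>The radius of convergence is divided by |c| and stays positive.\<close>

lemma has_fps_expansion_dilate: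
  fixes f :: "complex \<Rightarrow> complex"
  assumes f: "f has_fps_expansion F" and c: "c \<noteq> 0"
  shows "(\<lambda>z. f (z * c)) has_fps_expansion Abs_fps (\<lambda>n. c ^ n * fps_nth F n)"
  unfolding has_fps_expansion_def
proof
  have "fps_conv_radius (Abs_fps (\<lambda>n. c ^ n * fps_nth F n)) = fps_conv_radius F / ereal (norm c)"
    by (simp add: fps_conv_radius_def conv_radius_mult_power[OF c])
  also have "\<dots> > 0"
    using f c unfolding has_fps_expansion_def by (cases "fps_conv_radius F") (auto simp: zero_less_divide_iff)
  finally show "0 < fps_conv_radius (Abs_fps (\<lambda>n. c ^ n * fps_nth F n))" .
  have "((\<lambda>z. z * c) \<longlongrightarrow> 0 * c) (nhds 0)" by (intro tendsto_intros filterlim_ident)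
  then have "filterlim (\<lambda>z. z * c) (nhds 0) (nhds 0)" by simp
  moreover have "\<forall>\<^sub>F w in nhds 0. eval_fps F w = f w" using f by (simp add: has_fps_expansion_def)
  ultimately have "\<forall>\<^sub>F z in nhds 0. eval_fps F (z * c) = f (z * c)"
    by (rule eventually_compose_filterlim[rotated])
  then show "\<forall>\<^sub>F z in nhds 0. eval_fps (Abs_fps (\<lambda>n. c ^ n * fps_nth F n)) z = f (z * c)"
    by (simp add: eval_fps_def power_mult_distrib mult_ac)
qed

section \<open>Asymptotic expansions of scalar functions\<close>

definition power_series_asymptotics :: "(real \<Rightarrow> complex) \<Rightarrow> (nat \<Rightarrow> complex) \<Rightarrow> bool" where
  "power_series_asymptotics F c \<longleftrightarrow> (\<forall>N.
     ((\<lambda>t. inverse (of_real t ^ N) * (F t - (\<Sum>k\<le>N. c k * of_real t ^ k))) \<longlongrightarrow> 0) (at_right 0))"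

text \<open>The product topology makes convergence of formal series coefficientwise.\<close>

lemma asymptotic_expansion_iff:
  "asymptotic_expansion F c \<longleftrightarrow> (\<forall>i. power_series_asymptotics (\<lambda>t. F t i) (\<lambda>k. c k i))"
proof -
  have "(g \<longlongrightarrow> h) A \<longleftrightarrow> (\<forall>i. ((\<lambda>t. g t i) \<longlongrightarrow> h i) A)"
    for g :: "real \<Rightarrow> nat \<times> nat \<Rightarrow> complex" and h A
    using limitin_componentwise[of "\<lambda>_. euclidean" UNIV g h A]
    by (simp add: euclidean_product_topology)
  then show ?thesis
    unfolding asymptotic_expansion_def power_series_asymptotics_def by (simp only:) blast
qed

lemma power_series_asymptotics_fps:
  assumes f: "f has_fps_expansion F" and ev: "\<forall>\<^sub>F t in at_right 0. g t = f (of_real t)"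
  shows "power_series_asymptotics g (fps_nth F)"
  unfolding power_series_asymptotics_def
proof
  fix N
  \<comment> \<open>The remainder after t^N is t^(N+1) times the analytic function R; dividing by
    t^N leaves t R(t), which tends to 0.\<close>
  define R where "R = fps_shift (Suc N) F"
  have R: "eval_fps R has_fps_expansion R"
    using f by (intro eval_fps_has_fps_expansion) (simp add: R_def has_fps_expansion_def)
  have F: "F = (\<Sum>k\<le>N. fps_const (fps_nth F k) * fps_X ^ k) + R * fps_X ^ Suc N"
  proof (rule fps_ext)
    fix n
    have "fps_nth (\<Sum>k\<le>N. fps_const (fps_nth F k) * fps_X ^ k) n
        = (\<Sum>k\<le>N. if k = n then fps_nth F n else 0)"
      unfolding fps_sum_nth by (intro sum.cong) auto
    then show "fps_nth F n = fps_nth ((\<Sum>k\<le>N. fps_const (fps_nth F k) * fps_X ^ k) + R * fps_X ^ Suc N) n"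
      by (auto simp: fps_X_power_mult_right_nth R_def simp del: power_Suc)
  qed
  have "(\<lambda>z. (\<Sum>k\<le>N. fps_nth F k * z ^ k) + eval_fps R z * z ^ Suc N) has_fps_expansion F"
    by (subst F) (intro fps_expansion_intros R)
  with f have "\<forall>\<^sub>F z in nhds 0. f z = (\<Sum>k\<le>N. fps_nth F k * z ^ k) + eval_fps R z * z ^ Suc N"
    unfolding has_fps_expansion_def by (auto elim: eventually_elim2)
  moreover have lim0: "((\<lambda>t. complex_of_real t) \<longlongrightarrow> 0) (at_right 0)"
    using tendsto_of_real[OF tendsto_ident_at, of 0 "{0<..}", where 'a = complex] by simp
  ultimately have "\<forall>\<^sub>F t in at_right 0. f (of_real t)
      = (\<Sum>k\<le>N. fps_nth F k * of_real t ^ k) + eval_fps R (of_real t) * of_real t ^ Suc N"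
    by (rule eventually_compose_filterlim)
  with ev have "\<forall>\<^sub>F t in at_right 0. eval_fps R (of_real t) * of_real t
      = inverse (of_real t ^ N) * (g t - (\<Sum>k\<le>N. fps_nth F k * of_real t ^ k))"
    using eventually_at_right_less[of 0]
    by eventually_elim (simp add: field_simps)
  moreover have "((\<lambda>t. eval_fps R (of_real t) * of_real t) \<longlongrightarrow> eval_fps R 0 * 0) (at_right 0)"
  proof (intro tendsto_mult lim0)
    have "isCont (eval_fps R) 0"
      using has_fps_expansion_imp_continuous[OF R, of UNIV] by simp
    then show "((\<lambda>t. eval_fps R (complex_of_real t)) \<longlongrightarrow> eval_fps R 0) (at_right 0)"
      by (rule isCont_tendsto_compose[OF _ lim0])
  qed
  ultimately show "((\<lambda>t. inverse (of_real t ^ N) * (g t - (\<Sum>k\<le>N. fps_nth F k * of_real t ^ k))) \<longlongrightarrow> 0) (at_right 0)"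
    unfolding mult_zero_right by (rule Lim_transform_eventually[rotated])
qed

lemma power_series_asymptotics_cmult:
  assumes "power_series_asymptotics F c"
  shows "power_series_asymptotics (\<lambda>t. a * F t) (\<lambda>k. a * c k)"
  unfolding power_series_asymptotics_def
proof
  fix N
  have "((\<lambda>t. a * (inverse (of_real t ^ N) * (F t - (\<Sum>k\<le>N. c k * of_real t ^ k)))) \<longlongrightarrow> a * 0) (at_right 0)"
    using assms unfolding power_series_asymptotics_def by (intro tendsto_intros) blast
  then show "((\<lambda>t. inverse (of_real t ^ N) * (a * F t - (\<Sum>k\<le>N. a * c k * of_real t ^ k))) \<longlongrightarrow> 0) (at_right 0)"
    by (simp add: algebra_simps sum_distrib_left)
qed

lemma power_series_asymptotics_diff:
  assumes "power_series_asymptotics F c" "power_series_asymptotics G d"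
  shows "power_series_asymptotics (\<lambda>t. F t - G t) (\<lambda>k. c k - d k)"
  unfolding power_series_asymptotics_def
proof
  fix N
  have "((\<lambda>t. inverse (of_real t ^ N) * (F t - (\<Sum>k\<le>N. c k * of_real t ^ k))
      - inverse (of_real t ^ N) * (G t - (\<Sum>k\<le>N. d k * of_real t ^ k))) \<longlongrightarrow> 0 - 0) (at_right 0)"
    using assms unfolding power_series_asymptotics_def by (intro tendsto_diff) blast+
  then show "((\<lambda>t. inverse (of_real t ^ N) * (F t - G t - (\<Sum>k\<le>N. (c k - d k) * of_real t ^ k))) \<longlongrightarrow> 0) (at_right 0)"
    by (simp add: algebra_simps sum_subtractf)
qed

lemma power_series_asymptotics_0: "power_series_asymptotics (\<lambda>_. 0) (\<lambda>_. 0)"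
  by (simp add: power_series_asymptotics_def)

lemma power_series_asymptotics_sum:
  assumes "\<And>i. i \<in> A \<Longrightarrow> power_series_asymptotics (F i) (c i)"
  shows "power_series_asymptotics (\<lambda>t. \<Sum>i\<in>A. F i t) (\<lambda>k. \<Sum>i\<in>A. c i k)"
  using assms
proof (induction A rule: infinite_finite_induct)
  case (insert i A)
  from insert.prems have "power_series_asymptotics (F i) (c i)" by simp
  from power_series_asymptotics_diff[OF this power_series_asymptotics_cmult[OF insert.IH, of "- 1"]] insert
  show ?case by simp
qed (simp_all add: power_series_asymptotics_0)

section \<open>Taylor coefficients of the averaged entries\<close>

lemma fps_expansion_zs_power_coeff:
  "\<exists>F. (\<lambda>t. zs_power_coeff p t N k :: complex) has_fps_expansion F"
proof -
  define F where "F n = fps_const (1 - p ^ n) * inverse (1 - fps_X * fps_const (p ^ n))" for n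
  have "(\<lambda>t. zs_coeff p t n) has_fps_expansion F n" for n
    unfolding zs_coeff_def divide_inverse F_def by (intro fps_expansion_intros) simp
  then have "(\<lambda>t. zs_power_coeff p t N k) has_fps_expansion (\<Prod>i<k. F (N - i))"
    unfolding zs_power_coeff_def by (intro fps_expansion_intros)
  then show ?thesis by blast
qed

text \<open>The sequence f depends on t as well, since each recursion step replaces it by a
  combination with t-dependent coefficients.\<close>

lemma fps_expansion_qmean:
  assumes "\<And>N. \<exists>F. (\<lambda>t. f t N :: complex) has_fps_expansion F"
  shows "\<exists>F. (\<lambda>t. qmean p (t * p) M (f t)) has_fps_expansion F"
  using assms
proof (induction M arbitrary: f)
  case (Suc M)
  from Suc.prems obtain F where F: "\<And>N. (\<lambda>t. f t N) has_fps_expansion F N" by metis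
  have "(\<lambda>t. p ^ N * (t * p) * f t N + (1 - t * p * p ^ N) * f t (Suc N)) has_fps_expansion
     fps_const (p ^ N) * (fps_X * fps_const p) * F N + (1 - fps_X * fps_const p * fps_const (p ^ N)) * F (Suc N)" for N
    by (intro fps_expansion_intros F)
  then show ?case
    unfolding qmean.simps
    by (intro Suc.IH[of "\<lambda>t N. p ^ N * (t * p) * f t N + (1 - t * p * p ^ N) * f t (Suc N)"]) blast
qed simp

lemma fps_expansion_symbol_gf: "\<exists>F. (\<lambda>t :: complex. symbol_gf p M m t k l) has_fps_expansion F"
proof -
  have "\<exists>F. (\<lambda>t. product_entry p t m k l N) has_fps_expansion F" for N
    unfolding product_entry_def
    using fps_expansion_zs_power_coeff[of p N m] fps_expansion_zs_power_coeff[of p "N - m + l" k]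
      has_fps_expansion_mult by blast
  from fps_expansion_qmean[of "\<lambda>t. product_entry p t m k l", OF this]
  obtain F where F: "(\<lambda>t. qmean p (t * p) M (product_entry p t m k l)) has_fps_expansion F" by blast
  have "(\<lambda>t. symbol_gf p M m t k l) has_fps_expansion F * inverse (1 - fps_X)"
    unfolding symbol_gf_def divide_inverse by (intro fps_expansion_intros F) simp
  then show ?thesis by blast
qed

text \<open>The coefficient of t^(K+1) in \<open>symbol_gf_dilate\<close>; dilation multiplies the
  n-th coefficient by p^n. The terms are grouped as in \<open>p_poly_recurrence\<close>, and at K =
  0 the truncated index again has the factor 0.\<close>

lemma symbol_gf_fps_recurrence:
  assumes q: "0 < q" "q < 1"
  defines "p \<equiv> complex_of_real (q\<^sup>2)"
  assumes G: "\<And>k l. (\<lambda>t. symbol_gf p M m t k l) has_fps_expansion G k l"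
  shows "(1 - p ^ Suc K) * (fps_nth (G k l) (Suc K) - fps_nth (G k l) K)
     + p * (1 - p ^ K) * (fps_nth (G k l) (K - 1) - fps_nth (G k l) K)
   = p * (1 - 1 / p ^ k) * (1 - 1 / p ^ l) * (fps_nth (G (k - 1) (l - 1)) K
       - (1 + 1 / p) * fps_nth (G k l) K + 1 / p * fps_nth (G (Suc k) (Suc l)) K)"
proof -
  have p: "p \<noteq> 0" using q by (simp add: p_def)
  have p1: "p ^ Suc n \<noteq> 1" for n
    unfolding p_def by (rule of_real_power_neq_1[OF q])
  define g where "g t k l = symbol_gf p M m t k l" for t k l
  define c where "c = p * (1 - 1 / p ^ k) * (1 - 1 / p ^ l)"
  define D where "D = Abs_fps (\<lambda>n. p ^ n * fps_nth (G k l) n)"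
  have g: "(\<lambda>t. g t k l) has_fps_expansion G k l" for k l
    unfolding g_def by (rule G)
  have D: "(\<lambda>t. g (t * p) k l) has_fps_expansion D"
    unfolding D_def by (rule has_fps_expansion_dilate[OF g p])
  \<comment> \<open>The prefactors are multiplied out into powers of t so that coefficients can be
    read off.\<close>
  have L: "(\<lambda>t. g t k l - t * ((1 + p) * g t k l) + t * (t * (p * g t k l))
       - (g (t * p) k l - t * (2 * p * g (t * p) k l) + t * (t * (p\<^sup>2 * g (t * p) k l))))
    has_fps_expansion G k l - fps_X * (fps_const (1 + p) * G k l) + fps_X * (fps_X * (fps_const p * G k l))
       - (D - fps_X * (fps_const (2 * p) * D) + fps_X * (fps_X * (fps_const (p\<^sup>2) * D)))" (is "?l has_fps_expansion ?L")
    by (intro fps_expansion_intros g D)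
  have R: "(\<lambda>t. t * (c * (g t (k - 1) (l - 1) - (1 + 1 / p) * g t k l + 1 / p * g t (Suc k) (Suc l))))
    has_fps_expansion fps_X * (fps_const c * (G (k - 1) (l - 1) - fps_const (1 + 1 / p) * G k l
       + fps_const (1 / p) * G (Suc k) (Suc l)))" (is "?r has_fps_expansion ?R")
    by (intro fps_expansion_intros g)
  have "?L = ?R"
  \<comment> \<open>The dilation equation holds on the unit disc, which is a neighbourhood of
    0.\<close>
  proof (rule has_fps_expansion_unique_complex[OF L R])
    have "\<forall>\<^sub>F t :: complex in nhds 0. t \<in> ball 0 1"
      by (intro eventually_nhds_in_open) auto
    then show "\<forall>\<^sub>F t in nhds 0. ?l t = ?r t"
    proof eventually_elim
      case (elim t)
      then have "t * p ^ n \<noteq> 1" for n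
        using of_real_mult_power_neq_1[OF q, of t n] by (simp add: p_def)
      from symbol_gf_dilate[OF p p1 this, of M m k l, folded g_def c_def]
      show ?case by (simp add: algebra_simps power2_eq_square)
    qed
  qed
  then have "fps_nth ?L (Suc K) = fps_nth ?R (Suc K)" by (rule arg_cong)
  then show ?thesis
    unfolding c_def[symmetric] by (cases K) (simp_all add: D_def algebra_simps power2_eq_square)
qed

text \<open>Both sides solve one recurrence in K: the left by the recurrence of p_K at the box
  operator together with \<open>box_mono2\<close>, the right by the dilation equation. They agree at
  K = 0, and the leading coefficient 1 - p^(K+1) is nonzero. Neighbouring k and l enter, so the
  induction covers all of them at once.\<close>

lemma poly_operator_entry:
  assumes q: "0 < q" "q < 1"
  defines "p \<equiv> complex_of_real (q\<^sup>2)"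
  assumes G: "\<And>k l. (\<lambda>t. symbol_gf p M m t k l) has_fps_expansion G k l"
  shows "symbol_entry p 0 (lookup (m0 q (poly_operator (p_poly q K) (box q) (mono2 a m k l)))) d M
    = (if int l + int a = int m + int k + d then fps_nth (G k l) K else 0)"
proof -
  have p: "p \<noteq> 0" using q by (simp add: p_def)
  have p1: "p ^ Suc n \<noteq> 1" for n
    unfolding p_def by (rule of_real_power_neq_1[OF q])
  define E where "E T = symbol_entry p 0 (lookup (m0 q T)) d M" for T
  have E: "Vector_Spaces.linear cscale (*) E"
    unfolding E_def by (rule linear_compose_c[OF linear_m0 linear_symbol_entry])
  note E_simps = clinear_simps[OF E]
  define U where "U K k l = E (poly_operator (p_poly q K) (box q) (mono2 a m k l))" for K k l
  define V where "V K k l = (if int l + int a = int m + int k + d then fps_nth (G k l) K else 0)" for K k l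
  define c where "c k l = p * (1 - 1 / p ^ k) * (1 - 1 / p ^ l)" for k l
  have U: "(1 - p ^ Suc K) * (U (Suc K) k l - U K k l) + p * (1 - p ^ K) * (U (K - 1) k l - U K k l)
    = c k l * (U K (k - 1) (l - 1) - (1 + 1 / p) * U K k l + 1 / p * U K (Suc k) (Suc l))" for K k l
  proof -
    interpret P: Vector_Spaces.linear cscale cscale "poly_operator (p_poly q K) (box q)"
      by (rule linear_poly_operator[OF linear_box])
    show ?thesis
      using arg_cong[OF poly_operator_p_poly_recurrence[OF q, of K "box q" "mono2 a m k l", folded p_def], of E]
      unfolding P.scale[symmetric] box_mono2[OF less_imp_neq[OF q(1), symmetric], folded p_def]
      by (simp add: P.scale P.add P.diff E_simps U_def c_def)
  qed
  have V: "(1 - p ^ Suc K) * (V (Suc K) k l - V K k l) + p * (1 - p ^ K) * (V (K - 1) k l - V K k l)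
    = c k l * (V K (k - 1) (l - 1) - (1 + 1 / p) * V K k l + 1 / p * V K (Suc k) (Suc l))" for K k l
  proof (cases "k = 0 \<or> l = 0")
    case True
    then show ?thesis
      using symbol_gf_fps_recurrence[OF q G[unfolded p_def], folded p_def, of K k l]
      by (auto simp: V_def c_def)
  next
    case False
    \<comment> \<open>The indices k and l move together, so the entry stays on the diagonal
      d.\<close>
    then have "int (l - 1) + int a = int m + int (k - 1) + d \<longleftrightarrow> int l + int a = int m + int k + d" by auto
    then show ?thesis
      using symbol_gf_fps_recurrence[OF q G[unfolded p_def], folded p_def, of K k l]
      by (auto simp: V_def c_def)
  qed
  have "U K k l = V K k l" for K k l
  proof (induction K arbitrary: k l rule: less_induct)
    case (less K)
    show ?case
    proof (cases K)
      case 0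
      have "\<forall>\<^sub>F z in nhds 0. eval_fps (G k l) z = symbol_gf p M m z k l"
        using G[of k l] by (simp add: has_fps_expansion_def)
      \<comment> \<open>The constant Taylor coefficient is the value at t = 0, where the mean is
        concentrated at N = M.\<close>
      from eventually_nhds_x_imp_x[OF this]
      have "fps_nth (G k l) 0 = product_entry p 0 m k l M"
        by (simp add: eval_fps_at_0 symbol_gf_def qmean_at_0)
      then show ?thesis
        unfolding 0 U_def V_def E_def p_poly_0 poly_operator_1 mono2_def m0_tensor
        by (simp add: symbol_entry_pol_mult_mono[OF p_def[THEN meta_eq_to_obj_eq]])
    next
      case (Suc J)
      have IH: "U J k l = V J k l" "U (J - 1) k l = V (J - 1) k l" for k l
        using less.IH[of J] less.IH[of "J - 1"] Suc by auto
      have "(1 - p ^ Suc J) * (U (Suc J) k l - V J k l) = (1 - p ^ Suc J) * (V (Suc J) k l - V J k l)"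
        using U[of J k l, unfolded IH, folded V] by (rule add_right_imp_eq)
      then show ?thesis using p1[of J] Suc by simp
    qed
  qed
  then show ?thesis by (simp add: U_def V_def E_def)
qed

text \<open>The entry from e_N to e_(N+d) of the product of the quantizations of f and g (see
  \<open>quantize_product_unit_vec\<close>), extended to complex t.\<close>

definition product_matrix :: "complex \<Rightarrow> complex \<Rightarrow> pol \<Rightarrow> pol \<Rightarrow> int \<Rightarrow> nat \<Rightarrow> complex" where
  "product_matrix p t f g d N = (\<Sum>(a, k)\<in>keys f. \<Sum>(l, m)\<in>keys g. lookup f (a, k) * lookup g (l, m)
     * (if int l + int a = int m + int k + d then product_entry p t m k l N else 0))"

lemma linear_functional_expand:
  assumes "Vector_Spaces.linear cscale (*) F"
  shows "F f = (\<Sum>b\<in>keys f. lookup f b * F (single b 1))"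
proof -
  have "F f = lin (*) (\<lambda>b. F (single b 1)) f"
    by (rule linear_eqI[OF assms linear_lin[OF vector_space_complex]]) (simp add: vector_space_complex)
  then show ?thesis by (simp add: lin_def)
qed

lemma star_product_nth:
  "fps_nth (star_product q f g) K
     = m0 q (poly_operator (if K = 0 then p_poly q 0 else p_poly q K - p_poly q (K - 1)) (box q) (f \<otimes>\<^sub>p g))"
  by (simp add: star_product_def C_coeff_def p_poly_0 poly_operator_1 m0_tensor)

text \<open>On monomials the mean is (1 - t) times \<open>symbol_gf\<close>, and multiplying the
  series of the p_K by 1 - t yields the differences p_K - p_(K-1). Bilinearity gives the general
  case.\<close>

lemma star_product_entry_expansion:
  assumes q: "0 < q" "q < 1"
  defines "p \<equiv> complex_of_real (q\<^sup>2)"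
  shows "(\<lambda>t. qmean p (t * p) M (product_matrix p t f g d))
    has_fps_expansion Abs_fps (\<lambda>K. symbol_entry p 0 (lookup (fps_nth (star_product q f g) K)) d M)"
proof -
  define E where "E K f g = symbol_entry p 0 (lookup (fps_nth (star_product q f g) K)) d M" for K f g
  have lin: "Vector_Spaces.linear cscale (*) (\<lambda>f. E K f g)" "Vector_Spaces.linear cscale (*) (\<lambda>g. E K f g)" for K f g
    unfolding E_def star_product_nth
    by (intro linear_compose_c[OF linear_tensor_left] linear_compose_c[OF linear_tensor_right]
        linear_compose_c[OF linear_poly_operator[OF linear_box]] linear_compose_c[OF linear_m0] linear_symbol_entry)+
  have "\<exists>G. \<forall>k l. (\<lambda>t. symbol_gf p M m t k l) has_fps_expansion G k l" for m
    using fps_expansion_symbol_gf[of p M m] by metis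
  then obtain G where G: "\<And>m k l. (\<lambda>t. symbol_gf p M m t k l) has_fps_expansion G m k l" by metis
  define S where "S t a k l m = (if int l + int a = int m + int k + d then qmean p (t * p) M (product_entry p t m k l) else 0)"
    for t a k l m
  have mono: "(\<lambda>t. S t a k l m) has_fps_expansion Abs_fps (\<lambda>K. E K (single (a, k) 1) (single (l, m) 1))" for a k l m
  proof -
    have "(\<lambda>t. (1 - t) * (if int l + int a = int m + int k + d then symbol_gf p M m t k l else 0))
        has_fps_expansion (1 - fps_X) * (if int l + int a = int m + int k + d then G m k l else 0)"
      by (intro fps_expansion_intros)
        (cases "int l + int a = int m + int k + d", simp_all only: if_True if_False simp_thms G has_fps_expansion_0)
    moreover have "(1 - fps_X) * (if int l + int a = int m + int k + d then G m k l else 0)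
        = Abs_fps (\<lambda>K. E K (single (a, k) 1) (single (l, m) 1))"
    proof (rule fps_ext)
      fix K
      note e = poly_operator_entry[OF q G[of m, unfolded p_def], folded p_def, of _ a k l d, unfolded mono2_def pmono_def tensor_single]
      show "fps_nth ((1 - fps_X) * (if int l + int a = int m + int k + d then G m k l else 0)) K
          = fps_nth (Abs_fps (\<lambda>K. E K (single (a, k) 1) (single (l, m) 1))) K"
        unfolding E_def star_product_nth
        by (cases K) (auto simp: left_diff_distrib poly_operator_diff clinear_simps[OF linear_m0]
            clinear_simps(4)[OF linear_symbol_entry] e)
    qed
    ultimately have "(\<lambda>t. (1 - t) * (if int l + int a = int m + int k + d then symbol_gf p M m t k l else 0))
        has_fps_expansion Abs_fps (\<lambda>K. E K (single (a, k) 1) (single (l, m) 1))" by simp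
    moreover have "\<forall>\<^sub>F t :: complex in nhds 0. t \<in> ball 0 1"
      by (intro eventually_nhds_in_open) auto
    then have "\<forall>\<^sub>F t in nhds 0. (1 - t) * (if int l + int a = int m + int k + d then symbol_gf p M m t k l else 0) = S t a k l m"
      by eventually_elim (auto simp: S_def symbol_gf_def)
    ultimately show ?thesis
      unfolding has_fps_expansion_def by (auto elim: eventually_elim2)
  qed
  have "(\<lambda>t. \<Sum>(a, k)\<in>keys f. \<Sum>(l, m)\<in>keys g. lookup f (a, k) * lookup g (l, m) * S t a k l m)
      has_fps_expansion (\<Sum>(a, k)\<in>keys f. \<Sum>(l, m)\<in>keys g. fps_const (lookup f (a, k) * lookup g (l, m))
         * Abs_fps (\<lambda>K. E K (single (a, k) 1) (single (l, m) 1)))"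
    unfolding case_prod_beta by (intro fps_expansion_intros mono)
  also have "(\<lambda>t. \<Sum>(a, k)\<in>keys f. \<Sum>(l, m)\<in>keys g. lookup f (a, k) * lookup g (l, m) * S t a k l m)
      = (\<lambda>t. qmean p (t * p) M (product_matrix p t f g d))"
    unfolding product_matrix_def[abs_def] case_prod_beta qmean_sum qmean_scale S_def
    by (intro ext sum.cong refl) (auto simp: qmean_scale[of _ _ _ 0, simplified])
  also have "(\<Sum>(a, k)\<in>keys f. \<Sum>(l, m)\<in>keys g. fps_const (lookup f (a, k) * lookup g (l, m))
         * Abs_fps (\<lambda>K. E K (single (a, k) 1) (single (l, m) 1))) = Abs_fps (\<lambda>K. E K f g)"
  proof (rule fps_ext)
    fix K
    have "E K f g = (\<Sum>b\<in>keys f. \<Sum>e\<in>keys g. lookup f b * lookup g e * E K (single b 1) (single e 1))"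
      by (subst linear_functional_expand[OF lin(1)], subst linear_functional_expand[OF lin(2)])
        (simp add: sum_distrib_left mult.assoc)
    then show "fps_nth (\<Sum>(a, k)\<in>keys f. \<Sum>(l, m)\<in>keys g. fps_const (lookup f (a, k) * lookup g (l, m))
         * Abs_fps (\<lambda>K. E K (single (a, k) 1) (single (l, m) 1))) K = fps_nth (Abs_fps (\<lambda>K. E K f g)) K"
      by (simp add: case_prod_beta fps_sum_nth)
  qed
  finally show ?thesis unfolding E_def .
qed

text \<open>The coefficients of a symbol do not depend on N, so the mean only meets
  \<open>zs_power_coeff\<close>, in which \<open>qmean_zs_power_coeff\<close> replaces t by
  0.\<close>

lemma qmean_symbol_entry:
  assumes "\<And>n. t * p ^ n \<noteq> 1"
  shows "qmean p (t * p) M (symbol_entry p t a d) = symbol_entry p 0 a d M"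
proof -
  define c where "c k = (if 0 \<le> int k + d then a (nat (int k + d), k) else 0)" for k
  have "qmean p (t * p) M (symbol_entry p t a d)
      = qmean p (t * p) M (\<lambda>N. \<Sum>k\<le>M. c k * zs_power_coeff p t N k)"
    unfolding symbol_entry_def c_def
    \<comment> \<open>Terms with k > N vanish, so the range k \<le> M serves all N \<le> M.\<close>
    by (intro qmean_cong sum.mono_neutral_left) (auto simp: zs_power_coeff_eq_0)
  also have "\<dots> = (\<Sum>k\<le>M. c k * zs_power_coeff p 0 M k)"
    by (simp add: qmean_sum qmean_scale qmean_zs_power_coeff[OF assms])
  finally show ?thesis by (simp add: symbol_entry_def c_def)
qed

section \<open>The triangular system between a symbol and its matrix entries\<close>

lemma zs_power_coeff_nonzero:
  assumes "\<And>n. p ^ Suc n \<noteq> 1" "\<And>n. t * p ^ n \<noteq> 1" "k \<le> N"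
  shows "zs_power_coeff p t N k \<noteq> 0"
proof -
  have "zs_coeff p t (N - i) \<noteq> 0" if "i < k" for i
  proof -
    have "N - i = Suc (N - Suc i)" using that assms(3) by simp
    then show ?thesis using assms(1)[of "N - Suc i"] assms(2)[of "N - i"] by (auto simp: zs_coeff_def)
  qed
  then show ?thesis by (auto simp: zs_power_coeff_def)
qed

lemma symbol_entry_split:
  "symbol_entry p t a d N = (\<Sum>k<N. (if 0 \<le> int k + d then a (nat (int k + d), k) else 0) * zs_power_coeff p t N k)
     + (if 0 \<le> int N + d then a (nat (int N + d), N) else 0) * zs_power_coeff p t N N"
  unfolding symbol_entry_def by (simp add: lessThan_Suc_atMost[symmetric])

text \<open>Forward substitution along each diagonal j - k = d, with nonzero pivots
  \<open>zs_power_coeff p t k k\<close>. The vector e_(N+d) exists only for N + d \<ge> 0.\<close>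

lemma symbol_entry_unique:
  assumes nz: "\<And>n. p ^ Suc n \<noteq> 1" "\<And>n. t * p ^ n \<noteq> 1"
    and eq: "\<And>d N. 0 \<le> int N + d \<Longrightarrow> symbol_entry p t a d N = symbol_entry p t b d N"
  shows "a = b"
proof -
  have "0 \<le> int k + d \<Longrightarrow> a (nat (int k + d), k) = b (nat (int k + d), k)" for k d
  proof (induction k rule: less_induct)
    case (less k)
    have "(\<Sum>i<k. (if 0 \<le> int i + d then a (nat (int i + d), i) else 0) * zs_power_coeff p t k i)
       = (\<Sum>i<k. (if 0 \<le> int i + d then b (nat (int i + d), i) else 0) * zs_power_coeff p t k i)"
      using less.IH by (intro sum.cong) auto
    then show ?case
      using eq[OF less.prems] less.prems zs_power_coeff_nonzero[OF nz, of k k]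
      by (simp add: symbol_entry_split)
  qed
  from this[of k "int j - int k" for j k] show ?thesis by auto
qed

text \<open>The same substitution as a construction, for each d by well-founded recursion. An entry
  with N + d < 0 has no target vector and must be 0.\<close>

lemma symbol_entry_exists:
  assumes nz: "\<And>n. p ^ Suc n \<noteq> 1" "\<And>n. t * p ^ n \<noteq> 1"
    and y: "\<And>d N. int N + d < 0 \<Longrightarrow> y d N = 0"
  shows "\<exists>a. \<forall>d N. symbol_entry p t a d N = y d N"
proof -
  have "\<exists>c. \<forall>N. (\<Sum>k\<le>N. c k * zs_power_coeff p t N k) = v N" for v :: "nat \<Rightarrow> complex"
  proof -
    have "\<exists>c. \<forall>N. c N = (v N - (\<Sum>k<N. c k * zs_power_coeff p t N k)) / zs_power_coeff p t N N"
    proof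
      let ?R = "\<lambda>f N. (v N - (\<Sum>k<N. f k * zs_power_coeff p t N k)) / zs_power_coeff p t N N"
      define c where "c = wfrec less_than ?R"
      show "\<forall>N. c N = ?R c N"
      proof
        fix N
        have "c N = ?R (cut c less_than N) N"
          unfolding c_def by (rule wfrec) simp
        \<comment> \<open>\<open>cut\<close> changes nothing, since the sum uses c only below
          N.\<close>
        also have "\<dots> = ?R c N" by (simp add: cut_apply)
        finally show "c N = ?R c N" .
      qed
    qed
    then obtain c where cN: "\<And>N. c N = (v N - (\<Sum>k<N. c k * zs_power_coeff p t N k)) / zs_power_coeff p t N N" by blast
    have "(\<Sum>k\<le>N. c k * zs_power_coeff p t N k) = v N" for N
      using cN[of N] zs_power_coeff_nonzero[OF nz, of N N] by (simp add: lessThan_Suc_atMost[symmetric])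
    then show ?thesis by blast
  qed
  then have "\<forall>d. \<exists>c. \<forall>N. (\<Sum>k\<le>N. c k * zs_power_coeff p t N k) = y d N" by blast
  from choice[OF this] obtain c where c: "\<And>d N. (\<Sum>k\<le>N. c d k * zs_power_coeff p t N k) = y d N" by blast
  \<comment> \<open>The index j = k + d of a symbol cannot be negative; as the solution vanishes at
    such k, nothing is lost when it is read as a symbol.\<close>
  have c0: "c d k = 0" if "int k + d < 0" for d k
    using that
  proof (induction k rule: less_induct)
    case (less k)
    have "(\<Sum>i<k. c d i * zs_power_coeff p t k i) = 0"
      using less by (intro sum.neutral) auto
    then show ?case
      using c[where d = d and N = k] y[OF less.prems] zs_power_coeff_nonzero[OF nz, of k k]
      by (simp add: lessThan_Suc_atMost[symmetric])
  qed
  have "symbol_entry p t (\<lambda>(j, k). c (int j - int k) k) d N = y d N" for d N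
    unfolding symbol_entry_def c[symmetric] by (intro sum.cong) (auto simp: c0)
  then show ?thesis by blast
qed

text \<open>If N + d < 0, then z*^m or the later z*^k lowers the vector below e_0.\<close>

lemma product_matrix_eq_0:
  assumes "int N + d < 0"
  shows "product_matrix p t f g d N = 0"
proof -
  have "product_entry p t m k l N = 0" if "int l + int a = int m + int k + d" for a k l m
    using that assms by (cases "m \<le> N") (auto simp: product_entry_def zs_power_coeff_eq_0)
  then show ?thesis unfolding product_matrix_def by (intro sum.neutral) (auto intro!: sum.neutral)
qed

section \<open>Operators and covariant symbols\<close>

definition sq_norm :: "real \<Rightarrow> real \<Rightarrow> (nat \<Rightarrow> complex) \<Rightarrow> real" where
  "sq_norm q \<alpha> \<psi> = (suminf (\<lambda>k. weight q \<alpha> k * (cmod (\<psi> k))\<^sup>2))"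

definition unit_vec :: "nat \<Rightarrow> nat \<Rightarrow> complex" where
  "unit_vec N = (\<lambda>i. of_bool (i = N))"

text \<open>The explicit adjoint of \<open>z_op\<close>, identified in
  \<open>adjoint_z_op\<close>.\<close>

definition zs_op :: "real \<Rightarrow> real \<Rightarrow> (nat \<Rightarrow> complex) \<Rightarrow> (nat \<Rightarrow> complex)" where
  "zs_op q \<alpha> \<psi> = (if \<psi> \<in> L2a q \<alpha>
     then (\<lambda>n. of_real (zs_coeff (q\<^sup>2) (q powr (4 * \<alpha>)) (Suc n)) * \<psi> (Suc n)) else (\<lambda>_. 0))"

lemma unit_vec_Cz: "unit_vec N \<in> Cz"
  by (simp add: unit_vec_def Cz_def)

text \<open>Eventual membership passes from generating sets to finite intersections and unions. The
  first assumption places l in the space, which \<open>limitin\<close> demands.\<close>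

lemma limitin_topology_generated_by:
  assumes l: "l \<in> \<Union>B" and ev: "\<And>U. U \<in> B \<Longrightarrow> l \<in> U \<Longrightarrow> \<forall>\<^sub>F x in F. f x \<in> U"
  shows "limitin (topology_generated_by B) f l F"
proof -
  have "l \<in> U \<longrightarrow> (\<forall>\<^sub>F x in F. f x \<in> U)" if "generate_topology_on B U" for U
    using that
  proof induction
    case (Int a b)
    then show ?case by (auto intro: eventually_conj)
  next
    case (UN K)
    show ?case
    proof
      assume "l \<in> \<Union>K"
      then obtain k where "k \<in> K" "l \<in> k" by blast
      with UN have "\<forall>\<^sub>F x in F. f x \<in> k" by blast
      then show "\<forall>\<^sub>F x in F. f x \<in> \<Union>K" by eventually_elim (use \<open>k \<in> K\<close> in blast)
    qed
  qed (auto intro: ev)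
  then show ?thesis
    using l by (auto simp: limitin_def openin_topology_generated_by_iff)
qed

context
  fixes q \<alpha> :: real
  assumes q: "0 < q" "q < 1" and \<alpha>: "0 < \<alpha>"
begin

private abbreviation (input) "w \<equiv> weight q \<alpha>"
private abbreviation (input) "H \<equiv> L2a q \<alpha>"
private abbreviation (input) "c \<equiv> zs_coeff (q\<^sup>2) (q powr (4 * \<alpha>))"

section \<open>Weights and norm estimates\<close>

lemma q_powr_range: "0 < q powr (4 * \<alpha>)" "q powr (4 * \<alpha>) < 1"
  using q \<alpha> by (auto simp: powr_def mult_pos_neg)

lemma weight_gt_0: "w k > 0"
  by (rule weight_pos[OF q \<alpha>])

text \<open>From t p^n \<le> p^n \<le> 1 and t < 1. The bound 1 makes the shift and its adjoint
  contractions.\<close>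

lemma zs_coeff_range: "0 \<le> c n" "c n \<le> 1"
proof -
  define x t where "x = (q\<^sup>2) ^ n" and "t = q powr (4 * \<alpha>)"
  have x: "0 \<le> x" "x \<le> 1" using q by (auto simp: x_def power_le_one)
  have t: "0 < t" "t < 1" using q_powr_range by (auto simp: t_def)
  have "t * x \<le> t" by (rule mult_left_le) (use t x in auto)
  then have "0 < 1 - t * x" using t by linarith
  moreover have "t * x \<le> x" by (rule mult_left_le_one_le) (use t x in auto)
  ultimately show "0 \<le> c n" "c n \<le> 1" using x
    by (auto simp: zs_coeff_def x_def[symmetric] t_def[symmetric] divide_le_eq)
qed

text \<open>The base q^(4 \<alpha> + 2) is t p, so the new factors are 1 - p^(n+1) and 1 - t
  p^(n+1).\<close>

lemma weight_Suc: "w (Suc n) = w n * c (Suc n)"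
proof -
  have "q powr (4 * \<alpha> + 2) = q\<^sup>2 * q powr (4 * \<alpha>)"
    using q by (simp add: powr_add)
  then show ?thesis
    by (simp add: weight_def qpoch_Suc zs_coeff_def mult_ac)
qed

lemma L2a_iff: "\<psi> \<in> H \<longleftrightarrow> summable (\<lambda>k. w k * (cmod (\<psi> k))\<^sup>2)"
  by (simp add: L2a_def)

lemma sq_norm_nonneg: "\<psi> \<in> H \<Longrightarrow> 0 \<le> sq_norm q \<alpha> \<psi>"
  unfolding sq_norm_def L2a_iff by (intro suminf_nonneg) (simp_all add: weight_gt_0 less_imp_le)

lemma L2a_norm_eq_sqrt: "\<psi> \<in> H \<Longrightarrow> L2a_norm q \<alpha> \<psi> = sqrt (sq_norm q \<alpha> \<psi>)"
  by (simp add: L2a_norm_eq sq_norm_def)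

lemma L2a_zero: "(\<lambda>_. 0) \<in> H"
  by (simp add: L2a_iff)

lemma L2a_scale: "\<psi> \<in> H \<Longrightarrow> (\<lambda>k. a * \<psi> k) \<in> H"
  and sq_norm_scale: "\<psi> \<in> H \<Longrightarrow> sq_norm q \<alpha> (\<lambda>k. a * \<psi> k) = (cmod a)\<^sup>2 * sq_norm q \<alpha> \<psi>"
proof -
  have e: "w k * (cmod (a * \<psi> k))\<^sup>2 = (cmod a)\<^sup>2 * (w k * (cmod (\<psi> k))\<^sup>2)" for k
    by (simp add: norm_mult power_mult_distrib)
  show "\<psi> \<in> H \<Longrightarrow> (\<lambda>k. a * \<psi> k) \<in> H" unfolding L2a_iff e by (rule summable_mult)
  show "\<psi> \<in> H \<Longrightarrow> sq_norm q \<alpha> (\<lambda>k. a * \<psi> k) = (cmod a)\<^sup>2 * sq_norm q \<alpha> \<psi>"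
    unfolding L2a_iff sq_norm_def e by (rule suminf_mult)
qed

lemma L2a_dominated:
  assumes "summable g" "\<And>k. w k * (cmod (\<psi> k))\<^sup>2 \<le> g k"
  shows "\<psi> \<in> H" "sq_norm q \<alpha> \<psi> \<le> suminf g"
proof -
  show "\<psi> \<in> H"
    unfolding L2a_iff by (rule summable_comparison_test'[OF assms(1)]) (simp add: assms(2) weight_gt_0 less_imp_le)
  then show "sq_norm q \<alpha> \<psi> \<le> suminf g"
    unfolding L2a_iff sq_norm_def by (intro suminf_le assms)
qed

text \<open>From |a + b|^2 \<le> 2 |a|^2 + 2 |b|^2; the constant is irrelevant for
  boundedness.\<close>

lemma L2a_add:
  assumes "\<psi> \<in> H" "\<phi> \<in> H"
  shows "(\<lambda>k. \<psi> k + \<phi> k) \<in> H"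
    and "sq_norm q \<alpha> (\<lambda>k. \<psi> k + \<phi> k) \<le> 2 * sq_norm q \<alpha> \<psi> + 2 * sq_norm q \<alpha> \<phi>"
proof -
  let ?g = "\<lambda>k. 2 * (w k * (cmod (\<psi> k))\<^sup>2) + 2 * (w k * (cmod (\<phi> k))\<^sup>2)"
  have "(cmod (a + b))\<^sup>2 \<le> 2 * (cmod a)\<^sup>2 + 2 * (cmod b)\<^sup>2" for a b
  proof -
    have "(cmod (a + b))\<^sup>2 \<le> (cmod a + cmod b)\<^sup>2"
      by (intro power_mono norm_triangle_ineq) auto
    also have "\<dots> \<le> 2 * (cmod a)\<^sup>2 + 2 * (cmod b)\<^sup>2"
      using zero_le_power2[of "cmod a - cmod b"] by (simp add: power2_eq_square algebra_simps)
    finally show ?thesis .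
  qed
  then have "w k * (cmod (\<psi> k + \<phi> k))\<^sup>2 \<le> w k * (2 * (cmod (\<psi> k))\<^sup>2 + 2 * (cmod (\<phi> k))\<^sup>2)" for k
    by (intro mult_left_mono) (simp_all add: weight_gt_0 less_imp_le)
  then have le: "w k * (cmod (\<psi> k + \<phi> k))\<^sup>2 \<le> ?g k" for k
    by (simp add: algebra_simps)
  have s: "summable ?g" using assms unfolding L2a_iff by (intro summable_add summable_mult)
  have "suminf ?g = 2 * sq_norm q \<alpha> \<psi> + 2 * sq_norm q \<alpha> \<phi>"
    using assms unfolding L2a_iff sq_norm_def
    by (simp add: suminf_add[symmetric] suminf_mult summable_mult)
  with L2a_dominated[OF s le] show "(\<lambda>k. \<psi> k + \<phi> k) \<in> H"
    "sq_norm q \<alpha> (\<lambda>k. \<psi> k + \<phi> k) \<le> 2 * sq_norm q \<alpha> \<psi> + 2 * sq_norm q \<alpha> \<phi>" by simp_all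
qed

section \<open>Bounded operators and their combinations\<close>

lemma bounded_opsI:
  assumes "\<And>\<psi>. \<psi> \<in> H \<Longrightarrow> A \<psi> \<in> H"
    and "\<And>\<psi> \<phi>. \<psi> \<in> H \<Longrightarrow> \<phi> \<in> H \<Longrightarrow> A (\<lambda>k. \<psi> k + \<phi> k) = (\<lambda>k. A \<psi> k + A \<phi> k)"
    and "\<And>a \<psi>. \<psi> \<in> H \<Longrightarrow> A (\<lambda>k. a * \<psi> k) = (\<lambda>k. a * A \<psi> k)"
    and bound: "\<And>\<psi>. \<psi> \<in> H \<Longrightarrow> sq_norm q \<alpha> (A \<psi>) \<le> M * sq_norm q \<alpha> \<psi>"
    and "\<And>\<psi>. \<psi> \<notin> H \<Longrightarrow> A \<psi> = (\<lambda>_. 0)"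
  shows "A \<in> bounded_ops q \<alpha>"
proof -
  have "L2a_norm q \<alpha> (A \<psi>) \<le> sqrt M * L2a_norm q \<alpha> \<psi>" if "\<psi> \<in> H" for \<psi>
    using bound[OF that] assms(1)[OF that] that
    by (simp add: L2a_norm_eq_sqrt real_sqrt_mult[symmetric])
  then show ?thesis
    unfolding bounded_ops_def using assms by blast
qed

lemma bounded_opsD:
  assumes "A \<in> bounded_ops q \<alpha>"
  shows "\<psi> \<in> H \<Longrightarrow> A \<psi> \<in> H"
    and "\<psi> \<in> H \<Longrightarrow> \<phi> \<in> H \<Longrightarrow> A (\<lambda>k. \<psi> k + \<phi> k) = (\<lambda>k. A \<psi> k + A \<phi> k)"
    and "\<psi> \<in> H \<Longrightarrow> A (\<lambda>k. a * \<psi> k) = (\<lambda>k. a * A \<psi> k)"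
    and "\<psi> \<notin> H \<Longrightarrow> A \<psi> = (\<lambda>_. 0)"
  using assms unfolding bounded_ops_def by blast+

lemma bounded_ops_bound:
  assumes "A \<in> bounded_ops q \<alpha>"
  obtains M where "0 \<le> M" "\<And>\<psi>. \<psi> \<in> H \<Longrightarrow> sq_norm q \<alpha> (A \<psi>) \<le> M * sq_norm q \<alpha> \<psi>"
proof -
  obtain M where M: "\<And>\<psi>. \<psi> \<in> H \<Longrightarrow> L2a_norm q \<alpha> (A \<psi>) \<le> M * L2a_norm q \<alpha> \<psi>"
    using assms unfolding bounded_ops_def by blast
  have "sq_norm q \<alpha> (A \<psi>) \<le> M\<^sup>2 * sq_norm q \<alpha> \<psi>" if "\<psi> \<in> H" for \<psi>
  proof -
    have A: "A \<psi> \<in> H" by (rule bounded_opsD(1)[OF assms that])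
    have "(sqrt (sq_norm q \<alpha> (A \<psi>)))\<^sup>2 \<le> (M * sqrt (sq_norm q \<alpha> \<psi>))\<^sup>2"
      using M[OF that] A that by (intro power_mono) (simp_all add: L2a_norm_eq_sqrt sq_norm_nonneg)
    then show ?thesis
      using A that by (simp add: power_mult_distrib sq_norm_nonneg)
  qed
  then show ?thesis using that[of "M\<^sup>2"] by simp
qed

lemma bounded_ops_compose:
  assumes A: "A \<in> bounded_ops q \<alpha>" and B: "B \<in> bounded_ops q \<alpha>"
  shows "(\<lambda>\<psi>. A (B \<psi>)) \<in> bounded_ops q \<alpha>"
proof -
  obtain M where M: "0 \<le> M" "\<And>\<psi>. \<psi> \<in> H \<Longrightarrow> sq_norm q \<alpha> (A \<psi>) \<le> M * sq_norm q \<alpha> \<psi>"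
    using bounded_ops_bound[OF A] by blast
  obtain N where N: "0 \<le> N" "\<And>\<psi>. \<psi> \<in> H \<Longrightarrow> sq_norm q \<alpha> (B \<psi>) \<le> N * sq_norm q \<alpha> \<psi>"
    using bounded_ops_bound[OF B] by blast
  note D = bounded_opsD[OF A] bounded_opsD[OF B]
  show ?thesis
  proof (rule bounded_opsI[where M = "M * N"])
    fix \<psi> assume \<psi>: "\<psi> \<in> H"
    have "sq_norm q \<alpha> (A (B \<psi>)) \<le> M * sq_norm q \<alpha> (B \<psi>)" by (intro M D \<psi>)
    also have "\<dots> \<le> M * (N * sq_norm q \<alpha> \<psi>)" by (intro mult_left_mono M N \<psi>)
    finally show "sq_norm q \<alpha> (A (B \<psi>)) \<le> M * N * sq_norm q \<alpha> \<psi>" by (simp add: mult.assoc)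
  next
    fix \<psi> assume "\<psi> \<notin> H"
    \<comment> \<open>The zero vector is written as 0 times itself, so that homogeneity of A sends
      it to 0.\<close>
    then have "B \<psi> = (\<lambda>k. 0 * (\<lambda>_. 0) k)" by (simp add: D)
    then show "A (B \<psi>) = (\<lambda>_. 0)" by (simp only: D(3)[OF L2a_zero]) simp
  qed (simp_all add: D)
qed

lemma bounded_ops_add:
  assumes A: "A \<in> bounded_ops q \<alpha>" and B: "B \<in> bounded_ops q \<alpha>"
  shows "(\<lambda>\<psi> n. A \<psi> n + B \<psi> n) \<in> bounded_ops q \<alpha>"
proof -
  obtain M where M: "0 \<le> M" "\<And>\<psi>. \<psi> \<in> H \<Longrightarrow> sq_norm q \<alpha> (A \<psi>) \<le> M * sq_norm q \<alpha> \<psi>"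
    using bounded_ops_bound[OF A] by blast
  obtain N where N: "0 \<le> N" "\<And>\<psi>. \<psi> \<in> H \<Longrightarrow> sq_norm q \<alpha> (B \<psi>) \<le> N * sq_norm q \<alpha> \<psi>"
    using bounded_ops_bound[OF B] by blast
  note D = bounded_opsD[OF A] bounded_opsD[OF B]
  show ?thesis
  proof (rule bounded_opsI[where M = "2 * M + 2 * N"])
    fix \<psi> assume \<psi>: "\<psi> \<in> H"
    have "sq_norm q \<alpha> (\<lambda>n. A \<psi> n + B \<psi> n) \<le> 2 * sq_norm q \<alpha> (A \<psi>) + 2 * sq_norm q \<alpha> (B \<psi>)"
      by (intro L2a_add D \<psi>)
    also have "\<dots> \<le> 2 * (M * sq_norm q \<alpha> \<psi>) + 2 * (N * sq_norm q \<alpha> \<psi>)"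
      by (intro add_mono mult_left_mono M N \<psi>) simp_all
    finally show "sq_norm q \<alpha> (\<lambda>n. A \<psi> n + B \<psi> n) \<le> (2 * M + 2 * N) * sq_norm q \<alpha> \<psi>"
      by (simp add: algebra_simps)
  qed (auto simp: D L2a_add algebra_simps)
qed

lemma bounded_ops_0: "(\<lambda>_ _. 0) \<in> bounded_ops q \<alpha>"
  by (rule bounded_opsI[where M = 1]) (simp_all add: L2a_zero sq_norm_nonneg, simp add: sq_norm_def sq_norm_nonneg[unfolded sq_norm_def])

lemma bounded_ops_scale:
  assumes A: "A \<in> bounded_ops q \<alpha>"
  shows "(\<lambda>\<psi> n. a * A \<psi> n) \<in> bounded_ops q \<alpha>"
proof -
  obtain M where M: "0 \<le> M" "\<And>\<psi>. \<psi> \<in> H \<Longrightarrow> sq_norm q \<alpha> (A \<psi>) \<le> M * sq_norm q \<alpha> \<psi>"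
    using bounded_ops_bound[OF A] by blast
  note D = bounded_opsD[OF A]
  show ?thesis
  proof (rule bounded_opsI[where M = "(cmod a)\<^sup>2 * M"])
    fix \<psi> assume "\<psi> \<in> H"
    then show "sq_norm q \<alpha> (\<lambda>n. a * A \<psi> n) \<le> (cmod a)\<^sup>2 * M * sq_norm q \<alpha> \<psi>"
      using mult_left_mono[OF M(2), of \<psi> "(cmod a)\<^sup>2"] by (simp add: sq_norm_scale D mult.assoc)
  qed (auto simp: D L2a_scale algebra_simps)
qed

lemma z_op_bounded: "z_op q \<alpha> \<in> bounded_ops q \<alpha>"
proof (rule bounded_opsI[where M = 1])
  fix \<psi> assume \<psi>: "\<psi> \<in> H"
  \<comment> \<open>The series for \<psi>, moved by one place, dominates because the weights
    decrease.\<close>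
  define g where "g k = (case k of 0 \<Rightarrow> 0 | Suc i \<Rightarrow> w i * (cmod (\<psi> i))\<^sup>2)" for k
  have g: "summable g" "suminf g = sq_norm q \<alpha> \<psi>"
  proof -
    have "(\<lambda>k. g (Suc k)) sums sq_norm q \<alpha> \<psi>"
      using \<psi> by (simp add: g_def L2a_iff sq_norm_def summable_sums)
    then have "g sums (sq_norm q \<alpha> \<psi> + g 0)" by (simp add: sums_Suc_iff)
    then show "summable g" "suminf g = sq_norm q \<alpha> \<psi>"
      by (auto simp: sums_iff g_def)
  qed
  have "w (Suc i) * (cmod (\<psi> i))\<^sup>2 \<le> w i * (cmod (\<psi> i))\<^sup>2" for i
    unfolding weight_Suc using zs_coeff_range[of "Suc i"] weight_gt_0[of i]
    by (intro mult_right_mono mult_right_le_one_le) auto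
  then have "w k * (cmod (z_op q \<alpha> \<psi> k))\<^sup>2 \<le> g k" for k
    using \<psi> by (auto simp: z_op_def g_def split: nat.split)
  from L2a_dominated[OF g(1) this] g(2) show "z_op q \<alpha> \<psi> \<in> H" "sq_norm q \<alpha> (z_op q \<alpha> \<psi>) \<le> 1 * sq_norm q \<alpha> \<psi>"
    by simp_all
qed (auto simp: z_op_def L2a_add L2a_scale fun_eq_iff split: nat.split)

lemma zs_op_bounded: "zs_op q \<alpha> \<in> bounded_ops q \<alpha>"
proof (rule bounded_opsI[where M = 1])
  fix \<psi> assume \<psi>: "\<psi> \<in> H"
  define f where "f = (\<lambda>k. w k * (cmod (\<psi> k))\<^sup>2)"
  have f: "summable f" "f 0 \<ge> 0" using \<psi> weight_gt_0[of 0] by (auto simp: f_def L2a_iff)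
  have "w k * (cmod (zs_op q \<alpha> \<psi> k))\<^sup>2 \<le> f (Suc k)" for k
  proof -
    \<comment> \<open>One of the two factors \<open>c (Suc k)\<close> is absorbed by
      \<open>weight_Suc\<close>.\<close>
    have "w k * (cmod (zs_op q \<alpha> \<psi> k))\<^sup>2 = f (Suc k) * c (Suc k)"
      using \<psi> zs_coeff_range(1)[of "Suc k"] by (simp add: zs_op_def f_def weight_Suc norm_mult power_mult_distrib power2_eq_square)
    also have "\<dots> \<le> f (Suc k)"
      using zs_coeff_range[of "Suc k"] weight_gt_0[of "Suc k"] by (intro mult_right_le_one_le) (auto simp: f_def)
    finally show ?thesis .
  qed
  from L2a_dominated[OF _ this] f show "zs_op q \<alpha> \<psi> \<in> H" "sq_norm q \<alpha> (zs_op q \<alpha> \<psi>) \<le> 1 * sq_norm q \<alpha> \<psi>"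
    using suminf_split_head[OF f(1)] by (simp_all add: summable_Suc_iff, simp add: sq_norm_def f_def)
qed (auto simp: zs_op_def L2a_add L2a_scale fun_eq_iff algebra_simps)

section \<open>Scalar products and the adjoint of the shift\<close>

lemma Cz_in_L2a: "\<psi> \<in> Cz \<Longrightarrow> \<psi> \<in> H"
  using Cz_dense(1)[OF q \<alpha>] by blast

lemma scalar_prod_Cz:
  assumes "finite F" "\<And>k. k \<notin> F \<Longrightarrow> \<phi> k = 0"
  shows "scalar_prod q \<alpha> \<psi> \<phi> = (\<Sum>k\<in>F. of_real (w k) * \<psi> k * cnj (\<phi> k))"
  unfolding scalar_prod_def by (rule suminf_finite) (use assms in auto)

lemma scalar_prod_unit_vec: "scalar_prod q \<alpha> \<psi> (unit_vec n) = of_real (w n) * \<psi> n"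
  by (subst scalar_prod_Cz[of "{n}"]) (auto simp: unit_vec_def)

lemma scalar_prod_unit_vec_left: "scalar_prod q \<alpha> (unit_vec n) \<psi> = of_real (w n) * cnj (\<psi> n)"
proof -
  have "scalar_prod q \<alpha> (unit_vec n) \<psi> = (\<Sum>k\<in>{n}. of_real (w k) * unit_vec n k * cnj (\<psi> k))"
    unfolding scalar_prod_def by (rule suminf_finite) (auto simp: unit_vec_def)
  then show ?thesis by (simp add: unit_vec_def)
qed

text \<open>The term at index 0 vanishes, and after an index shift \<open>weight_Suc\<close> moves
  the coefficient to the other argument. Splitting off that term needs summability, which comes from
  x y \<le> x^2 + y^2.\<close>

lemma scalar_prod_z_op:
  assumes "\<psi> \<in> H" "\<phi> \<in> H"
  shows "scalar_prod q \<alpha> (z_op q \<alpha> \<psi>) \<phi> = scalar_prod q \<alpha> \<psi> (zs_op q \<alpha> \<phi>)"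
proof -
  define f where "f k = of_real (w k) * z_op q \<alpha> \<psi> k * cnj (\<phi> k)" for k
  have z: "z_op q \<alpha> \<psi> \<in> H" by (rule bounded_opsD(1)[OF z_op_bounded assms(1)])
  have "summable f"
  proof (rule summable_comparison_test')
    show "summable (\<lambda>k. w k * (cmod (z_op q \<alpha> \<psi> k))\<^sup>2 + w k * (cmod (\<phi> k))\<^sup>2)"
      using z assms(2) unfolding L2a_iff by (rule summable_add)
    fix k :: nat
    have "cmod (z_op q \<alpha> \<psi> k) * cmod (\<phi> k) \<le> (cmod (z_op q \<alpha> \<psi> k))\<^sup>2 + (cmod (\<phi> k))\<^sup>2"
    proof -
      have "x * y \<le> x\<^sup>2 + y\<^sup>2" if "0 \<le> x * y" for x y :: real
        using that zero_le_power2[of "x - y"] unfolding power2_diff by linarith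
      then show ?thesis by simp
    qed
    then have "w k * (cmod (z_op q \<alpha> \<psi> k) * cmod (\<phi> k)) \<le> w k * ((cmod (z_op q \<alpha> \<psi> k))\<^sup>2 + (cmod (\<phi> k))\<^sup>2)"
      using weight_gt_0[of k] by (intro mult_left_mono) auto
    then show "norm (f k) \<le> w k * (cmod (z_op q \<alpha> \<psi> k))\<^sup>2 + w k * (cmod (\<phi> k))\<^sup>2"
      using weight_gt_0[of k] by (simp add: f_def norm_mult algebra_simps)
  qed
  from suminf_split_head[OF this] have "suminf f = (suminf (\<lambda>k. f (Suc k)))"
    using assms by (simp add: f_def z_op_def)
  also have "(\<lambda>k. f (Suc k)) = (\<lambda>k. of_real (w k) * \<psi> k * cnj (zs_op q \<alpha> \<phi> k))"
    using assms by (simp add: fun_eq_iff f_def z_op_def zs_op_def weight_Suc)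
  finally show ?thesis unfolding scalar_prod_def f_def .
qed

text \<open>An adjoint is determined on \<open>L2a\<close> by pairing with the vectors
  \<open>unit_vec n\<close>, and outside it by the convention of \<open>bounded_ops\<close>.\<close>

lemma adjoint_z_op: "adjoint_op q \<alpha> (z_op q \<alpha>) = zs_op q \<alpha>"
  unfolding adjoint_op_def
proof (rule the_equality)
  show "zs_op q \<alpha> \<in> bounded_ops q \<alpha> \<and>
      (\<forall>\<psi>\<in>H. \<forall>\<phi>\<in>H. scalar_prod q \<alpha> (z_op q \<alpha> \<psi>) \<phi> = scalar_prod q \<alpha> \<psi> (zs_op q \<alpha> \<phi>))"
    using zs_op_bounded scalar_prod_z_op by blast
  fix B
  assume B: "B \<in> bounded_ops q \<alpha> \<and>
      (\<forall>\<psi>\<in>H. \<forall>\<phi>\<in>H. scalar_prod q \<alpha> (z_op q \<alpha> \<psi>) \<phi> = scalar_prod q \<alpha> \<psi> (B \<phi>))"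
  show "B = zs_op q \<alpha>"
  proof (intro ext)
    fix \<phi> n
    show "B \<phi> n = zs_op q \<alpha> \<phi> n"
    proof (cases "\<phi> \<in> H")
      case True
      have u: "unit_vec n \<in> H" using Cz_in_L2a unit_vec_Cz by blast
      have "scalar_prod q \<alpha> (unit_vec n) (B \<phi>) = scalar_prod q \<alpha> (unit_vec n) (zs_op q \<alpha> \<phi>)"
        using B scalar_prod_z_op[OF u True] True u by metis
      then show ?thesis
        using weight_gt_0[of n] by (simp add: scalar_prod_unit_vec_left)
    next
      case False
      then show ?thesis using B bounded_opsD(4) by (simp add: zs_op_def)
    qed
  qed
qed

lemma z_op_power:
  assumes "\<psi> \<in> H"
  shows "(z_op q \<alpha> ^^ j) \<psi> \<in> H" "(z_op q \<alpha> ^^ j) \<psi> = (\<lambda>n. if n < j then 0 else \<psi> (n - j))"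
proof -
  have *: "(z_op q \<alpha> ^^ j) \<psi> \<in> H" for j
    using assms bounded_opsD(1)[OF z_op_bounded] by (induction j) auto
  show "(z_op q \<alpha> ^^ j) \<psi> \<in> H" by (rule *)
  show "(z_op q \<alpha> ^^ j) \<psi> = (\<lambda>n. if n < j then 0 else \<psi> (n - j))"
  proof (induction j)
    case (Suc j)
    have "(z_op q \<alpha> ^^ Suc j) \<psi> = (\<lambda>k. case k of 0 \<Rightarrow> 0 | Suc i \<Rightarrow> (z_op q \<alpha> ^^ j) \<psi> i)"
      using * by (simp add: z_op_def)
    then show ?case unfolding Suc by (auto simp: fun_eq_iff split: nat.split)
  qed simp
qed

lemma zs_op_power:
  assumes "\<psi> \<in> H"
  shows "(zs_op q \<alpha> ^^ k) \<psi> \<in> H"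
    "(zs_op q \<alpha> ^^ k) \<psi> = (\<lambda>n. of_real (zs_power_coeff (q\<^sup>2) (q powr (4 * \<alpha>)) (n + k) k) * \<psi> (n + k))"
proof -
  have *: "(zs_op q \<alpha> ^^ k) \<psi> \<in> H" for k
    using assms bounded_opsD(1)[OF zs_op_bounded] by (induction k) auto
  show "(zs_op q \<alpha> ^^ k) \<psi> \<in> H" by (rule *)
  show "(zs_op q \<alpha> ^^ k) \<psi> = (\<lambda>n. of_real (zs_power_coeff (q\<^sup>2) (q powr (4 * \<alpha>)) (n + k) k) * \<psi> (n + k))"
  proof (induction k)
    case (Suc k)
    have "(zs_op q \<alpha> ^^ Suc k) \<psi> = (\<lambda>n. of_real (c (Suc n)) * (zs_op q \<alpha> ^^ k) \<psi> (Suc n))"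
      using * by (simp add: zs_op_def)
    then show ?case unfolding Suc by (simp add: zs_power_coeff_Suc mult_ac)
  qed simp
qed

lemma antiwick_sum_apply:
  assumes "\<psi> \<in> H"
  shows "antiwick_sum q \<alpha> S a \<psi> n = (\<Sum>(j, k)\<in>S. a (j, k) * (if n < j then 0 else
     of_real (zs_power_coeff (q\<^sup>2) (q powr (4 * \<alpha>)) (n - j + k) k) * \<psi> (n - j + k)))"
proof -
  have "(z_op q \<alpha> ^^ j) ((zs_op q \<alpha> ^^ k) \<psi>) n = (if n < j then 0 else
     of_real (zs_power_coeff (q\<^sup>2) (q powr (4 * \<alpha>)) (n - j + k) k) * \<psi> (n - j + k))" for j k
    unfolding z_op_power(2)[OF zs_op_power(1)[OF assms]] unfolding zs_op_power(2)[OF assms] by simp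
  then show ?thesis
    using assms unfolding antiwick_sum_def adjoint_z_op by simp
qed

lemma antiwick_sum_bounded:
  assumes "finite S"
  shows "antiwick_sum q \<alpha> S a \<in> bounded_ops q \<alpha>"
proof -
  \<comment> \<open>The zeroth power is the identity, which has to be cut off outside
    \<open>L2a\<close> to lie in \<open>bounded_ops\<close>.\<close>
  have pow: "(\<lambda>\<psi>. if \<psi> \<in> H then (A ^^ n) \<psi> else (\<lambda>_. 0)) \<in> bounded_ops q \<alpha>" if A: "A \<in> bounded_ops q \<alpha>" for A n
  proof (induction n)
    case 0
    show ?case
      by (rule bounded_opsI[where M = 1]) (auto simp: L2a_add L2a_scale)
  next
    case (Suc n)
    from bounded_ops_compose[OF A Suc]
    have "(\<lambda>\<psi>. A (if \<psi> \<in> H then (A ^^ n) \<psi> else (\<lambda>_. 0))) \<in> bounded_ops q \<alpha>" .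
    moreover have "A (\<lambda>_. 0) = (\<lambda>_. 0)"
      using bounded_opsD(3)[OF A L2a_zero, of 0] by simp
    then have "(\<lambda>\<psi>. A (if \<psi> \<in> H then (A ^^ n) \<psi> else (\<lambda>_. 0))) = (\<lambda>\<psi>. if \<psi> \<in> H then (A ^^ Suc n) \<psi> else (\<lambda>_. 0))"
      by (intro ext) auto
    ultimately show ?case by simp
  qed
  show ?thesis using assms
  proof (induction S rule: finite_induct)
    case empty
    have "antiwick_sum q \<alpha> {} a = (\<lambda>_ _. 0)" by (auto simp: antiwick_sum_def fun_eq_iff)
    then show ?case by (simp add: bounded_ops_0)
  next
    case (insert x S)
    obtain j k where x: "x = (j, k)" by force
    let ?Z = "\<lambda>\<psi>. if \<psi> \<in> H then (z_op q \<alpha> ^^ j) \<psi> else (\<lambda>_. 0)"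
    let ?Zs = "\<lambda>\<psi>. if \<psi> \<in> H then (zs_op q \<alpha> ^^ k) \<psi> else (\<lambda>_. 0)"
    have "antiwick_sum q \<alpha> (insert x S) a = (\<lambda>\<psi> n. a (j, k) * ?Z (?Zs \<psi>) n + antiwick_sum q \<alpha> S a \<psi> n)"
      using insert.hyps zs_op_power(1) z_op_power(2)[OF L2a_zero]
      by (auto simp: fun_eq_iff antiwick_sum_def adjoint_z_op x)
    then show ?case
      using bounded_ops_add[OF bounded_ops_scale[OF bounded_ops_compose[OF pow[OF z_op_bounded] pow[OF zs_op_bounded]]] insert.IH]
      by simp
  qed
qed

section \<open>Matrix entries of operators and covariant symbols\<close>

private abbreviation (input) "p \<equiv> complex_of_real (q\<^sup>2)"
private abbreviation (input) "t \<equiv> complex_of_real (q powr (4 * \<alpha>))"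

lemma of_real_zs_power_coeff: "complex_of_real (zs_power_coeff a b N k) = zs_power_coeff (of_real a) (of_real b) N k"
  by (simp add: zs_power_coeff_def zs_coeff_def)

lemma t_power_neq_1: "t * p ^ n \<noteq> 1"
  by (rule of_real_mult_power_neq_1[OF q]) (use q_powr_range in simp)

lemma antiwick_sum_unit_vec:
  "antiwick_sum q \<alpha> S a (unit_vec N) n
     = (\<Sum>(j, k)\<in>S. a (j, k) * (if j \<le> n \<and> n - j + k = N then zs_power_coeff p t N k else 0))"
  unfolding antiwick_sum_apply[OF Cz_in_L2a[OF unit_vec_Cz]]
  by (intro sum.cong refl) (simp add: unit_vec_def of_real_zs_power_coeff case_prod_beta del: of_real_power)

text \<open>Only the finitely many pairs with j - k = n - N and k \<le> N contribute to this entry,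
  so the net of partial sums is eventually constant.\<close>

lemma antiwick_sum_unit_vec_eventually:
  "\<forall>\<^sub>F S in finite_subsets_at_top UNIV.
     antiwick_sum q \<alpha> S a (unit_vec N) n = symbol_entry p t a (int n - int N) N"
proof -
  define K where "K = {k. k \<le> N \<and> N \<le> k + n}"
  define T where "T = (\<lambda>k. (k + n - N, k)) ` K"
  have "finite K" by (rule finite_subset[of _ "{..N}"]) (auto simp: K_def)
  then have fin: "finite T" unfolding T_def by (rule finite_imageI)
  have *: "antiwick_sum q \<alpha> S a (unit_vec N) n = symbol_entry p t a (int n - int N) N" if S: "finite S" "T \<subseteq> S" for S
  proof -
    have "antiwick_sum q \<alpha> S a (unit_vec N) n
      = (\<Sum>(j, k)\<in>T. a (j, k) * (if j \<le> n \<and> n - j + k = N then zs_power_coeff p t N k else 0))"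
      unfolding antiwick_sum_unit_vec
      by (rule sum.mono_neutral_right) (use S in \<open>auto simp: T_def K_def image_iff\<close>)
    also have "\<dots> = (\<Sum>k\<in>K. a (k + n - N, k) * zs_power_coeff p t N k)"
      unfolding T_def by (subst sum.reindex) (auto simp: inj_on_def K_def intro!: sum.cong)
    also have "\<dots> = (\<Sum>k\<in>K. (if 0 \<le> int k + (int n - int N) then a (nat (int k + (int n - int N)), k) else 0)
        * zs_power_coeff p t N k)"
    proof (intro sum.cong refl)
      fix k assume "k \<in> K"
      then have "0 \<le> int k + (int n - int N)" "nat (int k + (int n - int N)) = k + n - N"
        by (auto simp: K_def)
      then show "a (k + n - N, k) * zs_power_coeff p t N k
        = (if 0 \<le> int k + (int n - int N) then a (nat (int k + (int n - int N)), k) else 0) * zs_power_coeff p t N k"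
        by simp
    qed
    also have "\<dots> = symbol_entry p t a (int n - int N) N"
      unfolding symbol_entry_def by (rule sum.mono_neutral_left) (auto simp: K_def)
    finally show ?thesis .
  qed
  show ?thesis
    unfolding eventually_finite_subsets_at_top using fin * by blast
qed

text \<open>Expanding a finitely supported vector in basis vectors shows that the functionals
  defining the weak topology involve only finitely many matrix entries.\<close>

lemma bounded_op_scalar_prod_Cz:
  assumes A: "A \<in> bounded_ops q \<alpha>" and F: "finite F" "{k. \<psi> k \<noteq> 0} \<subseteq> F" "{k. \<phi> k \<noteq> 0} \<subseteq> F"
  shows "scalar_prod q \<alpha> (A \<psi>) \<phi>
    = (\<Sum>n\<in>F. of_real (weight q \<alpha> n) * (\<Sum>N\<in>F. \<psi> N * A (unit_vec N) n) * cnj (\<phi> n))"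
proof -
  have "(\<lambda>k. \<Sum>N\<in>G. \<psi> N * unit_vec N k) \<in> L2a q \<alpha> \<and>
     A (\<lambda>k. \<Sum>N\<in>G. \<psi> N * unit_vec N k) = (\<lambda>k. \<Sum>N\<in>G. \<psi> N * A (unit_vec N) k)" if "finite G" for G
    using that
  proof (induction G rule: finite_induct)
    case empty
    have "A (\<lambda>_. 0) = (\<lambda>_. 0)"
      using bounded_opsD(3)[OF A L2a_zero, of 0] by simp
    then show ?case by (simp add: L2a_zero)
  next
    case (insert N G)
    note u = Cz_in_L2a[OF unit_vec_Cz[of N]]
    note s = L2a_scale[OF u, of "\<psi> N"]
    show ?case
      using insert L2a_add(1)[OF s] bounded_opsD(2)[OF A s] bounded_opsD(3)[OF A u]
      by simp
  qed
  moreover have "(\<lambda>k. \<Sum>N\<in>F. \<psi> N * unit_vec N k) = \<psi>"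
  proof
    fix k
    have "(\<Sum>N\<in>F. \<psi> N * unit_vec N k) = (\<Sum>N\<in>F. if N = k then \<psi> k else 0)"
      by (intro sum.cong) (auto simp: unit_vec_def)
    then show "(\<Sum>N\<in>F. \<psi> N * unit_vec N k) = \<psi> k" using F by auto
  qed
  ultimately have "A \<psi> = (\<lambda>k. \<Sum>N\<in>F. \<psi> N * A (unit_vec N) k)" using F(1) by metis
  moreover have "k \<notin> F \<Longrightarrow> \<phi> k = 0" for k using F(3) by blast
  ultimately show ?thesis by (simp add: scalar_prod_Cz[OF F(1)])
qed

text \<open>The topology tests finitely many entries at a time, and those of the partial sums
  eventually equal \<open>symbol_entry\<close>. Convergence is therefore equality of all
  entries.\<close>

lemma is_covariant_symbol_iff:
  assumes A: "A \<in> bounded_ops q \<alpha>"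
  shows "is_covariant_symbol q \<alpha> A a
    \<longleftrightarrow> (\<forall>N n. A (unit_vec N) n = symbol_entry p t a (int n - int N) N)"
proof
  assume L: "is_covariant_symbol q \<alpha> A a"
  show "\<forall>N n. A (unit_vec N) n = symbol_entry p t a (int n - int N) N"
  proof (intro allI)
    fix N n
    define f where "f B = scalar_prod q \<alpha> (B (unit_vec N)) (unit_vec n)" for B
    have "((\<lambda>S. f (antiwick_sum q \<alpha> S a)) \<longlongrightarrow> f A) (finite_subsets_at_top UNIV)"
    proof (rule topological_tendstoI)
      fix V assume V: "open V" "f A \<in> V"
      \<comment> \<open>The preimage of V under f is one of the generating open sets.\<close>
      define U where "U = {B \<in> bounded_ops q \<alpha>. f B \<in> V}"
      have "openin (weak_op_topology q \<alpha>) U"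
        unfolding weak_op_topology_def U_def f_def
        by (intro topology_generated_by_Basis CollectI exI[of _ "unit_vec N"] exI[of _ "unit_vec n"] exI[of _ V]
            conjI refl unit_vec_Cz V)
      moreover have "A \<in> U" using A V by (simp add: U_def)
      ultimately have "\<forall>\<^sub>F S in finite_subsets_at_top UNIV. antiwick_sum q \<alpha> S a \<in> U"
        using L by (simp add: is_covariant_symbol_def limitin_def)
      then show "\<forall>\<^sub>F S in finite_subsets_at_top UNIV. f (antiwick_sum q \<alpha> S a) \<in> V"
        by eventually_elim (simp add: U_def)
    qed
    moreover have "\<forall>\<^sub>F S in finite_subsets_at_top UNIV. f (antiwick_sum q \<alpha> S a)
        = of_real (weight q \<alpha> n) * symbol_entry p t a (int n - int N) N"
      using antiwick_sum_unit_vec_eventually[of a N n]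
      by eventually_elim (simp add: f_def scalar_prod_unit_vec)
    ultimately have "f A = of_real (weight q \<alpha> n) * symbol_entry p t a (int n - int N) N"
      by (rule tendsto_unique[OF finite_subsets_at_top_neq_bot _ tendsto_eventually])
    then show "A (unit_vec N) n = symbol_entry p t a (int n - int N) N"
      using weight_gt_0[of n] by (simp add: f_def scalar_prod_unit_vec)
  qed
next
  assume R: "\<forall>N n. A (unit_vec N) n = symbol_entry p t a (int n - int N) N"
  show "is_covariant_symbol q \<alpha> A a"
    unfolding is_covariant_symbol_def weak_op_topology_def
  proof (rule limitin_topology_generated_by)
    \<comment> \<open>With the open set \<open>UNIV\<close> the generating set is all of
      \<open>bounded_ops\<close>, so A lies in the space.\<close>
    have "(\<lambda>_. 0) \<in> Cz" by (simp add: Cz_def)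
    then have "{B \<in> bounded_ops q \<alpha>. scalar_prod q \<alpha> (B (\<lambda>_. 0)) (\<lambda>_. 0) \<in> UNIV}
      \<in> {{A \<in> bounded_ops q \<alpha>. scalar_prod q \<alpha> (A \<psi>\<^sub>1) \<psi>\<^sub>2 \<in> U} | \<psi>\<^sub>1 \<psi>\<^sub>2 U.
        \<psi>\<^sub>1 \<in> Cz \<and> \<psi>\<^sub>2 \<in> Cz \<and> open U}" by blast
    then show "A \<in> \<Union> {{A \<in> bounded_ops q \<alpha>. scalar_prod q \<alpha> (A \<psi>\<^sub>1) \<psi>\<^sub>2 \<in> U} | \<psi>\<^sub>1 \<psi>\<^sub>2 U.
        \<psi>\<^sub>1 \<in> Cz \<and> \<psi>\<^sub>2 \<in> Cz \<and> open U}" using A by blast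
  next
    fix U assume "U \<in> {{A \<in> bounded_ops q \<alpha>. scalar_prod q \<alpha> (A \<psi>\<^sub>1) \<psi>\<^sub>2 \<in> U} | \<psi>\<^sub>1 \<psi>\<^sub>2 U.
        \<psi>\<^sub>1 \<in> Cz \<and> \<psi>\<^sub>2 \<in> Cz \<and> open U}"
    then obtain \<psi> \<phi> V where U: "U = {B \<in> bounded_ops q \<alpha>. scalar_prod q \<alpha> (B \<psi>) \<phi> \<in> V}"
      and Cz: "\<psi> \<in> Cz" "\<phi> \<in> Cz" by blast
    assume "A \<in> U"
    define F where "F = {k. \<psi> k \<noteq> 0} \<union> {k. \<phi> k \<noteq> 0}"
    have F: "finite F" "{k. \<psi> k \<noteq> 0} \<subseteq> F" "{k. \<phi> k \<noteq> 0} \<subseteq> F"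
      using Cz by (auto simp: F_def Cz_def)
    have "\<forall>\<^sub>F S in finite_subsets_at_top UNIV. \<forall>N\<in>F. \<forall>n\<in>F. antiwick_sum q \<alpha> S a (unit_vec N) n = A (unit_vec N) n"
      using antiwick_sum_unit_vec_eventually R F(1) by (simp add: eventually_ball_finite_distrib)
    moreover have "\<forall>\<^sub>F S in finite_subsets_at_top UNIV. finite (S :: (nat \<times> nat) set)"
      by (rule eventually_finite_subsets_at_top_weakI)
    ultimately show "\<forall>\<^sub>F S in finite_subsets_at_top UNIV. antiwick_sum q \<alpha> S a \<in> U"
    proof eventually_elim
      case (elim S)
      note B = antiwick_sum_bounded[OF elim(2), of a]
      have "scalar_prod q \<alpha> (antiwick_sum q \<alpha> S a \<psi>) \<phi> = scalar_prod q \<alpha> (A \<psi>) \<phi>"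
        unfolding bounded_op_scalar_prod_Cz[OF B F]
          bounded_op_scalar_prod_Cz[OF A F]
        using elim(1) by simp
      then show ?case using B \<open>A \<in> U\<close> by (simp add: U)
    qed
  qed
qed

lemma quantize_product_unit_vec:
  "(quantize q \<alpha> f \<circ> quantize q \<alpha> g) (unit_vec N) n = product_matrix p t f g (int n - int N) N"
proof -
  note u = Cz_in_L2a[OF unit_vec_Cz[of N]]
  have g: "quantize q \<alpha> g (unit_vec N) \<in> L2a q \<alpha>"
    unfolding quantize_def by (rule bounded_opsD(1)[OF antiwick_sum_bounded u]) simp
  \<comment> \<open>If the integer condition holds but one of the natural-number conditions fails,
    the path falls below e_0 and \<open>product_entry\<close> is 0.\<close>
  have e: "(if n < i then 0 else zs_power_coeff p t (n - i + k) k *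
        (if l \<le> n - i + k \<and> n - i + k - l + m = N then zs_power_coeff p t N m else 0))
    = (if int l + int i = int m + int k + (int n - int N) then product_entry p t m k l N else 0)" for i k l m
  proof (cases "i \<le> n \<and> l \<le> n - i + k \<and> n - i + k - l + m = N")
    case True
    then have "int l + int i = int m + int k + (int n - int N)" and h: "N - m + l = n - i + k" by auto
    moreover have "\<not> n < i" using True by simp
    ultimately show ?thesis
      using True by (simp only: if_True if_False simp_thms product_entry_def h mult.commute)
  next
    case False
    have "product_entry p t m k l N = 0" if h: "int l + int i = int m + int k + (int n - int N)"
    proof (cases "m \<le> N")
      case True
      then have "n < i" using False h by auto
      then have "N - m + l < k" using True h by auto
      then show ?thesis by (simp add: product_entry_def zs_power_coeff_eq_0)
    qed (simp add: product_entry_def zs_power_coeff_eq_0)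
    then show ?thesis using False by auto
  qed
  have "(quantize q \<alpha> f \<circ> quantize q \<alpha> g) (unit_vec N) n
    = (\<Sum>(i, k)\<in>keys f. \<Sum>(l, m)\<in>keys g. lookup f (i, k) * lookup g (l, m) *
      (if n < i then 0 else zs_power_coeff p t (n - i + k) k *
        (if l \<le> n - i + k \<and> n - i + k - l + m = N then zs_power_coeff p t N m else 0)))"
    unfolding comp_apply quantize_def[of q \<alpha> f] antiwick_sum_apply[OF g] of_real_zs_power_coeff
    unfolding quantize_def antiwick_sum_unit_vec case_prod_beta
  proof (intro sum.cong refl)
    fix b
    show "lookup f (fst b, snd b) * (if n < fst b then 0 else zs_power_coeff p t (n - fst b + snd b) (snd b)
         * (\<Sum>e\<in>keys g. lookup g (fst e, snd e) * F e))
      = (\<Sum>e\<in>keys g. lookup f (fst b, snd b) * lookup g (fst e, snd e)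
         * (if n < fst b then 0 else zs_power_coeff p t (n - fst b + snd b) (snd b) * F e))" for F
      by (cases "n < fst b") (simp_all add: sum_distrib_left sum_distrib_right mult_ac)
  qed
  then show ?thesis unfolding e product_matrix_def .
qed

text \<open>Solving the triangular system for the entries of the product gives a covariant symbol,
  and uniqueness makes it the one selected by the definite description.\<close>

lemma covariant_symbol_product:
  "symbol_entry p t (covariant_symbol q \<alpha> (quantize q \<alpha> f \<circ> quantize q \<alpha> g)) d N
     = product_matrix p t f g d N"
proof -
  let ?A = "quantize q \<alpha> f \<circ> quantize q \<alpha> g"
  have A: "?A \<in> bounded_ops q \<alpha>"
    unfolding comp_def quantize_def
    by (rule bounded_ops_compose[OF antiwick_sum_bounded antiwick_sum_bounded]) simp_all
  obtain a where a: "\<And>d N. symbol_entry p t a d N = product_matrix p t f g d N"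
    using symbol_entry_exists[OF of_real_power_neq_1[OF q] t_power_neq_1, of "product_matrix p t f g"] product_matrix_eq_0 by blast
  have "covariant_symbol q \<alpha> ?A = a"
    unfolding covariant_symbol_def
  proof (rule the_equality)
    show "is_covariant_symbol q \<alpha> ?A a"
      unfolding is_covariant_symbol_iff[OF A] by (simp only: a quantize_product_unit_vec simp_thms)
    fix b assume b: "is_covariant_symbol q \<alpha> ?A b"
    show "b = a"
    proof (rule symbol_entry_unique[OF of_real_power_neq_1[OF q] t_power_neq_1])
      fix d N assume "0 \<le> int N + d"
      then have d: "int (nat (int N + d)) - int N = d" by simp
      from b have "?A (unit_vec N) (nat (int N + d)) = symbol_entry p t b d N"
        unfolding is_covariant_symbol_iff[OF A] by (metis d)
      then show "symbol_entry p t b d N = symbol_entry p t a d N"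
        unfolding quantize_product_unit_vec d a ..
    qed
  qed
  then show ?thesis using a by simp
qed

end

section \<open>Asymptotics of the covariant symbol of a product\<close>

lemma m_t_entry:
  assumes "0 < q" "q < 1" "0 < t" "t < 1"
  defines "p \<equiv> complex_of_real (q\<^sup>2)"
  shows "symbol_entry p 0 (m_t q t f g) d M = qmean p (of_real t * p) M (product_matrix p (of_real t) f g d)"
proof -
  note par = m_t_parameter[OF assms(1-4)]
  have nz: "complex_of_real t * p ^ n \<noteq> 1" for n
    unfolding p_def by (rule of_real_mult_power_neq_1) (use assms in simp_all)
  have "symbol_entry p (of_real t) (m_t q t f g) d N = product_matrix p (of_real t) f g d N" for N
    unfolding m_t_def Let_def p_def
    by (rule covariant_symbol_product[OF assms(1,2) par(1), unfolded par(2)])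
  then have "symbol_entry p (of_real t) (m_t q t f g) d = product_matrix p (of_real t) f g d" ..
  \<comment> \<open>Averaging moves from the system at t to the fixed system at 0.\<close>
  then show ?thesis using qmean_symbol_entry[OF nz, of M "m_t q t f g" d] by simp
qed

text \<open>The triangular system at t = 0 is constant, so each symbol coefficient is a fixed linear
  combination of an entry and earlier coefficients on its diagonal.\<close>

lemma power_series_asymptotics_symbol:
  assumes nz: "\<And>n. p ^ Suc n \<noteq> 1"
    and entry: "\<And>d N. power_series_asymptotics (\<lambda>t. symbol_entry p 0 (a t) d N) (\<lambda>K. symbol_entry p 0 (b K) d N)"
  shows "power_series_asymptotics (\<lambda>t. a t i) (\<lambda>K. b K i)"
proof -
  have "power_series_asymptotics (\<lambda>t. if 0 \<le> int k + d then a t (nat (int k + d), k) else 0)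
      (\<lambda>K. if 0 \<le> int k + d then b K (nat (int k + d), k) else 0)" for k d
  proof (induction k rule: less_induct)
    case (less k)
    define z where "z = zs_power_coeff p 0 k"
    have z: "z k \<noteq> 0" unfolding z_def by (rule zs_power_coeff_nonzero[OF nz]) simp_all
    define c where "c x i = (if 0 \<le> int i + d then x (nat (int i + d), i) else 0)" for x :: "nat \<times> nat \<Rightarrow> complex" and i
    have s: "c x k = inverse (z k) * (symbol_entry p 0 x d k - (\<Sum>i<k. z i * c x i))" for x
      using z by (simp add: symbol_entry_split c_def z_def mult.commute)
    have "power_series_asymptotics (\<lambda>t. \<Sum>i<k. z i * c (a t) i) (\<lambda>K. \<Sum>i<k. z i * c (b K) i)"
      unfolding c_def by (intro power_series_asymptotics_sum power_series_asymptotics_cmult less.IH) simp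
    then have "power_series_asymptotics (\<lambda>t. c (a t) k) (\<lambda>K. c (b K) k)"
      unfolding s by (intro power_series_asymptotics_cmult power_series_asymptotics_diff entry)
    then show ?case unfolding c_def .
  qed
  from this[of "snd i" "int (fst i) - int (snd i)"] show ?thesis by simp
qed

theorem theorem3p1:
  fixes q :: real and f\<^sub>1 f\<^sub>2 :: pol
  assumes "0 < q" and "q < 1"
  shows "asymptotic_expansion (\<lambda>t. m_t q t f\<^sub>1 f\<^sub>2)
           (\<lambda>k. Poly_Mapping.lookup (fps_nth (star_product q f\<^sub>1 f\<^sub>2) k))"
  unfolding asymptotic_expansion_iff
proof
  fix i
  let ?p = "complex_of_real (q\<^sup>2)"
  show "power_series_asymptotics (\<lambda>t. m_t q t f\<^sub>1 f\<^sub>2 i) (\<lambda>k. lookup (fps_nth (star_product q f\<^sub>1 f\<^sub>2) k) i)"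
  proof (rule power_series_asymptotics_symbol)
    show "?p ^ Suc n \<noteq> 1" for n
      by (rule of_real_power_neq_1[OF assms])
    fix d N
    have nth: "fps_nth (Abs_fps h) = h" for h :: "nat \<Rightarrow> complex" by (rule ext) simp
    have "\<forall>\<^sub>F t in at_right 0. t < (1 :: real)"
      by (rule order_tendstoD(2)[OF tendsto_ident_at]) simp
    then have "\<forall>\<^sub>F t in at_right 0. symbol_entry ?p 0 (m_t q t f\<^sub>1 f\<^sub>2) d N
        = qmean ?p (of_real t * ?p) N (product_matrix ?p (of_real t) f\<^sub>1 f\<^sub>2 d)"
      using eventually_at_right_less[of 0]
    proof eventually_elim
      case (elim t)
      show ?case by (rule m_t_entry[OF assms elim(2,1)])
    qed
    \<comment> \<open>For 0 < t < 1 the entry coincides with a function analytic at 0 whose Taylor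
      coefficients are the entries of the star product.\<close>
    from power_series_asymptotics_fps[OF star_product_entry_expansion[OF assms] this]
    show "power_series_asymptotics (\<lambda>t. symbol_entry ?p 0 (m_t q t f\<^sub>1 f\<^sub>2) d N)
      (\<lambda>K. symbol_entry ?p 0 (lookup (fps_nth (star_product q f\<^sub>1 f\<^sub>2) K)) d N)"
      unfolding nth .
  qed
qed

end
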